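(* Let $1\leq p<+\infty$, $1\leq q\leq+\infty$, and let $g\in\mathcal{H}(\mathbb{D})$. Then: (1) The operator $T_g:RM(p,q)\rightarrow RM(p,q)$ is bounded if and only if $g\in\mathcal{B}$. (2) The operator $T_g:RM(p,0)\rightarrow RM(p,0)$ is bounded if and only if $g\in\mathcal{B}$. (3) The operator $T_g:RM(p,q)\rightarrow RM(p,q)$ is compact if and only if $g\in\mathcal{B}_0$. (4) The operator $T_g:RM(p,0)\rightarrow RM(p,0)$ is compact if and only if $g\in\mathcal{B}_0$.
   Context: $\mathbb{D}$ is the open unit disc of $\mathbb{C}$ and $\mathcal{H}(\mathbb{D})$ the space of analytic functions on $\mathbb{D}$. For $1\leq p<+\infty$ and $1\le q\leq +\infty$, $RM(p,q)=\{f\in\mathcal{H}(\mathbb{D}):\rho_{p,q}(f)<+\infty\}$, a Banach space with norm $\rho_{p,q}$, where $$\rho_{p,q}(f)=\Big(\frac{1}{2\pi}\int_0^{2\pi}\Big(\int_0^1|f(re^{it})|^p\,dr\Big)^{q/p}dt\Big)^{1/q}\ (q<+\infty),\qquad \rho_{p,\infty}(f)=\operatorname{ess\,sup}_{t\in[0,2\pi)}\Big(\int_0^1|f(re^{it})|^p\,dr\Big)^{1/p}.$$ $RM(p,0)$ is the closed subspace of $RM(p,\infty)$ (with norm $\rho_{p,\infty}$) consisting of the $f\in\mathcal{H}(\mathbb{D})$ with $\lim_{\rho\to1}\sup_\theta\big(\int_\rho^1|f(re^{i\theta})|^p\,dr\big)^{1/p}=0$. The Bloch space $\mathcal{B}$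 is the set of $f\in\mathcal{H}(\mathbb{D})$ with $\sup_{z\in\mathbb{D}}(1-|z|^2)|f'(z)|<+\infty$; the little Bloch space $\mathcal{B}_0$ consists of the $f\in\mathcal{B}$ with $\lim_{|z|\to1}(1-|z|^2)|f'(z)|=0$. For $g\in\mathcal{H}(\mathbb{D})$, the integration operator is $T_g(f)(z)=\int_0^z f(w)g'(w)\,dw$, $z\in\mathbb{D}$. Saying that $T_g:X\to X$ is bounded (compact) includes that $T_g$ maps $X$ into $X$. *)

theory Defs
  imports
    "HOL-Complex_Analysis.Complex_Analysis"
    "HOL-Probability.Essential_Supremum"
begin

text \<open>An analytic function on the open unit disc is encoded by its extension by \<open>0\<close> to the
  whole plane, so that equality in \<open>HD\<close> is equality on the disc and the norms below separate
  points.\<close>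

abbreviation disc :: "complex set" where
  "disc \<equiv> ball 0 1"

definition HD :: "(complex \<Rightarrow> complex) set" where
  "HD = {f. f holomorphic_on disc \<and> (\<forall>z. z \<notin> disc \<longrightarrow> f z = 0)}"

text \<open>The power \<open>x\<^sup>a\<close> for \<open>x \<in> [0,\<infinity>]\<close>; only used with \<open>a > 0\<close>.\<close>

definition ennpow :: "ennreal \<Rightarrow> real \<Rightarrow> ennreal" where
  "ennpow x a = (if x = \<infinity> then \<infinity> else ennreal (enn2real x powr a))"

text \<open>\<open>radial_int p f s t\<close> is the integral of \<open>|f(r e\<^sup>i\<^sup>t)|\<^sup>p\<close> over \<open>s \<le> r < 1\<close>.\<close>

definition radial_int :: "real \<Rightarrow> (complex \<Rightarrow> complex) \<Rightarrow> real \<Rightarrow> real \<Rightarrow> ennreal" where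
  "radial_int p f s t = (\<integral>\<^sup>+ r\<in>{s..<1}. ennreal (norm (f (of_real r * cis t)) powr p) \<partial>lborel)"

definition rho :: "real \<Rightarrow> ennreal \<Rightarrow> (complex \<Rightarrow> complex) \<Rightarrow> ennreal" where
  "rho p q f =
     (if q = \<infinity>
      then esssup (restrict_space lborel {0..<2*pi}) (\<lambda>t. ennpow (radial_int p f 0 t) (1 / p))
      else ennpow (ennreal (1 / (2*pi)) *
                     (\<integral>\<^sup>+ t\<in>{0..2*pi}. ennpow (radial_int p f 0 t) (enn2real q / p) \<partial>lborel))
                  (1 / enn2real q))"

definition RM :: "real \<Rightarrow> ennreal \<Rightarrow> (complex \<Rightarrow> complex) set" where
  "RM p q = {f \<in> HD. rho p q f < \<infinity>}"

text \<open>The space \<open>RM(p,0)\<close>, which carries the norm of \<open>RM(p,\<infinity>)\<close>.\<close>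

definition RM0 :: "real \<Rightarrow> (complex \<Rightarrow> complex) set" where
  "RM0 p = {f \<in> RM p \<infinity>.
     ((\<lambda>s. SUP \<theta>. ennpow (radial_int p f s \<theta>) (1 / p)) \<longlongrightarrow> 0) (at_left 1)}"

definition rho_norm :: "real \<Rightarrow> ennreal \<Rightarrow> (complex \<Rightarrow> complex) \<Rightarrow> real" where
  "rho_norm p q f = enn2real (rho p q f)"

definition Bloch :: "(complex \<Rightarrow> complex) set" where
  "Bloch = {f \<in> HD. bdd_above ((\<lambda>z. (1 - (norm z)\<^sup>2) * norm (deriv f z)) ` disc)}"

text \<open>The filter below expresses \<open>|z| \<rightarrow> 1\<close> with \<open>|z| < 1\<close>.\<close>

definition little_Bloch :: "(complex \<Rightarrow> complex) set" where
  "little_Bloch = {f \<in> Bloch.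
     ((\<lambda>z. (1 - (norm z)\<^sup>2) * norm (deriv f z)) \<longlongrightarrow> 0) (filtercomap norm (at_left 1))}"

definition T_op :: "(complex \<Rightarrow> complex) \<Rightarrow> (complex \<Rightarrow> complex) \<Rightarrow> complex \<Rightarrow> complex" where
  "T_op g f z =
     (if z \<in> disc then contour_integral (linepath 0 z) (\<lambda>w. f w * deriv g w) else 0)"

text \<open>Boundedness and compactness of a linear self-map \<open>T\<close> of the function space \<open>X\<close> with
  norm \<open>N\<close>. Linearity is not part of these predicates, since \<open>T_op g\<close> is linear on \<open>HD\<close>.\<close>

definition bounded_op ::
    "('a \<Rightarrow> complex) set \<Rightarrow> (('a \<Rightarrow> complex) \<Rightarrow> real) \<Rightarrow> (('a \<Rightarrow> complex) \<Rightarrow> ('a \<Rightarrow> complex)) \<Rightarrow> bool" where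
  "bounded_op X N T \<longleftrightarrow> T ` X \<subseteq> X \<and> (\<exists>C. \<forall>f\<in>X. N (T f) \<le> C * N f)"

definition norm_topology ::
    "('a \<Rightarrow> complex) set \<Rightarrow> (('a \<Rightarrow> complex) \<Rightarrow> real) \<Rightarrow> ('a \<Rightarrow> complex) topology" where
  "norm_topology X N = Metric_space.mtopology X (\<lambda>f h. N (\<lambda>z. f z - h z))"

definition compact_op ::
    "('a \<Rightarrow> complex) set \<Rightarrow> (('a \<Rightarrow> complex) \<Rightarrow> real) \<Rightarrow> (('a \<Rightarrow> complex) \<Rightarrow> ('a \<Rightarrow> complex)) \<Rightarrow> bool" where
  "compact_op X N T \<longleftrightarrow>
     T ` X \<subseteq> X \<and>
     compactin (norm_topology X N) (norm_topology X N closure_of (T ` {f \<in> X. N f \<le> 1}))"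

end

theory Submission
  imports Defs
begin

text \<open>
  For \<open>F = T\<^sub>g f\<close> the Bloch condition gives \<open>|F'(r e\<^sup>i\<^sup>t)| \<le> C |f(r e\<^sup>i\<^sup>t)| / (1 - r)\<close>, so on each radius \<open>|F|\<close> is
  dominated by the dual Hardy operator \<open>u \<mapsto> \<integral>\<^sub>0\<^sup>r u(s) / (1 - s) ds\<close> applied to \<open>|f|\<close>, which is bounded on
  \<open>L\<^sup>p(0,1)\<close>; this yields boundedness for all \<open>q\<close> at once. For \<open>g\<close> in the little Bloch space the constant is
  arbitrarily small up to a bounded term supported in a smaller disc, and Montel's theorem gives compactness.

  Conversely, averaging Cauchy's formula over the circles of radius \<open>r \<ge> (1 + |a|) / 2\<close> and using Jensen's
  inequality with respect to the Poisson kernel yields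
  \<open>|F'(a)| \<le> K (1 - |a|)\<^sup>-\<^sup>(\<^sup>1\<^sup>+\<^sup>1\<^sup>/\<^sup>p\<^sup>+\<^sup>1\<^sup>/\<^sup>q\<^sup>) \<rho>(F)\<close>. Applied to the images of the normalised functions
  \<open>(1 - |a|)\<^sup>3\<^sup>-\<^sup>1\<^sup>/\<^sup>p\<^sup>-\<^sup>1\<^sup>/\<^sup>q / (1 - cnj a z)\<^sup>3\<close>, which tend to \<open>0\<close> locally uniformly as \<open>|a| \<rightarrow> 1\<close>, this bounds
  \<open>(1 - |a|) |g'(a)|\<close> by a multiple of the norm of the image.
\<close>

section \<open>Powers in \<open>[0,\<infinity>]\<close> and the \<open>L\<^sup>p\<close> seminorm\<close>

text \<open>Cauchy's formula integrates over angles at a fixed radius, whereas \<open>rho\<close>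
  integrates over the radius first. The two orders are reconciled by enlarging the kernel to
  \<open>8 / (norm (cis t - a))\<^sup>2\<close>, which no longer depends on \<open>r\<close>: after
  averaging over \<open>r\<close>, Tonelli's theorem moves the radial integral inside. The exponent
  3 of the test functions exceeds \<open>1/p + 1/q \<le> 2\<close>, so their scaling factor tends to
  0; it also leaves a nonpositive power of \<open>norm (cis t - a)\<close> once the square needed
  for the Poisson integral has been split off. Compactness on RM(p,0) has an obstacle of its own: a
  locally uniform limit of functions in its unit ball is only known to lie in RM(p,\<infinity>). It
  is overcome because, for \<open>g\<close> in the little Bloch space, \<open>T_op g\<close> maps
  all of RM(p,\<infinity>) into RM(p,0). No constant has to be sharp, so a Jensen inequality with a
  factor 2 takes the place of Hoelder's inequality, and estimates are carried out in
  \<open>[0,\<infinity>]\<close>, where no integrability has to be checked.\<close>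

lemma ennpow_ennreal: "0 \<le> x \<Longrightarrow> ennpow (ennreal x) a = ennreal (x powr a)"
  by (simp add: ennpow_def)

lemma ennpow_top [simp]: "ennpow top a = top"
  by (simp add: ennpow_def)

lemma ennpow_0 [simp]: "ennpow 0 a = 0"
  by (simp add: ennpow_def)

lemma ennpow_1 [simp]: "ennpow x 1 = x"
  by (cases x) (auto simp: ennpow_def)

lemma ennpow_eq_0_iff: "ennpow x a = 0 \<longleftrightarrow> x = 0"
  by (cases x) (auto simp: ennpow_def)

lemma ennpow_mono: "x \<le> y \<Longrightarrow> 0 \<le> a \<Longrightarrow> ennpow x a \<le> ennpow y a"
  by (cases x; cases y) (auto simp: ennpow_def powr_mono2 top_unique)

lemma ennpow_ennpow: "ennpow (ennpow x a) b = ennpow x (a * b)"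
  by (cases x) (auto simp: ennpow_def powr_powr)

lemma ennpow_mult: "0 < a \<Longrightarrow> ennpow (x * y) a = ennpow x a * ennpow y a"
  by (cases x; cases y)
    (auto simp: ennpow_def powr_mult ennreal_mult ennreal_mult_top ennreal_top_mult ennreal_mult_eq_top_iff
      simp flip: ennreal_mult)

lemma ennpow_inverse: "0 < a \<Longrightarrow> ennpow (ennpow x a) (1 / a) = x"
  by (simp add: ennpow_ennpow)

lemma ennpow_inverse': "0 < a \<Longrightarrow> ennpow (ennpow x (1 / a)) a = x"
  by (simp add: ennpow_ennpow)

lemma ennpow_le_iff: "0 < a \<Longrightarrow> ennpow x (1 / a) \<le> y \<longleftrightarrow> x \<le> ennpow y a"
  using ennpow_mono[of x "ennpow y a" "1 / a"] ennpow_mono[of "ennpow x (1 / a)" y a]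
  by (auto simp: ennpow_ennpow)

lemma ennpow_less_iff: "0 < a \<Longrightarrow> y < ennpow x a \<longleftrightarrow> ennpow y (1 / a) < x"
  using ennpow_le_iff[of "1 / a" x y] by (auto simp: not_le[symmetric])

lemma measurable_ennpow [measurable]:
  assumes [measurable]: "f \<in> borel_measurable M"
  shows "(\<lambda>x. ennpow (f x) a) \<in> borel_measurable M"
  unfolding ennpow_def by measurable

text \<open>Since the power is an order isomorphism of \<open>[0,\<infinity>]\<close>, strict lower
  bounds pass through it in both directions; this is what turns Fatou's lemma for integrals into
  Fatou's lemma for norms.\<close>

lemma ennpow_Liminf_le:
  assumes a: "0 < a"
  shows "ennpow (Liminf F u) a \<le> Liminf F (\<lambda>n. ennpow (u n) a)"
proof (subst le_Liminf_iff, intro allI impI)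
  fix y assume "y < ennpow (Liminf F u) a"
  then have "ennpow y (1 / a) < Liminf F u" using a by (simp add: ennpow_less_iff)
  then have "eventually (\<lambda>n. ennpow y (1 / a) < u n) F" by (rule less_LiminfD)
  then show "eventually (\<lambda>n. y < ennpow (u n) a) F"
    using a by (simp add: ennpow_less_iff)
qed

text \<open>A lossy convexity inequality; it gives Jensen's inequality up to a factor \<open>2\<close>.\<close>

lemma le_add_ennpow:
  assumes l: "0 < l" and p: "1 \<le> p"
  shows "x \<le> ennreal l + ennreal (l powr (1 - p)) * ennpow x p"
proof (cases x)
  case (real r)
  show ?thesis
  proof (cases "r \<le> l")
    case True
    then have "x \<le> ennreal l" using real by (simp add: ennreal_leI)
    then show ?thesis by (rule order_trans) simp
  next
    case False
    then have "r > 0" using l by simp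
    have "r powr (1 - p) \<le> l powr (1 - p)"
      using False l p by (intro powr_mono2') auto
    then have "r powr (1 - p) * r powr p \<le> l powr (1 - p) * r powr p"
      by (intro mult_right_mono) auto
    moreover have "r powr (1 - p) * r powr p = r"
      using \<open>r > 0\<close> by (simp flip: powr_add)
    ultimately have "ennreal r \<le> ennreal (l powr (1 - p) * r powr p)"
      by (simp add: ennreal_leI)
    then show ?thesis
      using real by (simp add: ennpow_ennreal ennreal_mult add_increasing)
  qed
next
  case top
  then show ?thesis using l by (simp add: ennpow_def ennreal_mult_top)
qed

text \<open>The affine bound \<open>le_add_ennpow\<close> is integrated with a free parameter
  \<open>l\<close>, which is then chosen to balance the two terms. Only an upper bound
  \<open>W\<close> for the mass is required, so the lemma applies to weights whose mass is merely
  estimated.\<close>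

lemma jensen_ennpow:
  assumes p: "1 \<le> p" and W: "0 < W" "emeasure M (space M) \<le> ennreal W"
    and [measurable]: "u \<in> borel_measurable M"
  shows "(\<integral>\<^sup>+x. u x \<partial>M) \<le> ennreal (2 * W powr (1 - 1 / p)) * ennpow (\<integral>\<^sup>+x. ennpow (u x) p \<partial>M) (1 / p)"
proof -
  define K where "K = (\<integral>\<^sup>+x. ennpow (u x) p \<partial>M)"
  have main: "(\<integral>\<^sup>+x. u x \<partial>M) \<le> ennreal (l * W) + ennreal (l powr (1 - p)) * K" if l: "0 < l" for l
  proof -
    have "(\<integral>\<^sup>+x. u x \<partial>M) \<le> (\<integral>\<^sup>+x. ennreal l + ennreal (l powr (1 - p)) * ennpow (u x) p \<partial>M)"
      by (intro nn_integral_mono le_add_ennpow p l)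
    also have "\<dots> = ennreal l * emeasure M (space M) + ennreal (l powr (1 - p)) * K"
      by (subst nn_integral_add) (auto simp: nn_integral_cmult K_def)
    also have "\<dots> \<le> ennreal l * ennreal W + ennreal (l powr (1 - p)) * K"
      by (intro add_mono mult_left_mono W) auto
    finally show ?thesis using l W by (simp add: ennreal_mult)
  qed
  consider "K = \<infinity>" | "K = 0" | k where "K = ennreal k" "0 < k"
    by (cases K) (auto simp: le_less)
  then show ?thesis
  proof cases
    case 1
    then show ?thesis unfolding K_def[symmetric] using W by (simp add: ennreal_mult_top)
  next
    case 2
    then have "AE x in M. ennpow (u x) p = 0"
      unfolding K_def by (subst (asm) nn_integral_0_iff_AE) auto
    then have "(\<integral>\<^sup>+x. u x \<partial>M) = 0"
      by (subst nn_integral_0_iff_AE) (auto simp: ennpow_eq_0_iff)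
    then show ?thesis by simp
  next
    case 3
    \<comment> \<open>Both terms agree when \<open>l powr p = k / W\<close>; each then equals
      \<open>W powr (1 - 1 / p) * k powr (1 / p)\<close>, hence the factor 2. For
      \<open>K = 0\<close> or \<open>K = \<infinity>\<close> there is no such positive real
      \<open>l\<close>.\<close>
    define l where "l = (k / W) powr (1 / p)"
    have l: "0 < l" using 3 W by (simp add: l_def)
    have 1: "l * W = W powr (1 - 1 / p) * k powr (1 / p)"
      using 3 W p by (simp add: l_def powr_divide powr_diff)
    have "l powr (1 - p) * k = k powr (1 / p) * W powr (1 - 1 / p)"
    proof -
      have "l powr (1 - p) * k = (k / W) powr (1 / p - 1) * k powr 1"
        unfolding l_def powr_powr using p 3 by (simp add: field_simps)
      also have "\<dots> = (k powr (1 / p - 1) * k powr 1) * W powr (- (1 / p - 1))"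
        using 3 W by (simp add: powr_divide powr_minus_divide del: minus_diff_eq)
      also have "\<dots> = k powr (1 / p) * W powr (1 - 1 / p)"
        by (simp only: powr_add[symmetric]) simp
      finally show ?thesis .
    qed
    then have "l * W + l powr (1 - p) * k = 2 * W powr (1 - 1 / p) * k powr (1 / p)"
      using 1 by simp
    then show ?thesis
      using main[OF l] 3 W l unfolding K_def[symmetric]
      by (simp add: ennpow_ennreal flip: ennreal_mult ennreal_plus)
  qed
qed

section \<open>The \<open>Lp\<close> seminorm of functions with values in
  \<open>[0,\<infinity>]\<close>\<close>

definition Lp :: "'a measure \<Rightarrow> real \<Rightarrow> ('a \<Rightarrow> ennreal) \<Rightarrow> ennreal" where
  "Lp M p u = ennpow (\<integral>\<^sup>+x. ennpow (u x) p \<partial>M) (1 / p)"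

lemma Lp_mono:
  assumes "0 < p" "AE x in M. u x \<le> v x"
  shows "Lp M p u \<le> Lp M p v"
  unfolding Lp_def using assms by (intro ennpow_mono nn_integral_mono_AE) (auto elim!: eventually_mono intro: ennpow_mono)

lemma Lp_cmult:
  assumes "0 < p" "u \<in> borel_measurable M"
  shows "Lp M p (\<lambda>x. c * u x) = c * Lp M p u"
  unfolding Lp_def using assms by (simp add: ennpow_mult nn_integral_cmult ennpow_inverse)

lemma Lp_const:
  assumes "0 < p"
  shows "Lp M p (\<lambda>x. c) = c * ennpow (emeasure M (space M)) (1 / p)"
  unfolding Lp_def using assms by (simp add: ennpow_mult ennpow_inverse)

lemma Lp_eq_0:
  assumes "0 < p" "u \<in> borel_measurable M" "Lp M p u = 0"
  shows "AE x in M. u x = 0"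
  using assms unfolding Lp_def by (simp add: ennpow_eq_0_iff nn_integral_0_iff_AE)

text \<open>Fatou's lemma in norm form. It is the source of lower semicontinuity below: in the
  function, in the angle and, for finite \<open>q\<close>, in the outer norm.\<close>

lemma Lp_liminf:
  assumes p: "0 < p" and [measurable]: "\<And>n. u n \<in> borel_measurable M"
  shows "Lp M p (\<lambda>x. liminf (\<lambda>n. u n x)) \<le> liminf (\<lambda>n. Lp M p (u n))"
proof -
  have "(\<integral>\<^sup>+x. ennpow (liminf (\<lambda>n. u n x)) p \<partial>M) \<le> (\<integral>\<^sup>+x. liminf (\<lambda>n. ennpow (u n x) p) \<partial>M)"
    by (intro nn_integral_mono ennpow_Liminf_le p)
  also have "\<dots> \<le> liminf (\<lambda>n. \<integral>\<^sup>+x. ennpow (u n x) p \<partial>M)"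
    by (rule nn_integral_liminf) auto
  finally have "Lp M p (\<lambda>x. liminf (\<lambda>n. u n x)) \<le> ennpow (liminf (\<lambda>n. \<integral>\<^sup>+x. ennpow (u n x) p \<partial>M)) (1 / p)"
    unfolding Lp_def using p by (intro ennpow_mono) auto
  also have "\<dots> \<le> liminf (\<lambda>n. Lp M p (u n))"
    unfolding Lp_def using p by (intro ennpow_Liminf_le) auto
  finally show ?thesis .
qed

lemma convex_ennpow:
  assumes p: "1 \<le> p" and s: "0 \<le> s" "s \<le> 1"
  shows "ennpow (ennreal s * x + ennreal (1 - s) * y) p \<le> ennreal s * ennpow x p + ennreal (1 - s) * ennpow y p"
proof -
  consider "s = 0" | "s = 1" | "0 < s" "s < 1" using s by fastforce
  then show ?thesis
  proof cases
    case 3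
    show ?thesis
    proof (cases "x = \<infinity> \<or> y = \<infinity>")
      case True
      then show ?thesis using 3 by (auto simp: ennreal_mult_top)
    next
      case False
      then obtain a b where ab: "x = ennreal a" "y = ennreal b" "0 \<le> a" "0 \<le> b"
        by (cases x; cases y) auto
      \<comment> \<open>This covers a vanishing argument, where convexity reduces to
        \<open>r powr p \<le> r\<close> for \<open>0 < r < 1\<close>.\<close>
      have less: "(r * c) powr p \<le> r * c powr p" if "0 < r" "r < 1" "0 \<le> c" for r c :: real
        using powr_mono'[of 1 p r] p that by (simp add: powr_mult mult_right_mono)
      have "(s * a + (1 - s) * b) powr p \<le> s * a powr p + (1 - s) * b powr p"
      proof (cases "a = 0 \<or> b = 0")
        case True
        then show ?thesis using less[of s a] less[of "1 - s" b] 3 ab by auto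
      next
        case False
        then show ?thesis
          using powr_convex[OF p] ab 3 unfolding convex_on_def
            by (auto dest!: bspec[of _ _ a] bspec[of _ _ b] spec[of _ s] spec[of _ "1 - s"])
      qed
      then show ?thesis
        using ab 3 by (simp add: ennpow_ennreal ennreal_leI flip: ennreal_mult ennreal_plus)
    qed
  qed simp_all
qed

text \<open>Minkowski's inequality from convexity alone: with \<open>a\<close> and \<open>b\<close>
  the two norms, \<open>(u + v) / (a + b)\<close> is the convex combination of \<open>u / a\<close>
  and \<open>v / b\<close> with weight \<open>a / (a + b)\<close>, and both of these have norm 1. A
  vanishing norm is treated apart, since it cannot be divided by.\<close>

lemma Lp_triangle:
  assumes p: "1 \<le> p" and [measurable]: "u \<in> borel_measurable M" "v \<in> borel_measurable M"
  shows "Lp M p (\<lambda>x. u x + v x) \<le> Lp M p u + Lp M p v"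
proof -
  consider "Lp M p u = \<infinity> \<or> Lp M p v = \<infinity>" | "Lp M p u = 0" | "Lp M p v = 0"
    | a b where "Lp M p u = ennreal a" "Lp M p v = ennreal b" "0 < a" "0 < b"
    by (cases "Lp M p u"; cases "Lp M p v") (auto simp: le_less)
  then show ?thesis
  proof cases
    case 2
    then have "AE x in M. u x = 0" using p by (intro Lp_eq_0) auto
    then show ?thesis using p 2 by (auto intro!: Lp_mono)
  next
    case 3
    then have "AE x in M. v x = 0" using p by (intro Lp_eq_0) auto
    then show ?thesis using p 3 by (auto intro!: Lp_mono)
  next
    case (4 a b)
    define s where "s = a / (a + b)"
    have s: "0 < s" "s < 1" using 4 by (auto simp: s_def)
    have s1: "1 - s = b / (a + b)" using 4 by (simp add: s_def field_simps)
    have int: "(\<integral>\<^sup>+x. ennpow (u x) p \<partial>M) = ennreal (a powr p)" "(\<integral>\<^sup>+x. ennpow (v x) p \<partial>M) = ennreal (b powr p)"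
      using 4 p unfolding Lp_def by (metis ennpow_ennreal ennpow_inverse' less_eq_real_def less_le_trans zero_less_one)+
    have eq: "ennreal (1 / (a + b)) * (u x + v x)
        = ennreal s * (ennreal (1 / a) * u x) + ennreal (1 - s) * (ennreal (1 / b) * v x)" for x
      using 4 unfolding s1 unfolding s_def by (simp add: distrib_left mult.assoc[symmetric] flip: ennreal_mult)
    have "(\<integral>\<^sup>+x. ennpow (ennreal (1 / (a + b)) * (u x + v x)) p \<partial>M)
      \<le> (\<integral>\<^sup>+x. ennreal s * ennpow (ennreal (1 / a) * u x) p + ennreal (1 - s) * ennpow (ennreal (1 / b) * v x) p \<partial>M)"
      unfolding eq by (intro nn_integral_mono convex_ennpow p) (use s in auto)
    also have "\<dots> = ennreal s * (ennpow (ennreal (1 / a)) p * ennreal (a powr p))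
        + ennreal (1 - s) * (ennpow (ennreal (1 / b)) p * ennreal (b powr p))"
      using p by (simp add: nn_integral_add nn_integral_cmult ennpow_mult int)
    also have "\<dots> = 1"
      using 4 s by (simp add: ennpow_ennreal powr_divide flip: ennreal_mult ennreal_plus)
    finally have "Lp M p (\<lambda>x. ennreal (1 / (a + b)) * (u x + v x)) \<le> 1"
      unfolding Lp_def using p by (subst ennpow_le_iff) (auto simp: ennpow_def)
    then have "ennreal (1 / (a + b)) * Lp M p (\<lambda>x. u x + v x) \<le> 1"
      using p by (simp add: Lp_cmult)
    then have "ennreal (a + b) * (ennreal (1 / (a + b)) * Lp M p (\<lambda>x. u x + v x)) \<le> ennreal (a + b) * 1"
      by (intro mult_left_mono) auto
    then show ?thesis using 4 by (simp add: mult.assoc[symmetric] flip: ennreal_mult ennreal_plus)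
  qed auto
qed

section \<open>Radial and angular norms\<close>

definition radial_norm :: "real \<Rightarrow> real \<Rightarrow> (complex \<Rightarrow> complex) \<Rightarrow> real \<Rightarrow> ennreal" where
  "radial_norm p s f t = ennpow (radial_int p f s t) (1 / p)"

text \<open>A density on the whole line instead of a restricted space: the sigma-algebra stays that
  of \<open>borel\<close>, so measurability and Tonelli's theorem need no change of space when
  \<open>s\<close> varies.\<close>

definition radial_measure :: "real \<Rightarrow> real measure" where
  "radial_measure s = density lborel (indicator {s..<1})"

definition circle_measure :: "real measure" where
  "circle_measure = density lborel (\<lambda>t. ennreal (1 / (2 * pi)) * indicator {0..2*pi} t)"

text \<open>The outer half of the mixed norm. An estimate of radial norms at each angle passes to
  \<open>rho\<close> by monotonicity of this functional, so most estimates need no distinction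
  between finite and infinite \<open>q\<close>.\<close>

definition angular_norm :: "ennreal \<Rightarrow> (real \<Rightarrow> ennreal) \<Rightarrow> ennreal" where
  "angular_norm q u = (if q = \<infinity> then esssup (restrict_space lborel {0..<2*pi}) u else Lp circle_measure (enn2real q) u)"

lemma sets_radial_measure [measurable_cong]: "sets (radial_measure s) = sets borel"
  by (simp add: radial_measure_def)

lemma sets_circle_measure [measurable_cong]: "sets circle_measure = sets borel"
  by (simp add: circle_measure_def)

lemma space_radial_measure [simp]: "space (radial_measure s) = UNIV"
  by (simp add: radial_measure_def)

lemma space_circle_measure [simp]: "space circle_measure = UNIV"
  by (simp add: circle_measure_def)

lemma nn_integral_radial_measure:
  "u \<in> borel_measurable borel \<Longrightarrow> (\<integral>\<^sup>+r. u r \<partial>radial_measure s) = (\<integral>\<^sup>+r. u r * indicator {s..<1} r \<partial>lborel)"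
  by (simp add: radial_measure_def nn_integral_density mult.commute)

lemma nn_integral_circle_measure:
  "u \<in> borel_measurable borel \<Longrightarrow>
    (\<integral>\<^sup>+t. u t \<partial>circle_measure) = ennreal (1 / (2 * pi)) * (\<integral>\<^sup>+t. u t * indicator {0..2*pi} t \<partial>lborel)"
  by (simp add: circle_measure_def nn_integral_density nn_integral_cmult[symmetric] ac_simps)

lemma emeasure_radial_measure: "s \<le> 1 \<Longrightarrow> emeasure (radial_measure s) UNIV = ennreal (1 - s)"
  using nn_integral_radial_measure[of "\<lambda>_. 1" s] by simp

lemma emeasure_circle_measure: "emeasure circle_measure UNIV = 1"
  using nn_integral_circle_measure[of "\<lambda>_. 1"] by (simp flip: ennreal_mult)

lemma sigma_finite_radial_measure: "sigma_finite_measure (radial_measure s)"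
  unfolding radial_measure_def by (subst sigma_finite_measure.sigma_finite_iff_density_finite[OF sigma_finite_lborel]) (auto simp: indicator_def)

lemma sigma_finite_circle_measure: "sigma_finite_measure circle_measure"
  by (rule finite_measure.axioms(1)) (rule finite_measureI, simp add: emeasure_circle_measure)

text \<open>Extension by \<open>0\<close> makes \<open>f\<close> equal to its product with the
  indicator of the open disc, hence Borel on the whole plane; polar coordinates can then be inserted
  without restricting the radius.\<close>

lemma HD_measurable:
  assumes "f \<in> HD"
  shows "f \<in> borel_measurable borel"
proof -
  have "continuous_on disc f" using assms by (auto simp: HD_def holomorphic_on_imp_continuous_on)
  then have "(\<lambda>z. indicator disc z *\<^sub>R f z) \<in> borel_measurable borel"
    by (intro borel_measurable_continuous_on_indicator) auto
  also have "(\<lambda>z. indicator disc z *\<^sub>R f z) = f"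
    using assms by (auto simp: HD_def indicator_def fun_eq_iff)
  finally show ?thesis .
qed

lemma cis_measurable [measurable]: "cis \<in> borel_measurable borel"
  by (intro borel_measurable_continuous_onI continuous_intros)

lemma HD_polar_measurable:
  assumes "f \<in> HD" and [measurable]: "u \<in> borel_measurable M" "v \<in> borel_measurable M"
  shows "(\<lambda>x. f (of_real (u x) * cis (v x))) \<in> borel_measurable M"
  by (rule measurable_compose[OF _ HD_measurable[OF assms(1)]]) measurable

lemma radial_norm_eq_Lp:
  assumes "f \<in> HD" "0 < p"
  shows "radial_norm p s f t = Lp (radial_measure s) p (\<lambda>r. ennreal (norm (f (of_real r * cis t))))"
proof -
  note [measurable] = HD_polar_measurable[OF assms(1)]
  show ?thesis
    unfolding radial_norm_def Lp_def radial_int_def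
    by (subst nn_integral_radial_measure) (simp_all add: ennpow_ennreal)
qed

lemma radial_norm_measurable [measurable]:
  assumes "f \<in> HD"
  shows "radial_norm p s f \<in> borel_measurable borel"
proof -
  note [measurable] = HD_polar_measurable[OF assms]
  show ?thesis unfolding radial_norm_def radial_int_def by measurable
qed

lemma rho_eq_angular_norm:
  assumes "0 < p" "1 \<le> q" "f \<in> HD"
  shows "rho p q f = angular_norm q (radial_norm p 0 f)"
proof (cases "q = \<infinity>")
  case False
  have [measurable]: "radial_norm p 0 f \<in> borel_measurable borel" using assms by measurable
  have [measurable]: "(\<lambda>t. radial_int p f 0 t) \<in> borel_measurable borel"
    using measurable_ennpow[OF radial_norm_measurable[OF assms(3), of p 0], of p] assms
    by (simp add: radial_norm_def ennpow_ennpow)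
  show ?thesis using False
    by (simp add: angular_norm_def rho_def Lp_def nn_integral_circle_measure radial_norm_def[abs_def] ennpow_ennpow)
next
  case True
  then show ?thesis by (simp add: angular_norm_def rho_def radial_norm_def[abs_def])
qed

lemma angular_norm_mono:
  assumes "1 \<le> q" "\<And>t. u t \<le> v t" "u \<in> borel_measurable borel"
  shows "angular_norm q u \<le> angular_norm q v"
proof -
  have "q \<noteq> \<infinity> \<Longrightarrow> 0 < enn2real q" using assms(1) by (cases q) auto
  then show ?thesis
    unfolding angular_norm_def using assms(2,3) by (auto intro!: Lp_mono esssup_mono simp: measurable_restrict_space1)
qed

lemma enn2real_ge_1: "1 \<le> q \<Longrightarrow> q \<noteq> \<infinity> \<Longrightarrow> 1 \<le> enn2real q"
  by (cases q) auto

lemma angular_norm_triangle: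
  assumes "1 \<le> q" and m: "u \<in> borel_measurable borel" "v \<in> borel_measurable borel"
  shows "angular_norm q (\<lambda>t. u t + v t) \<le> angular_norm q u + angular_norm q v"
proof (cases "q = \<infinity>")
  case True
  have [measurable]: "u \<in> borel_measurable (restrict_space lborel A)" "v \<in> borel_measurable (restrict_space lborel A)" for A
    using m by (auto simp: measurable_restrict_space1)
  show ?thesis unfolding angular_norm_def using True
    by (simp, intro esssup_I)
      (measurable, use esssup_AE[of u "restrict_space lborel {0..<2*pi}"] esssup_AE[of v "restrict_space lborel {0..<2*pi}"] in eventually_elim, rule add_mono)
next
  case False
  then show ?thesis unfolding angular_norm_def using m enn2real_ge_1[OF assms(1)] by (simp add: Lp_triangle measurable_cong_sets[OF sets_circle_measure])
qed

lemma angular_norm_const: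
  assumes "1 \<le> q"
  shows "angular_norm q (\<lambda>t. c) = c"
proof -
  have "emeasure (restrict_space lborel {0..<2*pi}) (space (restrict_space lborel {0..<2*pi})) \<noteq> (0::ennreal)"
    by (simp add: emeasure_restrict_space)
  moreover have "q \<noteq> \<infinity> \<Longrightarrow> 0 < enn2real q" using assms(1) by (cases q) auto
  ultimately show ?thesis
    unfolding angular_norm_def by (simp add: esssup_const Lp_const emeasure_circle_measure ennpow_def)
qed

lemma angular_norm_cmult_le:
  assumes "1 \<le> q" and m: "u \<in> borel_measurable borel"
  shows "angular_norm q (\<lambda>t. c * u t) \<le> c * angular_norm q u"
proof (cases "q = \<infinity>")
  case True
  have [measurable]: "u \<in> borel_measurable (restrict_space lborel A)" for A
    using m by (auto simp: measurable_restrict_space1)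
  show ?thesis unfolding angular_norm_def using True
    by (simp, intro esssup_I)
      (measurable, use esssup_AE[of u "restrict_space lborel {0..<2*pi}"] in eventually_elim, rule mult_left_mono, auto)
next
  case False
  then show ?thesis unfolding angular_norm_def using m enn2real_ge_1[OF assms(1)] by (simp add: Lp_cmult measurable_cong_sets[OF sets_circle_measure])
qed

text \<open>For \<open>q = \<infinity>\<close> the exceptional null sets of the countably many
  \<open>u n\<close> are united; for finite \<open>q\<close> this is Fatou's lemma.\<close>

lemma angular_norm_liminf_le:
  assumes "1 \<le> q" and m: "\<And>n. u n \<in> borel_measurable borel" and le: "\<And>n. angular_norm q (u n) \<le> c"
  shows "angular_norm q (\<lambda>t. liminf (\<lambda>n. u n t)) \<le> c"
proof (cases "q = \<infinity>")
  case True
  let ?R = "restrict_space lborel {0..<2*pi}"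
  have [measurable]: "u n \<in> borel_measurable (restrict_space lborel A)" for A n
    using m by (auto simp: measurable_restrict_space1)
  have "AE t in ?R. u n t \<le> c" for n
    using esssup_AE[of "u n" ?R] by eventually_elim (use le[of n] True in \<open>auto simp: angular_norm_def\<close>)
  then have "AE t in ?R. \<forall>n. u n t \<le> c" by (simp add: AE_all_countable)
  then have "AE t in ?R. liminf (\<lambda>n. u n t) \<le> c"
    by eventually_elim (auto intro!: Liminf_le eventuallyI)
  then show ?thesis unfolding angular_norm_def using True by (simp, intro esssup_I) auto
next
  case False
  have [measurable]: "u n \<in> borel_measurable circle_measure" for n using m by (simp add: measurable_cong_sets[OF sets_circle_measure])
  have "Lp circle_measure (enn2real q) (\<lambda>t. liminf (\<lambda>n. u n t)) \<le> liminf (\<lambda>n. Lp circle_measure (enn2real q) (u n))"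
    using enn2real_ge_1[OF assms(1)] False by (intro Lp_liminf) auto
  also have "\<dots> \<le> c" using le False by (intro Liminf_le eventuallyI) (auto simp: angular_norm_def)
  finally show ?thesis using False by (simp add: angular_norm_def)
qed

section \<open>The dual Hardy inequality\<close>

text \<open>The weight \<open>(1 - s) powr (- 1 - c)\<close> is the one against which Jensen's
  inequality is applied below; the boundary term at \<open>0\<close> has the good sign and is
  dropped.\<close>

lemma nn_integral_powr_left:
  fixes c r :: real
  assumes c: "0 < c" and r: "0 \<le> r" "r < 1"
  shows "(\<integral>\<^sup>+s. ennreal ((1 - s) powr (- 1 - c)) * indicator {0..<r} s \<partial>lborel) \<le> ennreal ((1 - r) powr (- c) / c)"
proof -
  have "((\<lambda>s. (1 - s) powr (- 1 - c)) has_integral ((1 - r) powr (- c) / c - (1 - 0) powr (- c) / c)) {0..r}"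
    using assms
    by (intro fundamental_theorem_of_calculus)
      (auto intro!: derivative_eq_intros simp: has_real_derivative_iff_has_vector_derivative[symmetric] powr_diff powr_minus field_simps)
  then have "(\<integral>\<^sup>+s. ennreal ((1 - s) powr (- 1 - c)) * indicator {0..r} s \<partial>lborel) = ennreal ((1 - r) powr (- c) / c - 1 / c)"
    using nn_integral_has_integral_lebesgue'[of "{0..r}" "\<lambda>s. (1 - s) powr (- 1 - c)"] by simp
  moreover have "(\<integral>\<^sup>+s. ennreal ((1 - s) powr (- 1 - c)) * indicator {0..<r} s \<partial>lborel)
      \<le> (\<integral>\<^sup>+s. ennreal ((1 - s) powr (- 1 - c)) * indicator {0..r} s \<partial>lborel)"
    by (intro nn_integral_mono) (auto simp: indicator_def)
  ultimately show ?thesis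
    using c by (elim order_trans) (simp add: ennreal_leI)
qed

lemma nn_integral_powr_right:
  fixes c s :: real
  assumes c: "0 < c" and s: "0 \<le> s" "s < 1"
  shows "(\<integral>\<^sup>+r. ennreal ((1 - r) powr (c - 1)) * indicator {s..<1} r \<partial>lborel) \<le> ennreal ((1 - s) powr c / c)"
proof -
  have "((\<lambda>r. (1 - r) powr (c - 1)) has_integral (- ((1 - 1) powr c / c) - (- ((1 - s) powr c / c)))) {s..1}"
  \<comment> \<open>For \<open>c < 1\<close> the integrand is unbounded near 1, so differentiability
    is asked for in the interior only.\<close>
  proof (rule fundamental_theorem_of_calculus_interior)
    show "continuous_on {s..1} (\<lambda>r. - ((1 - r) powr c / c))"
      using c s by (intro continuous_intros continuous_on_powr') auto
    show "((\<lambda>r. - ((1 - r) powr c / c)) has_vector_derivative (1 - x) powr (c - 1)) (at x)" if "x \<in> {s<..<1}" for x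
      using that assms
      by (auto intro!: derivative_eq_intros simp: has_real_derivative_iff_has_vector_derivative[symmetric] powr_diff)
  qed (use s in auto)
  then have "(\<integral>\<^sup>+r. ennreal ((1 - r) powr (c - 1)) * indicator {s..1} r \<partial>lborel) = ennreal ((1 - s) powr c / c)"
    using c nn_integral_has_integral_lebesgue'[of "{s..1}" "\<lambda>r. (1 - r) powr (c - 1)"] by simp
  moreover have "(\<integral>\<^sup>+r. ennreal ((1 - r) powr (c - 1)) * indicator {s..<1} r \<partial>lborel)
      \<le> (\<integral>\<^sup>+r. ennreal ((1 - r) powr (c - 1)) * indicator {s..1} r \<partial>lborel)"
    by (intro nn_integral_mono) (auto simp: indicator_def)
  ultimately show ?thesis by simp
qed

text \<open>With \<open>x = 1 - r\<close> this sends \<open>v\<close> to the integral of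
  \<open>v y / y\<close> over \<open>x < y \<le> 1\<close>, the adjoint of the Hardy averaging
  operator.\<close>

definition hardy_op :: "(real \<Rightarrow> ennreal) \<Rightarrow> real \<Rightarrow> ennreal" where
  "hardy_op u r = (\<integral>\<^sup>+s. u s * ennreal (1 / (1 - s)) * indicator {0..<r} s \<partial>lborel)"

lemma hardy_measurable [measurable]:
  assumes [measurable]: "u \<in> borel_measurable borel"
  shows "hardy_op u \<in> borel_measurable borel"
proof -
  have eq: "indicator {0..<r} s = (if 0 \<le> s \<and> s < r then 1 else (0::ennreal))" for r s :: real
    by (auto simp: indicator_def)
  show ?thesis unfolding hardy_op_def[abs_def] eq by measurable
qed

text \<open>First half of a Schur test: \<open>u s / (1 - s)\<close> is split as
  \<open>u s * (1 - s) powr c\<close> times the weight \<open>(1 - s) powr (- 1 - c)\<close>, whose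
  mass on \<open>{0..<r}\<close> is at most \<open>W\<close>. Jensen's inequality raises
  \<open>W\<close> to the power \<open>p - 1\<close>.\<close>

lemma hardy_pointwise:
  assumes p: "1 \<le> p" and [measurable]: "u \<in> borel_measurable borel" and r: "0 \<le> r" "r < 1"
  shows "ennpow (hardy_op u r) p \<le> ennreal (2 powr p * p powr (p - 1)) *
    (\<integral>\<^sup>+s. ennpow (u s) p * ennreal ((1 - s) powr (- (1 / p))) * ennreal ((1 - r) powr (1 / p - 1)) * indicator {0..<r} s \<partial>lborel)"
proof -
  \<comment> \<open>This choice turns \<open>W powr (p - 1)\<close> into a multiple of
    \<open>(1 - r) powr (1 / p - 1)\<close>, which is integrable up to 1 for every \<open>p\<close>,
    including \<open>p = 1\<close>.\<close>
  define c where "c = 1 / p"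
  have c: "0 < c" using p by (simp add: c_def)
  define N where "N = density lborel (\<lambda>s. ennreal ((1 - s) powr (- 1 - c)) * indicator {0..<r} s)"
  have setsN[measurable_cong]: "sets N = sets borel" by (simp add: N_def)
  define W where "W = (1 - r) powr (- c) / c"
  have W: "0 < W" using c r by (simp add: W_def)
  have "emeasure N (space N) = (\<integral>\<^sup>+s. ennreal ((1 - s) powr (- 1 - c)) * indicator {0..<r} s \<partial>lborel)"
    unfolding N_def by (subst emeasure_density) auto
  then have NW: "emeasure N (space N) \<le> ennreal W"
    unfolding W_def using nn_integral_powr_left[OF c r] by simp
  have "hardy_op u r = (\<integral>\<^sup>+s. u s * ennreal ((1 - s) powr c) \<partial>N)"
    unfolding N_def hardy_op_def using r
    by (subst nn_integral_density)
      (auto intro!: nn_integral_cong simp: indicator_def ac_simps powr_minus divide_simps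
        simp flip: ennreal_mult powr_add)
  also have "\<dots> \<le> ennreal (2 * W powr (1 - 1 / p)) * ennpow (\<integral>\<^sup>+s. ennpow (u s * ennreal ((1 - s) powr c)) p \<partial>N) (1 / p)"
    by (rule jensen_ennpow[OF p W NW]) measurable
  finally have "ennpow (hardy_op u r) p \<le> ennpow \<dots> p"
    using p by (intro ennpow_mono) auto
  also have "\<dots> = ennreal ((2 * W powr (1 - 1 / p)) powr p) * (\<integral>\<^sup>+s. ennpow (u s * ennreal ((1 - s) powr c)) p \<partial>N)"
    using p W by (simp add: ennpow_mult ennpow_ennreal ennpow_inverse')
  also have "(2 * W powr (1 - 1 / p)) powr p = 2 powr p * p powr (p - 1) * (1 - r) powr (1 / p - 1)"
  proof -
    have "(2 * W powr (1 - 1 / p)) powr p = 2 powr p * W powr (p - 1)"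
      using p W by (simp add: powr_mult powr_powr algebra_simps)
    also have "W powr (p - 1) = p powr (p - 1) * (1 - r) powr (1 / p - 1)"
      unfolding W_def c_def using p r by (simp add: powr_mult powr_powr diff_divide_distrib)
    finally show ?thesis by simp
  qed
  also have "(\<integral>\<^sup>+s. ennpow (u s * ennreal ((1 - s) powr c)) p \<partial>N) =
    (\<integral>\<^sup>+s. ennpow (u s) p * ennreal ((1 - s) powr (- (1 / p))) * indicator {0..<r} s \<partial>lborel)"
    unfolding N_def using r p c
    by (subst nn_integral_density)
      (auto intro!: nn_integral_cong simp: indicator_def ac_simps c_def ennpow_mult ennpow_ennreal powr_powr
        powr_mult_base simp flip: ennreal_mult)
  also have "ennreal (2 powr p * p powr (p - 1) * (1 - r) powr (1 / p - 1)) * \<dots> = ennreal (2 powr p * p powr (p - 1)) *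
    (\<integral>\<^sup>+s. ennpow (u s) p * ennreal ((1 - s) powr (- (1 / p))) * ennreal ((1 - r) powr (1 / p - 1)) * indicator {0..<r} s \<partial>lborel)"
    using r p by (simp add: ennreal_mult mult.assoc nn_integral_cmult[symmetric]) (simp add: ac_simps)
  finally show ?thesis .
qed

text \<open>Second half of the Schur test: after Tonelli the integral of
  \<open>(1 - r) powr (1 / p - 1)\<close> over \<open>{s..<1}\<close> is at most
  \<open>p * (1 - s) powr (1 / p)\<close>, which cancels the weight left in \<open>s\<close>. The
  constants combine to \<open>(2 * p) powr p\<close>; the 2 is the loss in Jensen's
  inequality.\<close>

lemma hardy_inequality:
  assumes p: "1 \<le> p" and [measurable]: "u \<in> borel_measurable borel"
  shows "Lp (radial_measure 0) p (hardy_op u) \<le> ennreal (2 * p) * Lp (radial_measure 0) p u"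
proof -
  \<comment> \<open>The triangle \<open>s < r < 1\<close> is written as a condition and not as the
    indicator of an interval depending on \<open>r\<close>, so that the kernel is visibly measurable
    in both variables.\<close>
  let ?k = "\<lambda>r s. ennpow (u s) p * ennreal ((1 - s) powr (- (1 / p))) * ennreal ((1 - r) powr (1 / p - 1)) *
        (if 0 \<le> s \<and> s < r \<and> r < 1 then 1 else 0)"
  have "(\<integral>\<^sup>+r. (\<integral>\<^sup>+s. ?k r s \<partial>lborel) \<partial>lborel) = (\<integral>\<^sup>+s. (\<integral>\<^sup>+r. ?k r s \<partial>lborel) \<partial>lborel)"
    by (rule lborel_pair.Fubini') measurable
  also have "\<dots> \<le> (\<integral>\<^sup>+s. ennreal p * (ennpow (u s) p * indicator {0..<1} s) \<partial>lborel)"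
  proof (rule nn_integral_mono)
    fix s :: real
    show "(\<integral>\<^sup>+r. ?k r s \<partial>lborel) \<le> ennreal p * (ennpow (u s) p * indicator {0..<1} s)"
    proof (cases "s \<in> {0..<1}")
      case True
      have "(\<integral>\<^sup>+r. ?k r s \<partial>lborel) \<le> (\<integral>\<^sup>+r. ennpow (u s) p * ennreal ((1 - s) powr (- (1 / p))) *
          (ennreal ((1 - r) powr (1 / p - 1)) * indicator {s..<1} r) \<partial>lborel)"
        using True by (intro nn_integral_mono) (auto simp: indicator_def)
      also have "\<dots> = ennpow (u s) p * ennreal ((1 - s) powr (- (1 / p))) *
          (\<integral>\<^sup>+r. ennreal ((1 - r) powr (1 / p - 1)) * indicator {s..<1} r \<partial>lborel)"
        by (intro nn_integral_cmult) measurable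
      also have "\<dots> \<le> ennpow (u s) p * ennreal ((1 - s) powr (- (1 / p))) * ennreal ((1 - s) powr (1 / p) / (1 / p))"
        using True p by (intro mult_left_mono nn_integral_powr_right) auto
      also have "\<dots> = ennpow (u s) p * ennreal p"
        using True p by (simp add: mult.assoc powr_minus divide_simps flip: ennreal_mult)
      finally show ?thesis using True by (simp add: ac_simps)
    next
      case False
      have "(\<integral>\<^sup>+r. ?k r s \<partial>lborel) = (\<integral>\<^sup>+r. 0 \<partial>(lborel :: real measure))"
        using False by (intro nn_integral_cong) auto
      then show ?thesis by simp
    qed
  qed
  also have "\<dots> = ennreal p * (\<integral>\<^sup>+s. ennpow (u s) p \<partial>radial_measure 0)"
    by (simp add: nn_integral_cmult nn_integral_radial_measure)
  finally have dbl: "(\<integral>\<^sup>+r. (\<integral>\<^sup>+s. ?k r s \<partial>lborel) \<partial>lborel) \<le> ennreal p * (\<integral>\<^sup>+s. ennpow (u s) p \<partial>radial_measure 0)" .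
  have "(\<integral>\<^sup>+r. ennpow (hardy_op u r) p \<partial>radial_measure 0) = (\<integral>\<^sup>+r. ennpow (hardy_op u r) p * indicator {0..<1} r \<partial>lborel)"
    by (simp add: nn_integral_radial_measure)
  also have "\<dots> \<le> (\<integral>\<^sup>+r. ennreal (2 powr p * p powr (p - 1)) * (\<integral>\<^sup>+s. ?k r s \<partial>lborel) \<partial>lborel)"
  proof (rule nn_integral_mono)
    fix r :: real
    show "ennpow (hardy_op u r) p * indicator {0..<1} r \<le> ennreal (2 powr p * p powr (p - 1)) * (\<integral>\<^sup>+s. ?k r s \<partial>lborel)"
    proof (cases "r \<in> {0..<1}")
      case True
      have "(\<integral>\<^sup>+s. ?k r s \<partial>lborel) = (\<integral>\<^sup>+s. ennpow (u s) p * ennreal ((1 - s) powr (- (1 / p))) * ennreal ((1 - r) powr (1 / p - 1)) * indicator {0..<r} s \<partial>lborel)"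
        using True by (intro nn_integral_cong) (auto simp: indicator_def)
      then show ?thesis using hardy_pointwise[OF p assms(2), of r] True by simp
    qed simp
  qed
  also have "\<dots> = ennreal (2 powr p * p powr (p - 1)) * (\<integral>\<^sup>+r. (\<integral>\<^sup>+s. ?k r s \<partial>lborel) \<partial>lborel)"
    by (intro nn_integral_cmult) measurable
  also have "ennreal (2 powr p * p powr (p - 1)) * (\<integral>\<^sup>+r. (\<integral>\<^sup>+s. ?k r s \<partial>lborel) \<partial>lborel)
      \<le> ennreal (2 powr p * p powr (p - 1)) * (ennreal p * (\<integral>\<^sup>+s. ennpow (u s) p \<partial>radial_measure 0))"
    by (intro mult_left_mono dbl) simp
  also have "\<dots> = ennreal ((2 * p) powr p) * (\<integral>\<^sup>+s. ennpow (u s) p \<partial>radial_measure 0)"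
    using p by (simp add: mult.assoc[symmetric] powr_mult powr_diff flip: ennreal_mult)
  finally have "(\<integral>\<^sup>+r. ennpow (hardy_op u r) p \<partial>radial_measure 0) \<le> ennreal ((2 * p) powr p) * (\<integral>\<^sup>+s. ennpow (u s) p \<partial>radial_measure 0)" .
  then have "Lp (radial_measure 0) p (hardy_op u) \<le> ennpow (ennreal ((2 * p) powr p) * (\<integral>\<^sup>+s. ennpow (u s) p \<partial>radial_measure 0)) (1 / p)"
    unfolding Lp_def using p by (intro ennpow_mono) auto
  then show ?thesis
    unfolding Lp_def using p by (simp add: ennpow_mult ennpow_ennreal powr_powr)
qed

section \<open>Radial estimates for the integration operator\<close>

text \<open>Cut off outside the disc, the derivative is again in \<open>HD\<close>, so bounds on
  closed subdiscs can be taken from \<open>HD_bound_cball\<close>.\<close>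

definition disc_deriv :: "(complex \<Rightarrow> complex) \<Rightarrow> complex \<Rightarrow> complex" where
  "disc_deriv f z = (if z \<in> disc then deriv f z else 0)"

lemma HD_I: "f holomorphic_on disc \<Longrightarrow> (\<lambda>z. if z \<in> disc then f z else 0) \<in> HD"
  unfolding HD_def using holomorphic_transform[of f disc "\<lambda>z. if z \<in> disc then f z else 0"] by auto

lemma disc_deriv_HD: "f \<in> HD \<Longrightarrow> disc_deriv f \<in> HD"
  unfolding disc_deriv_def[abs_def] by (intro HD_I holomorphic_deriv) (auto simp: HD_def)

lemma ray_in_disc: "0 \<le> s \<Longrightarrow> s < 1 \<Longrightarrow> of_real s * cis t \<in> disc"
  by (simp add: norm_mult)

lemma HD_DERIV:
  assumes "f \<in> HD" "z \<in> disc"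
  shows "(f has_field_derivative deriv f z) (at z)"
  using assms holomorphic_derivI[of f disc z] by (auto simp: HD_def)

lemma norm_has_integral_le_nn_integral:
  fixes h :: "real \<Rightarrow> complex"
  assumes I: "(h has_integral I) {a..b}" and cont: "continuous_on {a..b} h"
  shows "ennreal (norm I) \<le> (\<integral>\<^sup>+t. ennreal (norm (h t)) * indicator {a..b} t \<partial>lborel)"
proof -
  have "norm I = norm (integral {a..b} h)"
    using integral_unique[OF I] by simp
  also have "\<dots> \<le> integral {a..b} (\<lambda>t. norm (h t))"
    using cont by (intro integral_norm_bound_integral integrable_continuous_real continuous_on_norm) auto
  finally have "ennreal (norm I) \<le> ennreal (integral {a..b} (\<lambda>t. norm (h t)))"
    by (rule ennreal_leI)
  also have "\<dots> = (\<integral>\<^sup>+t. ennreal (norm (h t)) * indicator {a..b} t \<partial>lborel)"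
    using cont by (intro nn_integral_has_integral_lebesgue'[symmetric] integrable_integral integrable_continuous_real continuous_on_norm) auto
  finally show ?thesis .
qed

lemma HD_norm_le_nn_integral:
  assumes F: "F \<in> HD" and F0: "F 0 = 0" and r: "0 \<le> r" "r < 1"
  shows "ennreal (norm (F (of_real r * cis t)))
    \<le> (\<integral>\<^sup>+s. ennreal (norm (deriv F (of_real s * cis t))) * indicator {0..r} s \<partial>lborel)"
proof -
  let ?d = "\<lambda>s. deriv F (of_real s * cis t) * cis t"
  have der: "((\<lambda>s. F (of_real s * cis t)) has_vector_derivative ?d s) (at s within {0..r})" if "s \<in> {0..r}" for s
  proof -
    have "((\<lambda>s. of_real s * cis t) has_vector_derivative cis t) (at s within {0..r})"
      by (auto intro!: derivative_eq_intros)
    moreover have "(F has_field_derivative deriv F (of_real s * cis t)) (at (of_real s * cis t))"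
      using that r by (intro HD_DERIV F ray_in_disc) auto
    ultimately have "((F \<circ> (\<lambda>s. of_real s * cis t)) has_vector_derivative cis t * deriv F (of_real s * cis t)) (at s within {0..r})"
      by (rule field_vector_diff_chain_within[OF _ has_field_derivative_at_within])
    then show ?thesis by (simp add: o_def mult.commute)
  qed
  have I: "(?d has_integral (F (of_real r * cis t) - F (of_real 0 * cis t))) {0..r}"
    by (rule fundamental_theorem_of_calculus[OF r(1) der])
  have "deriv F holomorphic_on disc" using F by (simp add: HD_def holomorphic_deriv)
  then have "continuous_on {0..r} (\<lambda>s. deriv F (of_real s * cis t))"
  proof (rule continuous_on_compose2[OF holomorphic_on_imp_continuous_on])
    show "continuous_on {0..r} (\<lambda>s. of_real s * cis t)"
      by (intro continuous_intros)
  qed (use r in \<open>auto simp: norm_mult\<close>)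
  then have cont: "continuous_on {0..r} ?d"
    by (intro continuous_intros)
  have "ennreal (norm (F (of_real r * cis t) - F (of_real 0 * cis t)))
      \<le> (\<integral>\<^sup>+s. ennreal (norm (?d s)) * indicator {0..r} s \<partial>lborel)"
    by (rule norm_has_integral_le_nn_integral[OF I cont])
  then show ?thesis using F0 by (simp add: norm_mult)
qed

text \<open>The upper estimates for images under \<open>T_op\<close> all come from here. The bound
  on the derivative has a bounded part and a part of Hardy type; the former contributes
  \<open>B * (1 - \<sigma>) powr (1 / p)\<close>, which tends to 0 as \<sigma> tends to 1 whatever
  \<open>B\<close> is, so the behaviour on a smaller disc never affects membership in
  RM(p,0).\<close>

lemma radial_norm_le_of_deriv_le:
  assumes F: "F \<in> HD" and F0: "F 0 = 0" and p: "1 \<le> p" and B: "0 \<le> B" and C: "0 \<le> C"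
    and [measurable]: "u \<in> borel_measurable borel"
    and le: "\<And>s. 0 \<le> s \<Longrightarrow> s < 1 \<Longrightarrow>
      ennreal (norm (deriv F (of_real s * cis t))) \<le> ennreal B + ennreal C * (u s * ennreal (1 / (1 - s)))"
    and \<sigma>: "0 \<le> \<sigma>" "\<sigma> < 1"
  shows "radial_norm p \<sigma> F t \<le> ennreal (B * (1 - \<sigma>) powr (1 / p)) + ennreal (2 * p * C) * Lp (radial_measure 0) p u"
proof -
  have pw: "ennreal (norm (F (of_real r * cis t))) \<le> ennreal B + ennreal C * hardy_op u r" if r: "0 \<le> r" "r < 1" for r
  proof -
    have "ennreal (norm (F (of_real r * cis t))) \<le> (\<integral>\<^sup>+s. ennreal (norm (deriv F (of_real s * cis t))) * indicator {0..r} s \<partial>lborel)"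
      by (rule HD_norm_le_nn_integral[OF F F0 r])
    also have "\<dots> \<le> (\<integral>\<^sup>+s. (ennreal B + ennreal C * (u s * ennreal (1 / (1 - s)))) * indicator {0..r} s \<partial>lborel)"
      using le r by (intro nn_integral_mono) (auto simp: indicator_def)
    also have "\<dots> = (\<integral>\<^sup>+s. ennreal B * indicator {0..r} s + ennreal C * (u s * ennreal (1 / (1 - s)) * indicator {0..r} s) \<partial>lborel)"
      by (intro nn_integral_cong) (auto simp: indicator_def)
    also have "\<dots> = ennreal B * ennreal r + ennreal C * (\<integral>\<^sup>+s. u s * ennreal (1 / (1 - s)) * indicator {0..r} s \<partial>lborel)"
      using r by (simp add: nn_integral_add nn_integral_cmult)
    also have "(\<integral>\<^sup>+s. u s * ennreal (1 / (1 - s)) * indicator {0..r} s \<partial>lborel) = hardy_op u r"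
      unfolding hardy_op_def by (intro nn_integral_cong_AE AE_I'[of "{r}"]) (auto simp: indicator_def)
    also have "ennreal B * ennreal r \<le> ennreal B"
      using r B by (simp add: ennreal_leI mult_left_le flip: ennreal_mult)
    finally show ?thesis by (simp add: add_right_mono)
  qed
  have ae: "AE r in radial_measure \<sigma>. ennreal (norm (F (of_real r * cis t))) \<le> ennreal B + ennreal C * hardy_op u r"
    unfolding radial_measure_def using pw \<sigma> by (subst AE_density) (auto simp: indicator_def)
  have "radial_norm p \<sigma> F t = Lp (radial_measure \<sigma>) p (\<lambda>r. ennreal (norm (F (of_real r * cis t))))"
    using p by (intro radial_norm_eq_Lp F) auto
  also have "\<dots> \<le> Lp (radial_measure \<sigma>) p (\<lambda>r. ennreal B + ennreal C * hardy_op u r)"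
    using p by (intro Lp_mono ae) auto
  also have "\<dots> \<le> Lp (radial_measure \<sigma>) p (\<lambda>r. ennreal B) + Lp (radial_measure \<sigma>) p (\<lambda>r. ennreal C * hardy_op u r)"
    by (intro Lp_triangle p) measurable
  also have "Lp (radial_measure \<sigma>) p (\<lambda>r. ennreal B) = ennreal (B * (1 - \<sigma>) powr (1 / p))"
    using p B \<sigma> by (simp add: Lp_const emeasure_radial_measure ennpow_ennreal ennreal_mult)
  also have "Lp (radial_measure \<sigma>) p (\<lambda>r. ennreal C * hardy_op u r) = ennreal C * Lp (radial_measure \<sigma>) p (hardy_op u)"
    using p by (intro Lp_cmult) auto
  also have "ennreal (B * (1 - \<sigma>) powr (1 / p)) + ennreal C * Lp (radial_measure \<sigma>) p (hardy_op u)
      \<le> ennreal (B * (1 - \<sigma>) powr (1 / p)) + ennreal C * (ennreal (2 * p) * Lp (radial_measure 0) p u)"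
  proof (intro add_left_mono mult_left_mono)
    \<comment> \<open>Only the constant term uses the length of \<open>{\<sigma>..<1}\<close>; the
      Hardy term is estimated over the whole radius.\<close>
    have "Lp (radial_measure \<sigma>) p (hardy_op u) \<le> Lp (radial_measure 0) p (hardy_op u)"
      unfolding Lp_def using p \<sigma>
      by (intro ennpow_mono) (auto simp: nn_integral_radial_measure indicator_def intro!: nn_integral_mono)
    also have "\<dots> \<le> ennreal (2 * p) * Lp (radial_measure 0) p u"
      by (rule hardy_inequality) (use p in auto)
    finally show "Lp (radial_measure \<sigma>) p (hardy_op u) \<le> ennreal (2 * p) * Lp (radial_measure 0) p u" .
  qed simp
  also have "ennreal C * (ennreal (2 * p) * Lp (radial_measure 0) p u) = ennreal (2 * p * C) * Lp (radial_measure 0) p u"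
    using p C by (simp add: ennreal_mult ac_simps)
  finally show ?thesis .
qed

lemma contour_integral_disc:
  assumes h: "h holomorphic_on disc"
  shows "\<exists>F. \<forall>z\<in>disc. (F has_field_derivative h z) (at z) \<and> contour_integral (linepath 0 z) h = F z - F 0"
proof -
  obtain F where F: "\<And>z. z \<in> disc \<Longrightarrow> (F has_field_derivative h z) (at z within disc)"
    using holomorphic_convex_primitive'[OF convex_ball open_ball h] by blast
  have "contour_integral (linepath 0 z) h = F z - F 0" if z: "z \<in> disc" for z
  proof -
    have "closed_segment 0 z \<subseteq> disc"
      using z by (intro closed_segment_subset) auto
    then have "(h has_contour_integral (F (pathfinish (linepath 0 z)) - F (pathstart (linepath 0 z)))) (linepath 0 z)"
      by (intro contour_integral_primitive[OF F]) auto
    then show ?thesis by (simp add: contour_integral_unique)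
  qed
  moreover have "(F has_field_derivative h z) (at z)" if "z \<in> disc" for z
    using F[OF that] at_within_open[OF that open_ball] by simp
  ultimately show ?thesis by blast
qed

lemma T_op_props:
  assumes f: "f \<in> HD" and g: "g \<in> HD"
  shows "T_op g f \<in> HD" "T_op g f 0 = 0" "\<And>z. z \<in> disc \<Longrightarrow> deriv (T_op g f) z = f z * deriv g z"
proof -
  have "(\<lambda>w. f w * deriv g w) holomorphic_on disc"
    using f g by (intro holomorphic_on_mult holomorphic_deriv) (simp_all add: HD_def)
  from contour_integral_disc[OF this] obtain F
    where F: "\<And>z. z \<in> disc \<Longrightarrow> (F has_field_derivative f z * deriv g z) (at z)"
    "\<And>z. z \<in> disc \<Longrightarrow> contour_integral (linepath 0 z) (\<lambda>w. f w * deriv g w) = F z - F 0"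
    by blast
  have T: "T_op g f z = F z - F 0" if "z \<in> disc" for z
    unfolding T_op_def using that F(2)[OF that] by (simp only: if_True)
  have D: "(T_op g f has_field_derivative f z * deriv g z) (at z)" if z: "z \<in> disc" for z
  proof (rule has_field_derivative_transform_within_open[of _ _ _ disc])
    show "((\<lambda>z. F z - F 0) has_field_derivative f z * deriv g z) (at z)"
      using DERIV_diff[OF F(1)[OF z] DERIV_const] by simp
  qed (use z in \<open>auto simp: T\<close>)
  show "T_op g f 0 = 0" by (simp add: T)
  show "deriv (T_op g f) z = f z * deriv g z" if "z \<in> disc" for z
    using D[OF that] by (rule DERIV_imp_deriv)
  have "T_op g f holomorphic_on disc"
    unfolding holomorphic_on_open[OF open_ball] using D by blast
  then show "T_op g f \<in> HD" by (simp add: HD_def T_op_def)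
qed

section \<open>Point evaluations\<close>

text \<open>The order \<open>k\<close> is kept general because point values (\<open>k = 0\<close>)
  and derivatives (\<open>k = 1\<close>) are both needed: the former to separate points and for
  Montel's theorem, the latter to recover \<open>deriv g\<close> from an image.\<close>

lemma norm_higher_deriv_le_circle:
  assumes f: "f \<in> HD" and a: "norm a < r" and r: "r < 1"
  shows "ennreal (norm ((deriv ^^ k) f a)) \<le>
    ennreal (fact k) * (\<integral>\<^sup>+t. ennreal (norm (f (of_real r * cis t)) / norm (of_real r * cis t - a) ^ Suc k) \<partial>circle_measure)"
proof -
  let ?h = "\<lambda>t. f (of_real r * cis t) / (of_real r * cis t - a) ^ Suc k * of_real r * \<i> * cis t"
  have r0: "0 < r" using a norm_ge_zero[of a] by linarith
  have hol: "f holomorphic_on disc" using f by (simp add: HD_def)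
  have sub: "cball 0 r \<subseteq> disc" using r by auto
  have "((\<lambda>u. f u / (u - a) ^ Suc k) has_contour_integral (2 * pi * \<i> / fact k * (deriv ^^ k) f a)) (circlepath 0 r)"
    using a sub hol
    by (intro Cauchy_has_contour_integral_higher_derivative_circlepath holomorphic_on_imp_continuous_on
        holomorphic_on_subset[OF hol]) (auto simp: dist_norm)
  then have I: "(?h has_integral (2 * pi * \<i> / fact k * (deriv ^^ k) f a)) {0..2*pi}"
    unfolding circlepath_def by (subst (asm) has_contour_integral_part_circlepath_iff) auto
  have nz: "of_real r * cis t \<noteq> a" for t
    using a r0 by (auto simp: norm_mult)
  have "continuous_on {0..2*pi} (\<lambda>t. f (of_real r * cis t))"
  proof (rule continuous_on_compose2[OF holomorphic_on_imp_continuous_on[OF hol]])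
    show "continuous_on {0..2*pi} (\<lambda>t. of_real r * cis t)" by (intro continuous_intros)
  qed (use r r0 in \<open>auto simp: norm_mult\<close>)
  then have cont: "continuous_on {0..2*pi} ?h"
    using nz by (intro continuous_intros) auto
  have m: "(\<lambda>t. ennreal (norm (f (of_real r * cis t)) / norm (of_real r * cis t - a) ^ Suc k)) \<in> borel_measurable borel"
  proof -
    note [measurable] = HD_polar_measurable[OF f]
    show ?thesis by measurable
  qed
  have "ennreal (norm (2 * pi * \<i> / fact k * (deriv ^^ k) f a)) \<le> (\<integral>\<^sup>+t. ennreal (norm (?h t)) * indicator {0..2*pi} t \<partial>lborel)"
    by (rule norm_has_integral_le_nn_integral[OF I cont])
  also have "\<dots> \<le> (\<integral>\<^sup>+t. ennreal (norm (f (of_real r * cis t)) / norm (of_real r * cis t - a) ^ Suc k) * indicator {0..2*pi} t \<partial>lborel)"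
    using r0 r by (intro nn_integral_mono mult_right_mono ennreal_leI)
      (auto simp: norm_mult norm_divide norm_power intro!: mult_left_le divide_right_mono)
  finally have "ennreal (fact k) * ennreal (1 / (2 * pi)) * ennreal (norm (2 * pi * \<i> / fact k * (deriv ^^ k) f a))
    \<le> ennreal (fact k) * ennreal (1 / (2 * pi)) * (\<integral>\<^sup>+t. ennreal (norm (f (of_real r * cis t)) / norm (of_real r * cis t - a) ^ Suc k) * indicator {0..2*pi} t \<partial>lborel)"
    by (rule mult_left_mono) simp
  moreover have "ennreal (fact k) * ennreal (1 / (2 * pi)) * ennreal (norm (2 * pi * \<i> / fact k * (deriv ^^ k) f a))
    = ennreal (norm ((deriv ^^ k) f a))"
    by (simp add: norm_mult norm_divide flip: ennreal_mult')
  ultimately show ?thesis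
    unfolding nn_integral_circle_measure[OF m] by (simp only: mult.assoc)
qed

text \<open>For \<open>r \<ge> (1 + norm a) / 2\<close> the point \<open>of_real r * cis t\<close>
  is at least as far from \<open>a\<close> as from \<open>cis t\<close>, so
  \<open>norm (cis t - a)\<close> is at most twice its distance from \<open>a\<close>. The resulting
  kernel is free of \<open>r\<close>.\<close>

lemma norm_higher_deriv_le_kernel:
  assumes f: "f \<in> HD" and a: "norm a < 1" and r: "(1 + norm a) / 2 \<le> r" "r < 1" and k: "k \<le> 1"
  shows "ennreal (norm ((deriv ^^ k) f a)) \<le>
    (\<integral>\<^sup>+t. ennreal (8 / (norm (cis t - a))\<^sup>2) * ennreal (norm (f (of_real r * cis t))) \<partial>circle_measure)"
proof -
  have ar: "norm a < r" using a r by (simp add: field_simps)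
  have r0: "0 < r" using ar norm_ge_zero[of a] by linarith
  have "ennreal (norm ((deriv ^^ k) f a)) \<le>
    ennreal (fact k) * (\<integral>\<^sup>+t. ennreal (norm (f (of_real r * cis t)) / norm (of_real r * cis t - a) ^ Suc k) \<partial>circle_measure)"
    by (rule norm_higher_deriv_le_circle[OF f ar r(2)])
  also have "ennreal (fact k) = 1" using k by (cases k) auto
  also have "1 * (\<integral>\<^sup>+t. ennreal (norm (f (of_real r * cis t)) / norm (of_real r * cis t - a) ^ Suc k) \<partial>circle_measure)
    \<le> (\<integral>\<^sup>+t. ennreal (8 / (norm (cis t - a))\<^sup>2) * ennreal (norm (f (of_real r * cis t))) \<partial>circle_measure)"
  proof (simp, rule nn_integral_mono)
    fix t
    let ?d = "norm (of_real r * cis t - a)" and ?D = "norm (cis t - a)"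
    have nr: "norm (of_real r * cis t) = r" using r0 by (simp add: norm_mult)
    have d1: "r - norm a \<le> ?d"
      using norm_triangle_ineq2[of "of_real r * cis t" a] nr by simp
    have d2: "?d \<le> 2"
      using norm_triangle_ineq4[of "of_real r * cis t" a] nr a r by simp
    have "?D \<le> ?d + norm (cis t - of_real r * cis t)"
      using norm_triangle_ineq[of "of_real r * cis t - a" "cis t - of_real r * cis t"] by (simp add: algebra_simps)
    also have "norm (cis t - of_real r * cis t) = 1 - r"
    proof -
      have "cis t - of_real r * cis t = of_real (1 - r) * cis t" by (simp add: algebra_simps)
      then show ?thesis using r by (simp only: norm_mult norm_of_real norm_cis) simp
    qed
    finally have D: "?D \<le> 2 * ?d" using d1 r by (simp add: field_simps)
    have d0: "0 < ?d" using d1 ar by linarith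
    have D0: "0 < ?D"
      using norm_triangle_ineq2[of "cis t" a] a by auto
    \<comment> \<open>For \<open>k = 0\<close> the missing factor is paid for by
      \<open>?d \<le> 2\<close>; this 2 and the square of the 2 in \<open>D\<close> make 8.\<close>
    have "1 / ?d ^ Suc k \<le> 2 / ?d\<^sup>2"
    proof -
      consider "k = 0" | "k = 1" using k by linarith
      then show ?thesis using d0 d2 by cases (auto simp: field_simps power2_eq_square)
    qed
    also have "\<dots> \<le> 8 / ?D\<^sup>2"
      using power_mono[OF D, of 2] d0 D0 by (simp add: field_simps)
    finally have "norm (f (of_real r * cis t)) * (1 / ?d ^ Suc k) \<le> norm (f (of_real r * cis t)) * (8 / ?D\<^sup>2)"
      by (rule mult_left_mono) simp
    then show "ennreal (norm (f (of_real r * cis t)) / (?d * ?d ^ k)) \<le> ennreal (8 / ?D\<^sup>2) * ennreal (norm (f (of_real r * cis t)))"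
      by (simp add: ennreal_leI mult.commute flip: ennreal_mult')
  qed
  finally show ?thesis .
qed

lemma norm_cis_minus: "norm (cis t - a) = norm (1 - cnj a * cis t)"
proof -
  have "cnj (cis t - a) * cis t = 1 - cnj a * cis t"
    by (simp add: algebra_simps cis_cnj cis_mult)
  then have "norm (1 - cnj a * cis t) = norm (cnj (cis t - a)) * norm (cis t)"
    by (simp only: norm_mult[symmetric])
  then show ?thesis by (simp only: complex_mod_cnj norm_cis mult_1_right)
qed

text \<open>On the unit circle \<open>|\<zeta> - a|\<^sup>-\<^sup>2 = \<zeta> / ((1 - cnj a \<zeta>) (\<zeta> - a))\<close>, so Cauchy's formula for \<open>1 / (1 - cnj a z)\<close>
  evaluates the integral.\<close>

lemma poisson_integral_le:
  assumes a: "norm a < 1"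
  shows "(\<integral>\<^sup>+t. ennreal (1 / (norm (cis t - a))\<^sup>2) \<partial>circle_measure) \<le> ennreal (1 / (1 - norm a))"
proof -
  have nz: "1 - cnj a * z \<noteq> 0" if "norm z \<le> 1" for z
  proof
    assume "1 - cnj a * z = 0"
    then have "cnj a * z = 1" by simp
    then have "norm (cnj a * z) = 1" by (simp only: norm_one)
    moreover have "norm (cnj a * z) \<le> norm a * 1" unfolding norm_mult using that by (intro mult_mono) auto
    ultimately show False using a by simp
  qed
  have cz: "cis t - a \<noteq> 0" for t using norm_triangle_ineq2[of "cis t" a] a by auto
  have "((\<lambda>u. (1 / (1 - cnj a * u)) / (u - a)) has_contour_integral (2 * pi * \<i> * (1 / (1 - cnj a * a)))) (circlepath 0 1)"
    using Cauchy_integral_circlepath[of 0 1 "\<lambda>u. 1 / (1 - cnj a * u)" a] a nz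
    by (force intro!: continuous_intros holomorphic_intros)
  then have I: "((\<lambda>t. 1 / (1 - cnj a * cis t) / (cis t - a) * \<i> * cis t) has_integral (2 * pi * \<i> * (1 / (1 - cnj a * a)))) {0..2*pi}"
    unfolding circlepath_def by (subst (asm) has_contour_integral_part_circlepath_iff) auto
  have eq: "1 / (1 - cnj a * cis t) / (cis t - a) * \<i> * cis t = \<i> * of_real (1 / (norm (cis t - a))\<^sup>2)" for t
  proof -
    have "of_real ((norm (cis t - a))\<^sup>2) = (cis t - a) * cnj (cis t - a)"
      by (rule complex_norm_square)
    moreover have "cnj (cis t - a) = (1 - cnj a * cis t) / cis t"
      by (simp add: field_simps cis_cnj cis_mult)
    ultimately have "of_real ((norm (cis t - a))\<^sup>2) = (cis t - a) * (1 - cnj a * cis t) / cis t" by simp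
    then have "of_real (1 / (norm (cis t - a))\<^sup>2) = 1 / ((cis t - a) * (1 - cnj a * cis t) / cis t)"
      by (simp only: of_real_divide of_real_1)
    then show ?thesis by (simp add: field_simps)
  qed
  have "((\<lambda>t. Im (1 / (1 - cnj a * cis t) / (cis t - a) * \<i> * cis t)) has_integral Im (2 * pi * \<i> * (1 / (1 - cnj a * a)))) {0..2*pi}"
    by (rule has_integral_Im[OF I])
  moreover have "cnj a * a = of_real ((norm a)\<^sup>2)"
    using complex_norm_square[of a] by (simp add: mult.commute)
  then have "2 * pi * \<i> * (1 / (1 - cnj a * a)) = \<i> * of_real (2 * pi * (1 / (1 - (norm a)\<^sup>2)))"
    by simp
  ultimately have "((\<lambda>t. 1 / (norm (cis t - a))\<^sup>2) has_integral (2 * pi * (1 / (1 - (norm a)\<^sup>2)))) {0..2*pi}"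
    unfolding eq by (simp only: Im_i_times Re_complex_of_real)
  then have "(\<integral>\<^sup>+t. ennreal (1 / (norm (cis t - a))\<^sup>2) * indicator {0..2*pi} t \<partial>lborel) = ennreal (2 * pi * (1 / (1 - (norm a)\<^sup>2)))"
    by (intro nn_integral_has_integral_lebesgue') auto
  then have "(\<integral>\<^sup>+t. ennreal (1 / (norm (cis t - a))\<^sup>2) \<partial>circle_measure) = ennreal (1 / (2 * pi)) * ennreal (2 * pi * (1 / (1 - (norm a)\<^sup>2)))"
    by (subst nn_integral_circle_measure) auto
  also have "\<dots> = ennreal (1 / (1 - (norm a)\<^sup>2))"
    by (simp flip: ennreal_mult')
  also have "\<dots> \<le> ennreal (1 / (1 - norm a))"
  proof (rule ennreal_leI, rule divide_left_mono)
    show "1 - norm a \<le> 1 - (norm a)\<^sup>2" using a power_le_one_iff[of "norm a" 2] by (simp add: power2_eq_square mult_left_le)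
    then show "0 < (1 - (norm a)\<^sup>2) * (1 - norm a)" using a by (intro mult_pos_pos) auto
  qed simp
  finally show ?thesis .
qed

text \<open>Here and below \<open>1 / enn2real q\<close> is \<open>0\<close> for \<open>q = \<infinity>\<close>, as it should be.\<close>

lemma kernel_integral_le_angular_norm:
  assumes a: "norm a < 1" and q: "1 \<le> q" and [measurable]: "u \<in> borel_measurable borel"
  shows "(\<integral>\<^sup>+t. ennreal (1 / (norm (cis t - a))\<^sup>2) * u t \<partial>circle_measure)
    \<le> ennreal (2 * (1 - norm a) powr (- 1 - 1 / enn2real q)) * angular_norm q u"
proof (cases "q = \<infinity>")
  case True
  let ?R = "restrict_space lborel {0..<2*pi}"
  define E where "E = angular_norm q u"
  have "AE t in ?R. u t \<le> E"
    unfolding E_def angular_norm_def using True esssup_AE[of u ?R] by simp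
  then have "AE t in lborel. t \<in> {0..<2*pi} \<longrightarrow> u t \<le> E"
    by (subst (asm) AE_restrict_space_iff) auto
  \<comment> \<open>The essential supremum runs over the half-open interval while
    \<open>circle_measure\<close> lives on the closed one; they differ by a null point.\<close>
  moreover have "AE t in lborel. t \<noteq> 2 * pi"
    by (rule AE_lborel_singleton)
  ultimately have "AE t in circle_measure. u t \<le> E"
    unfolding circle_measure_def by (subst AE_density) (auto elim!: eventually_elim2 simp: indicator_def)
  then have "(\<integral>\<^sup>+t. ennreal (1 / (norm (cis t - a))\<^sup>2) * u t \<partial>circle_measure) \<le> (\<integral>\<^sup>+t. ennreal (1 / (norm (cis t - a))\<^sup>2) * E \<partial>circle_measure)"
    by (intro nn_integral_mono_AE) (auto elim!: eventually_mono intro: mult_left_mono)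
  also have "\<dots> = (\<integral>\<^sup>+t. ennreal (1 / (norm (cis t - a))\<^sup>2) \<partial>circle_measure) * E"
    by (rule nn_integral_multc) measurable
  also have "\<dots> \<le> ennreal (1 / (1 - norm a)) * E"
    by (intro mult_right_mono poisson_integral_le a) auto
  also have "\<dots> \<le> ennreal (2 * (1 - norm a) powr (- 1 - 1 / enn2real q)) * E"
    using True a by (intro mult_right_mono ennreal_leI) (auto simp: powr_minus divide_simps)
  finally show ?thesis by (simp add: E_def)
next
  case False
  define Q where "Q = enn2real q"
  have Q: "1 \<le> Q" unfolding Q_def using enn2real_ge_1[OF q False] .
  define d where "d = 1 - norm a"
  have d: "0 < d" using a by (simp add: d_def)
  let ?k = "\<lambda>t. ennreal (1 / (norm (cis t - a))\<^sup>2)"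
  define N where "N = density circle_measure ?k"
  have [measurable_cong]: "sets N = sets borel" by (simp add: N_def sets_circle_measure)
  have "emeasure N (space N) = (\<integral>\<^sup>+t. ?k t \<partial>circle_measure)"
    unfolding N_def by (subst emeasure_density) auto
  also have "\<dots> \<le> ennreal (1 / d)"
    unfolding d_def by (rule poisson_integral_le[OF a])
  finally have N: "emeasure N (space N) \<le> ennreal (1 / d)" .
  \<comment> \<open>Jensen's inequality uses only the mass \<open>1 / d\<close> of the kernel, and
    this supremum then leads back to \<open>circle_measure\<close>; the exponents add up as
    \<open>- (1 - 1 / Q) - 2 / Q = - 1 - 1 / Q\<close>.\<close>
  have k_le: "?k t \<le> ennreal (d powr - 2)" for t
  proof -
    have "d \<le> norm (cis t - a)" using norm_triangle_ineq2[of "cis t" a] by (simp add: d_def)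
    then have "d\<^sup>2 \<le> (norm (cis t - a))\<^sup>2" using d by (intro power_mono) auto
    then show ?thesis using d by (intro ennreal_leI) (auto simp: powr_minus powr_numeral divide_simps)
  qed
  have "(\<integral>\<^sup>+t. ?k t * u t \<partial>circle_measure) = (\<integral>\<^sup>+t. u t \<partial>N)"
    unfolding N_def by (subst nn_integral_density) auto
  also have "\<dots> \<le> ennreal (2 * (1 / d) powr (1 - 1 / Q)) * ennpow (\<integral>\<^sup>+t. ennpow (u t) Q \<partial>N) (1 / Q)"
    by (rule jensen_ennpow[OF Q _ N]) (use d in auto)
  also have "\<dots> \<le> ennreal (2 * (1 / d) powr (1 - 1 / Q)) * ennpow (ennreal (d powr - 2) * (\<integral>\<^sup>+t. ennpow (u t) Q \<partial>circle_measure)) (1 / Q)"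
  proof (intro mult_left_mono ennpow_mono)
    have "(\<integral>\<^sup>+t. ennpow (u t) Q \<partial>N) = (\<integral>\<^sup>+t. ?k t * ennpow (u t) Q \<partial>circle_measure)"
      unfolding N_def by (subst nn_integral_density) auto
    also have "\<dots> \<le> (\<integral>\<^sup>+t. ennreal (d powr - 2) * ennpow (u t) Q \<partial>circle_measure)"
      by (intro nn_integral_mono mult_right_mono k_le) auto
    also have "\<dots> = ennreal (d powr - 2) * (\<integral>\<^sup>+t. ennpow (u t) Q \<partial>circle_measure)"
      by (rule nn_integral_cmult) measurable
    finally show "(\<integral>\<^sup>+t. ennpow (u t) Q \<partial>N) \<le> ennreal (d powr - 2) * (\<integral>\<^sup>+t. ennpow (u t) Q \<partial>circle_measure)" .
  qed (use Q in auto)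
  also have "\<dots> = ennreal (2 * (1 / d) powr (1 - 1 / Q) * d powr (- 2 / Q)) * angular_norm q u"
    using False Q by (simp add: angular_norm_def Lp_def Q_def[symmetric] ennpow_mult ennpow_ennreal powr_powr ennreal_mult mult.assoc)
  also have "2 * (1 / d) powr (1 - 1 / Q) * d powr (- 2 / Q) = 2 * d powr (- 1 - 1 / Q)"
  proof -
    have "(1 / d) powr (1 - 1 / Q) = d powr (- (1 - 1 / Q))"
      using d by (simp add: powr_divide powr_minus_divide del: minus_diff_eq)
    then show ?thesis by (simp flip: powr_add add: algebra_simps)
  qed
  finally show ?thesis by (simp add: d_def Q_def)
qed

text \<open>Averaging over radii allows the angular integral to become the outer one, as in
  \<open>rho\<close>. The exponent collects \<open>1 - 1 / p\<close> from Jensen's inequality in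
  \<open>r\<close>, \<open>- 1 - 1 / q\<close> from the kernel and \<open>- 1\<close> from dividing
  by the length \<open>d / 2\<close>; the constant is \<open>8 * 2 * 2 * 2\<close>. For
  \<open>k = 0\<close> one power of \<open>1 - norm a\<close> is given away, which is harmless
  because point values are only needed locally.\<close>

lemma norm_higher_deriv_le_rho:
  assumes f: "f \<in> HD" and a: "norm a < 1" and p: "1 \<le> p" and q: "1 \<le> q" and k: "k \<le> 1"
  shows "ennreal (norm ((deriv ^^ k) f a))
    \<le> ennreal (64 * (1 - norm a) powr (- (1 + 1 / p + 1 / enn2real q))) * rho p q f"
proof -
  define d where "d = 1 - norm a"
  have d: "0 < d" using a by (simp add: d_def)
  define s where "s = (1 + norm a) / 2"
  have s: "0 \<le> s" "s < 1" "1 - s = d / 2" using a by (auto simp: s_def d_def field_simps)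
  define X where "X = ennreal (norm ((deriv ^^ k) f a))"
  let ?k = "\<lambda>t. ennreal (1 / (norm (cis t - a))\<^sup>2)"
  let ?f = "\<lambda>r t. ennreal (norm (f (of_real r * cis t)))"
  note [measurable] = HD_polar_measurable[OF f]
  have [measurable]: "radial_norm p 0 f \<in> borel_measurable borel" by (rule radial_norm_measurable[OF f])
  interpret P: pair_sigma_finite "circle_measure" "radial_measure s"
    by (intro pair_sigma_finite.intro sigma_finite_circle_measure sigma_finite_radial_measure)
  have ae: "AE r in radial_measure s. X \<le> (\<integral>\<^sup>+t. 8 * ?k t * ?f r t \<partial>circle_measure)"
  proof -
    have "X \<le> (\<integral>\<^sup>+t. 8 * ?k t * ?f r t \<partial>circle_measure)" if "s \<le> r" "r < 1" for r
    proof -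
      have e8: "ennreal (8 / x) = 8 * ennreal (1 / x)" if "0 \<le> x" for x
        using that ennreal_mult[of 8 "1 / x"] by simp
      show ?thesis
        unfolding X_def using norm_higher_deriv_le_kernel[OF f a _ that(2) k] that(1)
        by (simp add: s_def e8)
    qed
    then show ?thesis unfolding radial_measure_def by (subst AE_density) (auto simp: indicator_def)
  qed
  have inner: "(\<integral>\<^sup>+r. ?f r t \<partial>radial_measure s) \<le> ennreal (2 * d powr (1 - 1 / p)) * radial_norm p 0 f t" for t
  proof -
    have "emeasure (radial_measure s) (space (radial_measure s)) \<le> ennreal d"
      using s d by (simp add: emeasure_radial_measure ennreal_leI)
    then have "(\<integral>\<^sup>+r. ?f r t \<partial>radial_measure s) \<le> ennreal (2 * d powr (1 - 1 / p)) * ennpow (\<integral>\<^sup>+r. ennpow (?f r t) p \<partial>radial_measure s) (1 / p)"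
      by (intro jensen_ennpow p d) measurable
    also have "\<dots> \<le> ennreal (2 * d powr (1 - 1 / p)) * radial_norm p 0 f t"
    proof (rule mult_left_mono)
      show "ennpow (\<integral>\<^sup>+r. ennpow (?f r t) p \<partial>radial_measure s) (1 / p) \<le> radial_norm p 0 f t"
        using p s by (subst radial_norm_eq_Lp[OF f])
          (auto simp: Lp_def nn_integral_radial_measure indicator_def intro!: ennpow_mono nn_integral_mono)
    qed simp
    finally show ?thesis .
  qed
  have "X * ennreal (d / 2) = (\<integral>\<^sup>+r. X \<partial>radial_measure s)"
    using s by (simp add: emeasure_radial_measure flip: s(3))
  also have "\<dots> \<le> (\<integral>\<^sup>+r. (\<integral>\<^sup>+t. 8 * ?k t * ?f r t \<partial>circle_measure) \<partial>radial_measure s)"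
    by (rule nn_integral_mono_AE[OF ae])
  also have "\<dots> = (\<integral>\<^sup>+t. (\<integral>\<^sup>+r. 8 * ?k t * ?f r t \<partial>radial_measure s) \<partial>circle_measure)"
    by (rule P.Fubini') measurable
  also have "\<dots> = (\<integral>\<^sup>+t. 8 * ?k t * (\<integral>\<^sup>+r. ?f r t \<partial>radial_measure s) \<partial>circle_measure)"
    by (intro nn_integral_cong nn_integral_cmult) measurable
  also have "\<dots> \<le> (\<integral>\<^sup>+t. 8 * ?k t * (ennreal (2 * d powr (1 - 1 / p)) * radial_norm p 0 f t) \<partial>circle_measure)"
    by (intro nn_integral_mono mult_left_mono inner) auto
  also have "\<dots> = 8 * ennreal (2 * d powr (1 - 1 / p)) * (\<integral>\<^sup>+t. ?k t * radial_norm p 0 f t \<partial>circle_measure)"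
    by (subst nn_integral_cmult[symmetric]) (auto intro!: nn_integral_cong simp: ac_simps)
  also have "\<dots> \<le> 8 * ennreal (2 * d powr (1 - 1 / p)) * (ennreal (2 * d powr (- 1 - 1 / enn2real q)) * rho p q f)"
    using p by (intro mult_left_mono) (auto simp: rho_eq_angular_norm q f d_def intro!: kernel_integral_le_angular_norm a)
  finally have "X * ennreal (d / 2) * ennreal (2 / d) \<le> 8 * ennreal (2 * d powr (1 - 1 / p)) * (ennreal (2 * d powr (- 1 - 1 / enn2real q)) * rho p q f) * ennreal (2 / d)"
    by (rule mult_right_mono) simp
  also have "\<dots> = ennreal (8 * (2 * d powr (1 - 1 / p)) * (2 * d powr (- 1 - 1 / enn2real q)) * (2 / d)) * rho p q f"
  proof -
    have "ennreal (8 * x * y * z) = 8 * ennreal x * ennreal y * ennreal z" if "0 \<le> x" "0 \<le> y" "0 \<le> z" for x y z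
      using that by (simp add: ennreal_mult)
    from this[of "2 * d powr (1 - 1 / p)" "2 * d powr (- 1 - 1 / enn2real q)" "2 / d"] d
    show ?thesis by (simp only: ac_simps) simp
  qed
  also have "8 * (2 * d powr (1 - 1 / p)) * (2 * d powr (- 1 - 1 / enn2real q)) * (2 / d) = 64 * d powr (- (1 + 1 / p + 1 / enn2real q))"
  proof -
    have "2 / d = 2 * d powr (- 1)" using d by (simp add: powr_minus divide_simps)
    moreover have "d powr (1 - 1 / p) * d powr (- 1 - 1 / enn2real q) * d powr (- 1) = d powr (- (1 + 1 / p + 1 / enn2real q))"
      by (simp only: powr_add[symmetric]) (simp add: algebra_simps)
    moreover have "8 * (2 * x) * (2 * y) * (2 * z) = 64 * (x * y * z)" for x y z :: real by simp
    ultimately show ?thesis by (simp only:)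
  qed
  also have "X * ennreal (d / 2) * ennreal (2 / d) = X"
    using d by (simp add: mult.assoc flip: ennreal_mult)
  finally show ?thesis by (simp add: X_def d_def)
qed

section \<open>Test functions\<close>

text \<open>With \<open>e = 1/p + 1/q\<close> the scaling makes the norm in \<open>RM(p,q)\<close> at most \<open>1\<close>.\<close>

definition test_fun :: "real \<Rightarrow> complex \<Rightarrow> complex \<Rightarrow> complex" where
  "test_fun e a z = (if z \<in> disc then of_real ((1 - norm a) powr (3 - e) / 27) / (1 - cnj a * z) ^ 3 else 0)"

lemma norm_one_minus_cnj_ge:
  assumes "norm a < 1" "norm z \<le> 1"
  shows "1 - norm z \<le> norm (1 - cnj a * z)" "1 - norm a \<le> norm (1 - cnj a * z)" "1 - cnj a * z \<noteq> 0"
proof -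
  have *: "1 - norm a * norm z \<le> norm (1 - cnj a * z)"
    using norm_triangle_ineq2[of 1 "cnj a * z"] by (simp add: norm_mult)
  moreover have "norm a * norm z \<le> norm z" "norm a * norm z \<le> norm a"
    using assms by (simp_all add: mult_left_le mult_left_le_one_le)
  ultimately show "1 - norm z \<le> norm (1 - cnj a * z)" "1 - norm a \<le> norm (1 - cnj a * z)" by linarith+
  with assms show "1 - cnj a * z \<noteq> 0" by auto
qed

lemma test_fun_HD:
  assumes "norm a < 1"
  shows "test_fun e a \<in> HD"
  unfolding test_fun_def[abs_def] using norm_one_minus_cnj_ge(3)[OF assms]
  by (intro HD_I holomorphic_intros) auto

text \<open>By the triangle inequality and \<open>1 - r \<le> norm (1 - cnj a * z)\<close>, the sum
  \<open>norm (cis t - a) + (1 - r)\<close> is at most \<open>3 * norm (1 - cnj a * z)\<close>; the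
  constant \<open>27 = 3 ^ 3\<close> in \<open>test_fun\<close> absorbs this.\<close>

lemma test_fun_polar_le:
  assumes a: "norm a < 1" and r: "0 \<le> r" "r < 1"
  shows "norm (test_fun e a (of_real r * cis t)) \<le> (1 - norm a) powr (3 - e) / (norm (cis t - a) + (1 - r)) ^ 3"
proof -
  let ?z = "of_real r * cis t" and ?D = "norm (cis t - a)"
  have nz: "norm ?z = r" using r by (simp add: norm_mult)
  have "1 - cnj a * cis t = (1 - cnj a * ?z) - cnj a * (of_real (1 - r) * cis t)"
    by (simp add: algebra_simps)
  then have "norm (1 - cnj a * cis t) \<le> norm (1 - cnj a * ?z) + norm (cnj a * (of_real (1 - r) * cis t))"
    by (metis norm_triangle_ineq4)
  also have "norm (cnj a * (of_real (1 - r) * cis t)) = norm a * (1 - r)"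
    using r unfolding norm_mult norm_of_real by simp
  also have "\<dots> \<le> 1 - r" using a r by (simp add: mult_left_le_one_le)
  finally have "?D + (1 - r) \<le> 3 * norm (1 - cnj a * ?z)"
    using norm_one_minus_cnj_ge(1)[OF a, of ?z] nz r by (simp add: norm_cis_minus)
  then have "(?D + (1 - r)) ^ 3 \<le> (3 * norm (1 - cnj a * ?z)) ^ 3"
    using r by (intro power_mono) auto
  then have "(?D + (1 - r)) ^ 3 \<le> 27 * norm (1 - cnj a * ?z) ^ 3" by (simp add: power_mult_distrib)
  moreover have "0 < (?D + (1 - r)) ^ 3" using r by (intro zero_less_power add_nonneg_pos) auto
  ultimately have "(1 - norm a) powr (3 - e) / (27 * norm (1 - cnj a * ?z) ^ 3) \<le> (1 - norm a) powr (3 - e) / (?D + (1 - r)) ^ 3"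
    by (intro divide_left_mono mult_pos_pos) auto
  then show ?thesis using ray_in_disc[OF r, of t]
    by (simp add: test_fun_def norm_divide norm_power)
qed

text \<open>Of the power \<open>- 3 * p\<close> of \<open>D + (1 - r)\<close>, the part
  \<open>2 - 3 * p\<close> is bounded by its value at \<open>r = 1\<close> and the remaining
  \<open>- 2\<close> integrates to at most \<open>1 / D\<close>. The \<open>p\<close>-th root of
  \<open>D powr (1 - 3 * p)\<close> gives the exponent.\<close>

lemma radial_norm_test_fun_le:
  assumes a: "norm a < 1" and p: "1 \<le> p"
  shows "radial_norm p 0 (test_fun e a) t \<le> ennreal ((1 - norm a) powr (3 - e) * norm (cis t - a) powr (1 / p - 3))"
proof -
  define D where "D = norm (cis t - a)"
  define c where "c = (1 - norm a) powr (3 - e)"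
  have D: "0 < D" using norm_triangle_ineq2[of "cis t" a] a by (auto simp: D_def)
  have c: "0 < c" using a by (simp add: c_def)
  have pw: "norm (test_fun e a (of_real r * cis t)) powr p \<le> c powr p * D powr (2 - 3 * p) * (D + (1 - r)) powr (- 2)"
    if r: "0 \<le> r" "r < 1" for r
  proof -
    have x: "0 < D + (1 - r)" using D r by simp
    have "norm (test_fun e a (of_real r * cis t)) \<le> c * (D + (1 - r)) powr (- 3)"
      using test_fun_polar_le[OF a r, of e t] x by (simp add: D_def c_def powr_minus powr_numeral divide_inverse)
    then have "norm (test_fun e a (of_real r * cis t)) powr p \<le> (c * (D + (1 - r)) powr (- 3)) powr p"
      using p by (intro powr_mono2) auto
    also have "\<dots> = c powr p * ((D + (1 - r)) powr (2 - 3 * p) * (D + (1 - r)) powr (- 2))"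
      using c by (simp add: powr_mult powr_powr flip: powr_add)
    also have "\<dots> \<le> c powr p * (D powr (2 - 3 * p) * (D + (1 - r)) powr (- 2))"
      using p r D by (intro mult_left_mono mult_right_mono powr_mono2') auto
    finally show ?thesis by (simp add: mult.assoc)
  qed
  have "((\<lambda>r. (D + (1 - r)) powr (- 2)) has_integral (inverse (D + (1 - 1)) - inverse (D + (1 - 0)))) {0..1}"
  proof (rule fundamental_theorem_of_calculus)
    show "((\<lambda>r. inverse (D + (1 - r))) has_vector_derivative (D + (1 - x)) powr (- 2)) (at x within {0..1})"
      if "x \<in> {0..1}" for x
      using that D
      by (auto intro!: derivative_eq_intros simp: has_real_derivative_iff_has_vector_derivative[symmetric]
          powr_minus powr_numeral power2_eq_square)
  qed simp
  then have I: "(\<integral>\<^sup>+r. ennreal ((D + (1 - r)) powr (- 2)) * indicator {0..1} r \<partial>lborel) \<le> ennreal (1 / D)"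
    by (subst nn_integral_has_integral_lebesgue'[where I="inverse (D + (1 - 1)) - inverse (D + (1 - 0))"])
      (use D in \<open>auto intro!: ennreal_leI simp: inverse_eq_divide\<close>)
  have "radial_int p (test_fun e a) 0 t \<le>
      (\<integral>\<^sup>+r. ennreal (c powr p * D powr (2 - 3 * p)) * (ennreal ((D + (1 - r)) powr (- 2)) * indicator {0..1} r) \<partial>lborel)"
    unfolding radial_int_def using pw
    by (intro nn_integral_mono) (auto simp: indicator_def ennreal_leI simp flip: ennreal_mult)
  also have "\<dots> = ennreal (c powr p * D powr (2 - 3 * p)) * (\<integral>\<^sup>+r. ennreal ((D + (1 - r)) powr (- 2)) * indicator {0..1} r \<partial>lborel)"
    by (rule nn_integral_cmult) measurable
  also have "\<dots> \<le> ennreal (c powr p * D powr (2 - 3 * p)) * ennreal (1 / D)"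
    by (intro mult_left_mono I) auto
  also have "\<dots> = ennreal (c powr p * D powr (1 - 3 * p))"
    using D by (simp add: powr_diff field_simps power2_eq_square powr_numeral flip: ennreal_mult)
  finally have "radial_norm p 0 (test_fun e a) t \<le> ennpow (ennreal (c powr p * D powr (1 - 3 * p))) (1 / p)"
    unfolding radial_norm_def using p by (intro ennpow_mono) auto
  also have "\<dots> = ennreal (c * D powr (1 / p - 3))"
    using p c by (simp add: ennpow_ennreal powr_mult powr_powr diff_divide_distrib)
  finally show ?thesis by (simp add: c_def D_def)
qed

text \<open>For \<open>q = \<infinity>\<close> the bound \<open>d \<le> norm (cis t - a)\<close>
  makes the exponents cancel at each angle. For finite \<open>q\<close> two negative powers of
  \<open>norm (cis t - a)\<close> are set aside for the Poisson integral and the rest is replaced by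
  a power of \<open>d\<close>; the total exponent of \<open>d\<close> vanishes precisely for this
  \<open>e\<close>.\<close>

lemma rho_test_fun_le_1:
  assumes a: "norm a < 1" and p: "1 \<le> p" and q: "1 \<le> q" and e: "e = 1 / p + 1 / enn2real q"
  shows "rho p q (test_fun e a) \<le> 1"
proof (cases "q = \<infinity>")
  case True
  define d where "d = 1 - norm a"
  have d: "0 < d" using a by (simp add: d_def)
  have [measurable]: "radial_norm p 0 (test_fun e a) \<in> borel_measurable borel" by (rule radial_norm_measurable[OF test_fun_HD[OF a]])
  have "rho p q (test_fun e a) = angular_norm q (radial_norm p 0 (test_fun e a))"
    using p q by (intro rho_eq_angular_norm test_fun_HD a) auto
  also have "\<dots> \<le> angular_norm q (\<lambda>t. 1)"
  proof (rule angular_norm_mono[OF q])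
    fix t
    have dD: "d \<le> norm (cis t - a)" using norm_triangle_ineq2[of "cis t" a] by (simp add: d_def)
    have "d powr (3 - e) * norm (cis t - a) powr (1 / p - 3) \<le> d powr (3 - e) * d powr (1 / p - 3)"
      using dD d p by (intro mult_left_mono powr_mono2') (auto simp: field_simps)
    also have "\<dots> = 1" using True d e by (simp flip: powr_add)
    finally show "radial_norm p 0 (test_fun e a) t \<le> 1"
      using radial_norm_test_fun_le[OF a p, of e t] by (simp add: d_def) (metis ennreal_1 ennreal_leI order_trans)
  qed measurable
  also have "\<dots> = 1" by (rule angular_norm_const[OF q])
  finally show ?thesis .
next
  case False
  define d where "d = 1 - norm a"
  define Q where "Q = enn2real q"
  have Q: "1 \<le> Q" unfolding Q_def using enn2real_ge_1[OF q False] .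
  have d: "0 < d" using a by (simp add: d_def)
  have [measurable]: "radial_norm p 0 (test_fun e a) \<in> borel_measurable borel" by (rule radial_norm_measurable[OF test_fun_HD[OF a]])
  have pw: "ennpow (radial_norm p 0 (test_fun e a) t) Q \<le> ennreal d * ennreal (1 / (norm (cis t - a))\<^sup>2)" for t
  proof -
    define D where "D = norm (cis t - a)"
    have dD: "d \<le> D" using norm_triangle_ineq2[of "cis t" a] by (simp add: d_def D_def)
    then have D: "0 < D" using d by simp
    have "1 / p \<le> 1" using p by simp
    then have "Q * (3 - 1 / p) \<ge> Q * 2" using Q by (intro mult_left_mono) auto
    \<comment> \<open>The exponent 3 is exactly what the case \<open>p = Q = 1\<close> requires,
      where the left-hand side is 0.\<close>
    then have ex: "Q / p - 3 * Q + 2 \<le> 0" using Q by (simp add: algebra_simps)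
    have "ennpow (radial_norm p 0 (test_fun e a) t) Q \<le> ennpow (ennreal (d powr (3 - e) * D powr (1 / p - 3))) Q"
      using radial_norm_test_fun_le[OF a p, of e t] Q by (intro ennpow_mono) (auto simp: d_def D_def)
    also have "\<dots> = ennreal (d powr ((3 - e) * Q) * D powr ((1 / p - 3) * Q))"
      by (simp add: ennpow_ennreal powr_mult powr_powr)
    also have "D powr ((1 / p - 3) * Q) = D powr (Q / p - 3 * Q + 2) * D powr (- 2)"
      by (simp add: algebra_simps flip: powr_add)
    also have "ennreal (d powr ((3 - e) * Q) * (D powr (Q / p - 3 * Q + 2) * D powr (- 2)))
        \<le> ennreal (d powr ((3 - e) * Q) * (d powr (Q / p - 3 * Q + 2) * D powr (- 2)))"
      using dD d ex by (intro ennreal_leI mult_left_mono mult_right_mono powr_mono2') auto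
    also have "d powr ((3 - e) * Q) * (d powr (Q / p - 3 * Q + 2) * D powr (- 2)) = d * (1 / D\<^sup>2)"
    proof -
      have "(3 - e) * Q + (Q / p - 3 * Q + 2) = 1" using Q by (simp add: e Q_def[symmetric] algebra_simps)
      then have "d powr ((3 - e) * Q) * d powr (Q / p - 3 * Q + 2) = d"
        using d by (simp only: powr_add[symmetric]) simp
      moreover have "D powr (- 2) = 1 / D\<^sup>2"
        using D by (simp add: powr_minus powr_numeral divide_inverse)
      ultimately show ?thesis by (simp only: mult.assoc[symmetric])
    qed
    also have "ennreal (d * (1 / D\<^sup>2)) = ennreal d * ennreal (1 / D\<^sup>2)"
      using d by (intro ennreal_mult) auto
    finally show ?thesis by (simp add: D_def)
  qed
  have "(\<integral>\<^sup>+t. ennpow (radial_norm p 0 (test_fun e a) t) Q \<partial>circle_measure) \<le> (\<integral>\<^sup>+t. ennreal d * ennreal (1 / (norm (cis t - a))\<^sup>2) \<partial>circle_measure)"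
    by (intro nn_integral_mono pw)
  also have "\<dots> = ennreal d * (\<integral>\<^sup>+t. ennreal (1 / (norm (cis t - a))\<^sup>2) \<partial>circle_measure)"
    by (rule nn_integral_cmult) measurable
  also have "\<dots> \<le> ennreal d * ennreal (1 / d)"
    unfolding d_def by (intro mult_left_mono poisson_integral_le a) auto
  also have "\<dots> = 1" using d by (simp flip: ennreal_mult)
  finally have "ennpow (\<integral>\<^sup>+t. ennpow (radial_norm p 0 (test_fun e a) t) Q \<partial>circle_measure) (1 / Q) \<le> ennpow 1 (1 / Q)"
    using Q by (intro ennpow_mono) auto
  then show ?thesis
    using False p q by (simp add: rho_eq_angular_norm test_fun_HD a angular_norm_def Lp_def Q_def ennpow_def)
qed

text \<open>At \<open>z = a\<close> the base of the denominator is
  \<open>1 - (norm a)\<^sup>2 \<le> 2 * d\<close>, hence \<open>216 = 27 * 2 ^ 3\<close>.\<close>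

lemma test_fun_at_ge:
  assumes a: "norm a < 1"
  shows "(1 - norm a) powr (- e) / 216 \<le> norm (test_fun e a a)"
proof -
  define d where "d = 1 - norm a"
  have d: "0 < d" using a by (simp add: d_def)
  have "1 - cnj a * a = of_real (1 - (norm a)\<^sup>2)"
    using complex_norm_square[of a] by (simp add: mult.commute)
  moreover have "1 - (norm a)\<^sup>2 = d * (1 + norm a)" by (simp add: d_def power2_eq_square algebra_simps)
  ultimately have n: "norm (1 - cnj a * a) = d * (1 + norm a)" using d by (simp only: norm_of_real) (simp add: abs_mult)
  then have "norm (1 - cnj a * a) \<le> 2 * d" using d a by simp
  then have "norm (1 - cnj a * a) ^ 3 \<le> (2 * d) ^ 3" by (intro power_mono) auto
  moreover have "0 < norm (1 - cnj a * a) ^ 3" unfolding n using d norm_ge_zero[of a] by (intro zero_less_power mult_pos_pos) linarith+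
  ultimately have "d powr (3 - e) / 27 / (2 * d) ^ 3 \<le> d powr (3 - e) / 27 / norm (1 - cnj a * a) ^ 3"
    using d by (intro divide_left_mono mult_pos_pos) auto
  also have "\<dots> = norm (test_fun e a a)"
    using a by (simp add: test_fun_def d_def norm_divide norm_power)
  also have "d powr (3 - e) / 27 / (2 * d) ^ 3 = d powr (- e) / 216"
    using d by (simp add: powr_diff powr_minus powr_numeral power_mult_distrib divide_simps)
  finally show ?thesis by (simp add: d_def)
qed

text \<open>The growth \<open>d powr (- e)\<close> of the test function at \<open>a\<close> meets
  the growth \<open>d powr (- (1 + e))\<close> of the derivative bound, and exactly one power of
  \<open>d\<close> survives. The constant is \<open>216 * 64\<close>.\<close>

lemma bloch_le_rho_T_op_test_fun:
  assumes g: "g \<in> HD" and a: "norm a < 1" and p: "1 \<le> p" and q: "1 \<le> q" and e: "e = 1 / p + 1 / enn2real q"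
  shows "ennreal ((1 - norm a) * norm (deriv g a)) \<le> 13824 * rho p q (T_op g (test_fun e a))"
proof -
  define d where "d = 1 - norm a"
  have d: "0 < d" using a by (simp add: d_def)
  let ?F = "T_op g (test_fun e a)"
  note T = T_op_props[OF test_fun_HD[OF a, of e] g]
  have "d powr (- e) / 216 * norm (deriv g a) \<le> norm (test_fun e a a) * norm (deriv g a)"
    using test_fun_at_ge[OF a, of e] by (intro mult_right_mono) (auto simp: d_def)
  also have "\<dots> = norm ((deriv ^^ 1) ?F a)"
    using T(3)[of a] a by (simp add: norm_mult)
  finally have "ennreal (d powr (- e) / 216 * norm (deriv g a)) \<le> ennreal (norm ((deriv ^^ 1) ?F a))"
    by (rule ennreal_leI)
  also have "\<dots> \<le> ennreal (64 * d powr (- (1 + e))) * rho p q ?F"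
    using norm_higher_deriv_le_rho[OF T(1) a p q, of 1] by (simp add: e d_def add.assoc)
  finally have "ennreal (216 * d powr (1 + e)) * ennreal (d powr (- e) / 216 * norm (deriv g a))
      \<le> ennreal (216 * d powr (1 + e)) * (ennreal (64 * d powr (- (1 + e))) * rho p q ?F)"
    by (rule mult_left_mono) simp
  moreover have "216 * d powr (1 + e) * (d powr (- e) / 216 * norm (deriv g a)) = d * norm (deriv g a)"
    using d by (simp add: powr_add powr_minus)
  then have "ennreal (216 * d powr (1 + e)) * ennreal (d powr (- e) / 216 * norm (deriv g a)) = ennreal (d * norm (deriv g a))"
    by (subst ennreal_mult[symmetric]) (simp_all only:, auto)
  moreover have "216 * d powr (1 + e) * (64 * d powr (- (1 + e))) = 13824"
  proof -
    have "d powr (1 + e) * d powr (- (1 + e)) = 1"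
      using d by (simp only: powr_add[symmetric]) simp
    then show ?thesis by (simp only: mult.assoc mult.left_commute)
  qed
  then have "ennreal (216 * d powr (1 + e)) * ennreal (64 * d powr (- (1 + e))) = 13824"
    by (simp flip: ennreal_mult)
  ultimately show ?thesis by (simp add: d_def mult.assoc[symmetric])
qed

section \<open>The metric space \<open>RM(p,q)\<close> and boundedness\<close>

lemma RM_D:
  assumes "f \<in> RM p q"
  shows "f \<in> HD" "rho p q f < \<infinity>"
  using assms by (auto simp: RM_def)

lemma RM0_subset_RM: "RM0 p \<subseteq> RM p \<infinity>"
  by (auto simp: RM0_def)

lemma HD_diff: "f \<in> HD \<Longrightarrow> h \<in> HD \<Longrightarrow> (\<lambda>z. f z - h z) \<in> HD"
  by (simp add: HD_def holomorphic_on_diff)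

lemma radial_int_diff_commute: "radial_int p (\<lambda>z. f z - h z) s t = radial_int p (\<lambda>z. h z - f z) s t"
  by (simp add: radial_int_def norm_minus_commute)

lemma rho_diff_commute: "rho p q (\<lambda>z. f z - h z) = rho p q (\<lambda>z. h z - f z)"
  unfolding rho_def by (simp add: radial_int_diff_commute[of p f h])

text \<open>Formulated with pointwise domination instead of a sum, so that the triangle inequality
  and the bound for a difference are both instances.\<close>

lemma rho_triangle:
  assumes f: "f \<in> HD" and h: "h \<in> HD" and k: "k \<in> HD" and p: "1 \<le> p" and q: "1 \<le> q"
    and le: "\<And>z. norm (f z) \<le> norm (h z) + norm (k z)"
  shows "rho p q f \<le> rho p q h + rho p q k"
proof -
  note [measurable] = HD_polar_measurable[OF f] HD_polar_measurable[OF h] HD_polar_measurable[OF k]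
  have m: "radial_norm p 0 f \<in> borel_measurable borel" "radial_norm p 0 h \<in> borel_measurable borel" "radial_norm p 0 k \<in> borel_measurable borel"
    using f h k by (auto intro: radial_norm_measurable)
  have p0: "0 < p" using p by simp
  have "radial_norm p 0 f t \<le> radial_norm p 0 h t + radial_norm p 0 k t" for t
  proof -
    have "radial_norm p 0 f t \<le> Lp (radial_measure 0) p (\<lambda>r. ennreal (norm (h (of_real r * cis t))) + ennreal (norm (k (of_real r * cis t))))"
      unfolding radial_norm_eq_Lp[OF f p0] using p le
      by (intro Lp_mono) (auto intro!: ennreal_leI simp flip: ennreal_plus)
    also have "\<dots> \<le> radial_norm p 0 h t + radial_norm p 0 k t"
      unfolding radial_norm_eq_Lp[OF h p0] radial_norm_eq_Lp[OF k p0] by (intro Lp_triangle p) measurable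
    finally show ?thesis .
  qed
  then have "rho p q f \<le> angular_norm q (\<lambda>t. radial_norm p 0 h t + radial_norm p 0 k t)"
    unfolding rho_eq_angular_norm[OF p0 q f] by (intro angular_norm_mono q m)
  also have "\<dots> \<le> rho p q h + rho p q k"
    unfolding rho_eq_angular_norm[OF p0 q h] rho_eq_angular_norm[OF p0 q k] by (intro angular_norm_triangle q m)
  finally show ?thesis .
qed

lemma rho_diff_triangle:
  assumes "f \<in> HD" "h \<in> HD" "k \<in> HD" "1 \<le> p" "1 \<le> q"
  shows "rho p q (\<lambda>z. f z - k z) \<le> rho p q (\<lambda>z. f z - h z) + rho p q (\<lambda>z. h z - k z)"
proof (rule rho_triangle)
  show "norm (f z - k z) \<le> norm (f z - h z) + norm (h z - k z)" for z
    using norm_triangle_ineq[of "f z - h z" "h z - k z"] by simp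
qed (use assms in \<open>auto intro: HD_diff\<close>)

lemma rho_diff_le:
  assumes "f \<in> HD" "h \<in> HD" "1 \<le> p" "1 \<le> q"
  shows "rho p q (\<lambda>z. f z - h z) \<le> rho p q f + rho p q h"
  using assms by (intro rho_triangle HD_diff norm_triangle_ineq4)

lemma norm_le_rho:
  assumes "f \<in> HD" "norm a < 1" "1 \<le> p" "1 \<le> q"
  shows "ennreal (norm (f a)) \<le> ennreal (64 * (1 - norm a) powr (- (1 + 1 / p + 1 / enn2real q))) * rho p q f"
  using norm_higher_deriv_le_rho[OF assms, of 0] by simp

lemma ennreal_rho_norm: "rho p q f < \<infinity> \<Longrightarrow> ennreal (rho_norm p q f) = rho p q f"
  by (simp add: rho_norm_def)

lemma RM_diff:
  assumes "f \<in> RM p q" "h \<in> RM p q" "1 \<le> p" "1 \<le> q"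
  shows "(\<lambda>z. f z - h z) \<in> RM p q"
proof -
  have "rho p q (\<lambda>z. f z - h z) \<le> rho p q f + rho p q h"
    using assms by (intro rho_diff_le) (auto simp: RM_def)
  also have "\<dots> < \<infinity>" using assms by (simp add: RM_def)
  finally show ?thesis using assms by (auto simp: RM_def HD_diff)
qed

text \<open>Distance 0 forces equality because the evaluation bound makes the difference vanish at
  every point of the disc, and off the disc both functions are 0 by the encoding of
  \<open>HD\<close>.\<close>

lemma Metric_space_RM:
  assumes p: "1 \<le> p" and q: "1 \<le> q"
  shows "Metric_space (RM p q) (\<lambda>f h. rho_norm p q (\<lambda>z. f z - h z))"
proof
  fix f h k
  show "0 \<le> rho_norm p q (\<lambda>z. f z - h z)" by (simp add: rho_norm_def)
  show "rho_norm p q (\<lambda>z. f z - h z) = rho_norm p q (\<lambda>z. h z - f z)"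
    by (simp add: rho_norm_def rho_diff_commute[of p q f h])
  assume f: "f \<in> RM p q" and h: "h \<in> RM p q"
  note fh = RM_diff[OF f h p q]
  show "rho_norm p q (\<lambda>z. f z - h z) = 0 \<longleftrightarrow> f = h"
  proof
    assume "rho_norm p q (\<lambda>z. f z - h z) = 0"
    then have 0: "rho p q (\<lambda>z. f z - h z) = 0"
      using ennreal_rho_norm[OF RM_D(2)[OF fh]] by simp
    show "f = h"
    proof
      fix z
      show "f z = h z"
      proof (cases "norm z < 1")
        case True
        then show ?thesis using norm_le_rho[OF RM_D(1)[OF fh] True p q] 0 by simp
      next
        case False
        then show ?thesis using RM_D(1)[OF f] RM_D(1)[OF h] by (simp add: HD_def)
      qed
    qed
  next
    assume "f = h"
    have "(\<lambda>z::complex. 0::complex) \<in> HD" by (simp add: HD_def)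
    then have "rho p q (\<lambda>z. 0) \<le> angular_norm q (\<lambda>t. 0)"
      using p q by (subst rho_eq_angular_norm) (auto simp: radial_norm_def radial_int_def intro!: angular_norm_mono)
    then have "rho p q (\<lambda>z. 0) = 0" using angular_norm_const[OF q, of 0] by simp
    then show "rho_norm p q (\<lambda>z. f z - h z) = 0"
      using \<open>f = h\<close> by (simp add: rho_norm_def)
  qed
  assume k: "k \<in> RM p q"
  have "ennreal (rho_norm p q (\<lambda>z. f z - k z)) \<le> ennreal (rho_norm p q (\<lambda>z. f z - h z)) + ennreal (rho_norm p q (\<lambda>z. h z - k z))"
    using RM_diff[OF f k p q] RM_diff[OF h k p q] fh rho_diff_triangle[OF RM_D(1)[OF f] RM_D(1)[OF h] RM_D(1)[OF k] p q]
    by (simp only: ennreal_rho_norm[OF RM_D(2)])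
  then show "rho_norm p q (\<lambda>z. f z - k z) \<le> rho_norm p q (\<lambda>z. f z - h z) + rho_norm p q (\<lambda>z. h z - k z)"
    by (simp add: rho_norm_def flip: ennreal_plus)
qed

section \<open>Growth of the derivative under the Bloch conditions, and boundedness of
  \<open>T_op\<close>\<close>

lemma bloch_bound:
  assumes "g \<in> Bloch"
  obtains C where "0 \<le> C" "\<And>z. z \<in> disc \<Longrightarrow> norm (deriv g z) \<le> C / (1 - norm z)"
proof -
  obtain C where C: "\<And>z. z \<in> disc \<Longrightarrow> (1 - (norm z)\<^sup>2) * norm (deriv g z) \<le> C"
    using assms unfolding Bloch_def bdd_above_def by blast
  have "norm (deriv g z) \<le> C / (1 - norm z)" if z: "z \<in> disc" for z
  proof -
    have "(norm z)\<^sup>2 \<le> norm z" using z by (simp add: power2_eq_square mult_left_le)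
    then have "(1 - norm z) * norm (deriv g z) \<le> (1 - (norm z)\<^sup>2) * norm (deriv g z)"
      by (intro mult_right_mono) auto
    with C[OF z] z show ?thesis by (simp add: field_simps)
  qed
  moreover have "0 \<le> C" using order_trans[OF norm_ge_zero, of "deriv g 0" C] C[of 0] by simp
  ultimately show ?thesis using that by blast
qed

lemma little_bloch_bound:
  assumes "g \<in> little_Bloch" "0 < c"
  obtains R where "0 \<le> R" "R < 1" "\<And>z. R \<le> norm z \<Longrightarrow> norm z < 1 \<Longrightarrow> norm (deriv g z) \<le> c / (1 - norm z)"
proof -
  have "((\<lambda>z. (1 - (norm z)\<^sup>2) * norm (deriv g z)) \<longlongrightarrow> 0) (filtercomap norm (at_left 1))"
    using assms(1) by (simp add: little_Bloch_def)
  from order_tendstoD(2)[OF this assms(2)]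
  have "\<exists>P. eventually P (at_left 1) \<and> (\<forall>z. P (norm z) \<longrightarrow> (1 - (norm z)\<^sup>2) * norm (deriv g z) < c)"
    by (simp only: eventually_filtercomap)
  then obtain P where P: "eventually P (at_left (1::real))" "\<forall>z. P (norm z) \<longrightarrow> (1 - (norm z)\<^sup>2) * norm (deriv g z) < c"
    by (elim exE conjE) (rule that)
  from P(1) obtain b where b: "b < 1" "\<And>y. b < y \<Longrightarrow> y < 1 \<Longrightarrow> P y"
    unfolding eventually_at_left_field by metis
  \<comment> \<open>The midpoint lies strictly above \<open>b\<close>, so the non-strict condition
    \<open>R \<le> norm z\<close> suffices.\<close>
  define R where "R = max 0 ((1 + b) / 2)"
  have "norm (deriv g z) \<le> c / (1 - norm z)" if z: "R \<le> norm z" "norm z < 1" for z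
  proof -
    have "(norm z)\<^sup>2 \<le> norm z" using z by (simp add: power2_eq_square mult_left_le)
    then have "(1 - norm z) * norm (deriv g z) \<le> (1 - (norm z)\<^sup>2) * norm (deriv g z)"
      by (intro mult_right_mono) auto
    also have "b < norm z" using z b(1) by (simp add: R_def)
    then have "(1 - (norm z)\<^sup>2) * norm (deriv g z) \<le> c"
      using P(2) b(2)[OF _ z(2)] by (intro less_imp_le) blast
    finally show ?thesis using z by (simp add: pos_le_divide_eq mult.commute)
  qed
  moreover have "0 \<le> R" "R < 1" using b by (auto simp: R_def)
  ultimately show ?thesis using that by blast
qed

lemma HD_bound_cball:
  assumes "f \<in> HD" "R < 1"
  obtains B where "0 \<le> B" "\<And>z. norm z \<le> R \<Longrightarrow> norm (f z) \<le> B"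
proof -
  have "continuous_on (cball 0 R) f"
    by (rule holomorphic_on_imp_continuous_on[OF holomorphic_on_subset[of f disc]]) (use assms in \<open>auto simp: HD_def\<close>)
  then have "bounded (f ` cball 0 R)"
    by (intro compact_imp_bounded compact_continuous_image) auto
  then obtain B where B: "\<forall>y\<in>f ` cball 0 R. norm y \<le> B"
    unfolding bounded_iff by blast
  show ?thesis
  proof (rule that[of "max B 0"])
    show "norm (f z) \<le> max B 0" if "norm z \<le> R" for z
      using B that by (simp add: le_max_iff_disj)
  qed simp
qed

lemma ray_measurable:
  assumes "f \<in> HD"
  shows "(\<lambda>s. ennreal (norm (f (of_real s * cis t)))) \<in> borel_measurable borel"
proof -
  note [measurable] = HD_polar_measurable[OF assms]
  show ?thesis by measurable
qed

lemma radial_norm_T_op_le: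
  assumes f: "f \<in> HD" and g: "g \<in> HD" and p: "1 \<le> p" and C: "0 \<le> C"
    and le: "\<And>z. z \<in> disc \<Longrightarrow> norm (deriv g z) \<le> C / (1 - norm z)"
  shows "radial_norm p 0 (T_op g f) t \<le> ennreal (2 * p * C) * radial_norm p 0 f t"
proof -
  note T = T_op_props[OF f g]
  have "radial_norm p 0 (T_op g f) t \<le> ennreal (0 * (1 - 0) powr (1 / p)) + ennreal (2 * p * C) * Lp (radial_measure 0) p (\<lambda>s. ennreal (norm (f (of_real s * cis t))))"
  proof (rule radial_norm_le_of_deriv_le[OF T(1,2) p _ C ray_measurable[OF f]])
    fix s :: real
    assume s: "0 \<le> s" "s < 1"
    let ?z = "of_real s * cis t"
    have "norm (f ?z) * norm (deriv g ?z) \<le> norm (f ?z) * (C / (1 - s))"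
      using le[OF ray_in_disc[OF s, of t]] s by (intro mult_left_mono) (auto simp: norm_mult)
    then have "norm (deriv (T_op g f) ?z) \<le> norm (f ?z) * (C / (1 - s))"
      unfolding T(3)[OF ray_in_disc[OF s, of t]] norm_mult .
    then have "ennreal (norm (deriv (T_op g f) ?z)) \<le> ennreal (C * (norm (f ?z) * (1 / (1 - s))))"
      by (intro ennreal_leI) (simp add: ac_simps)
    also have "\<dots> = ennreal 0 + ennreal C * (ennreal (norm (f ?z)) * ennreal (1 / (1 - s)))"
      using C s by (simp add: ennreal_mult del: times_divide_eq_right)
    finally show "ennreal (norm (deriv (T_op g f) ?z)) \<le> ennreal 0 + ennreal C * (ennreal (norm (f ?z)) * ennreal (1 / (1 - s)))" .
  qed auto
  then show ?thesis using p by (simp add: radial_norm_eq_Lp[OF f])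
qed

lemma rho_T_op_le:
  assumes f: "f \<in> HD" and g: "g \<in> HD" and p: "1 \<le> p" and q: "1 \<le> q" and C: "0 \<le> C"
    and le: "\<And>z. z \<in> disc \<Longrightarrow> norm (deriv g z) \<le> C / (1 - norm z)"
  shows "rho p q (T_op g f) \<le> ennreal (2 * p * C) * rho p q f"
proof -
  have p0: "0 < p" using p by simp
  have "angular_norm q (radial_norm p 0 (T_op g f)) \<le> angular_norm q (\<lambda>t. ennreal (2 * p * C) * radial_norm p 0 f t)"
    using radial_norm_T_op_le[OF f g p C le] by (intro angular_norm_mono q radial_norm_measurable T_op_props f g)
  also have "\<dots> \<le> ennreal (2 * p * C) * angular_norm q (radial_norm p 0 f)"
    by (intro angular_norm_cmult_le q radial_norm_measurable f)
  finally show ?thesis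
    using T_op_props(1)[OF f g] by (simp add: rho_eq_angular_norm[OF p0 q] f)
qed

lemma T_op_RM:
  assumes f: "f \<in> RM p q" and g: "g \<in> Bloch" and p: "1 \<le> p" and q: "1 \<le> q"
  shows "T_op g f \<in> RM p q"
proof -
  obtain C where C: "0 \<le> C" "\<And>z. z \<in> disc \<Longrightarrow> norm (deriv g z) \<le> C / (1 - norm z)"
    using bloch_bound[OF g] by blast
  have gHD: "g \<in> HD" using g by (simp add: Bloch_def)
  have "rho p q (T_op g f) \<le> ennreal (2 * p * C) * rho p q f"
    by (rule rho_T_op_le[OF RM_D(1)[OF f] gHD p q C])
  also have "\<dots> < \<infinity>" using RM_D(2)[OF f] by (simp add: ennreal_mult_less_top)
  finally show ?thesis using T_op_props(1)[OF RM_D(1)[OF f] gHD] by (simp add: RM_def)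
qed

text \<open>The estimate is the same on every invariant subspace of RM(p,q), so RM(p,q) and RM(p,0)
  differ only in the proof that they are mapped into themselves.\<close>

lemma bounded_op_if_bloch:
  assumes g: "g \<in> Bloch" and p: "1 \<le> p" and q: "1 \<le> q" and X: "X \<subseteq> RM p q" "T_op g ` X \<subseteq> X"
  shows "bounded_op X (rho_norm p q) (T_op g)"
proof -
  obtain C where C: "0 \<le> C" "\<And>z. z \<in> disc \<Longrightarrow> norm (deriv g z) \<le> C / (1 - norm z)"
    using bloch_bound[OF g] by blast
  have gHD: "g \<in> HD" using g by (simp add: Bloch_def)
  have "rho_norm p q (T_op g f) \<le> 2 * p * C * rho_norm p q f" if f: "f \<in> X" for f
  proof -
    have fR: "f \<in> RM p q" using f X by auto
    have "rho p q (T_op g f) \<le> ennreal (2 * p * C) * rho p q f"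
      by (rule rho_T_op_le[OF RM_D(1)[OF fR] gHD p q C])
    also have "\<dots> = ennreal (2 * p * C) * ennreal (rho_norm p q f)"
      by (simp only: ennreal_rho_norm[OF RM_D(2)[OF fR]])
    also have "\<dots> = ennreal (2 * p * C * rho_norm p q f)"
      using p C(1) by (intro ennreal_mult[symmetric]) (auto simp: rho_norm_def)
    finally show ?thesis unfolding rho_norm_def[of p q "T_op g f"]
      using p C(1) by (intro enn2real_leI) (auto simp: rho_norm_def)
  qed
  then show ?thesis unfolding bounded_op_def using X by blast
qed

text \<open>Fatou's lemma, once along the radius and once in the angle. Closed balls are thus stable
  under pointwise convergence on the disc, which keeps the limits from Montel's theorem in
  RM(p,q).\<close>

lemma rho_le_of_tendsto:
  assumes f: "\<And>n. f n \<in> HD" "\<And>n. rho p q (f n) \<le> c" and h: "h \<in> HD"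
    and lim: "\<And>z. z \<in> disc \<Longrightarrow> (\<lambda>n. f n z) \<longlonglongrightarrow> h z" and p: "1 \<le> p" and q: "1 \<le> q"
  shows "rho p q h \<le> c"
proof -
  have p0: "0 < p" using p by simp
  have "radial_norm p 0 h t \<le> liminf (\<lambda>n. radial_norm p 0 (f n) t)" for t
  proof -
    have "Lp (radial_measure 0) p (\<lambda>r. ennreal (norm (h (of_real r * cis t))))
        \<le> Lp (radial_measure 0) p (\<lambda>r. liminf (\<lambda>n. ennreal (norm (f n (of_real r * cis t)))))"
    proof (rule Lp_mono[OF p0])
      have "ennreal (norm (h (of_real r * cis t))) = liminf (\<lambda>n. ennreal (norm (f n (of_real r * cis t))))"
        if "0 \<le> r" "r < 1" for r
        using lim[OF ray_in_disc[OF that, of t]]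
        by (intro lim_imp_Liminf[symmetric] tendsto_ennrealI tendsto_norm) auto
      then show "AE r in radial_measure 0. ennreal (norm (h (of_real r * cis t))) \<le> liminf (\<lambda>n. ennreal (norm (f n (of_real r * cis t))))"
        unfolding radial_measure_def by (subst AE_density) (auto simp: indicator_def)
    qed
    also have "\<dots> \<le> liminf (\<lambda>n. Lp (radial_measure 0) p (\<lambda>r. ennreal (norm (f n (of_real r * cis t)))))"
      using ray_measurable[OF f(1)] by (intro Lp_liminf p0) (simp add: measurable_cong_sets[OF sets_radial_measure])
    finally show ?thesis by (simp add: radial_norm_eq_Lp[OF _ p0] h f)
  qed
  then have "angular_norm q (radial_norm p 0 h) \<le> angular_norm q (\<lambda>t. liminf (\<lambda>n. radial_norm p 0 (f n) t))"
    by (intro angular_norm_mono q radial_norm_measurable h)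
  also have "\<dots> \<le> c"
    using f by (intro angular_norm_liminf_le q radial_norm_measurable) (auto simp: rho_eq_angular_norm[OF p0 q, symmetric])
  finally show ?thesis by (simp add: rho_eq_angular_norm[OF p0 q h])
qed

section \<open>The space \<open>RM(p,0)\<close>\<close>

lemma AE_lborel_obtain_greaterThanLessThan:
  fixes x y :: real
  assumes "AE t in lborel. P t" "x < y"
  obtains t where "x < t" "t < y" "P t"
proof -
  have "\<exists>t\<in>{x<..<y}. P t"
  proof (rule ccontr)
    assume "\<not> (\<exists>t\<in>{x<..<y}. P t)"
    then have "AE t in lborel. t \<notin> {x<..<y}"
      using assms(1) by (auto elim!: eventually_mono)
    then have "emeasure lborel {x<..<y} = 0"
      by (subst (asm) AE_iff_measurable[where N="{x<..<y}"]) auto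
    then show False using assms(2) by simp
  qed
  then show ?thesis using that by auto
qed

text \<open>By Fatou's lemma the radial norm is lower semicontinuous in the angle, so its essential supremum is a supremum.\<close>

lemma radial_norm_le_rho_infinity:
  assumes f: "f \<in> HD" and p: "1 \<le> p"
  shows "radial_norm p 0 f t \<le> rho p \<infinity> f"
proof -
  have p0: "0 < p" using p by simp
  define E where "E = rho p \<infinity> f"
  let ?R = "restrict_space lborel {0..<2*pi}"
  have "AE t in ?R. radial_norm p 0 f t \<le> E"
    using esssup_AE[of "radial_norm p 0 f" ?R] rho_eq_angular_norm[OF p0 _ f, of \<infinity>] by (simp add: E_def angular_norm_def)
  then have ae: "AE t in lborel. t \<in> {0..<2*pi} \<longrightarrow> radial_norm p 0 f t \<le> E"
    by (subst (asm) AE_restrict_space_iff) auto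
  \<comment> \<open>The essential supremum only sees \<open>{0..<2*pi}\<close>, so the angle is
    first reduced modulo \<open>2 * pi\<close>.\<close>
  define \<theta> where "\<theta> = t - 2 * pi * of_int \<lfloor>t / (2 * pi)\<rfloor>"
  have \<theta>: "0 \<le> \<theta>" "\<theta> < 2 * pi"
  proof -
    have "of_int \<lfloor>t / (2 * pi)\<rfloor> \<le> t / (2 * pi)" "t / (2 * pi) < of_int \<lfloor>t / (2 * pi)\<rfloor> + 1"
      by linarith+
    then have "2 * pi * of_int \<lfloor>t / (2 * pi)\<rfloor> \<le> 2 * pi * (t / (2 * pi))"
      "2 * pi * (t / (2 * pi)) < 2 * pi * (of_int \<lfloor>t / (2 * pi)\<rfloor> + 1)"
      by (intro mult_left_mono mult_strict_left_mono; simp)+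
    then show "0 \<le> \<theta>" "\<theta> < 2 * pi" by (simp_all add: \<theta>_def algebra_simps)
  qed
  have "cis t = cis \<theta> * cis (2 * pi * of_int \<lfloor>t / (2 * pi)\<rfloor>)"
    unfolding cis_mult by (simp add: \<theta>_def)
  moreover have "cis (2 * pi * of_int \<lfloor>t / (2 * pi)\<rfloor>) = 1"
    by (intro cis_multiple_2pi) auto
  ultimately have cis: "cis t = cis \<theta>" by simp
  \<comment> \<open>The approach is from the right: since \<theta> is strictly below
    \<open>2 * pi\<close>, the angles remain in \<open>{0..<2*pi}\<close> even when \<theta> is
    0.\<close>
  have "\<exists>u. \<theta> < u \<and> u < min (2 * pi) (\<theta> + 1 / Suc n) \<and> radial_norm p 0 f u \<le> E" for n
  proof -
    have "\<theta> < min (2 * pi) (\<theta> + 1 / Suc n)" using \<theta> by simp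
    from AE_lborel_obtain_greaterThanLessThan[OF ae this] obtain u
      where "\<theta> < u" "u < min (2 * pi) (\<theta> + 1 / Suc n)" "u \<in> {0..<2*pi} \<longrightarrow> radial_norm p 0 f u \<le> E" .
    then show ?thesis using \<theta> by (intro exI[of _ u]) auto
  qed
  then obtain u where u: "\<And>n. \<theta> < u n" "\<And>n. u n < \<theta> + 1 / Suc n" "\<And>n. radial_norm p 0 f (u n) \<le> E"
    by (metis min_less_iff_conj)
  have "u \<longlonglongrightarrow> \<theta>"
  proof (rule tendsto_sandwich[of "\<lambda>_. \<theta>" u _ "\<lambda>n. \<theta> + 1 / Suc n"])
    show "(\<lambda>n. \<theta> + 1 / Suc n) \<longlonglongrightarrow> \<theta>"
      using tendsto_add[OF tendsto_const LIMSEQ_inverse_real_of_nat, of \<theta>] by (simp add: inverse_eq_divide)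
  qed (use u in \<open>auto intro!: always_eventually less_imp_le\<close>)
  have "ennreal (norm (f (of_real r * cis t))) = liminf (\<lambda>n. ennreal (norm (f (of_real r * cis (u n)))))"
    if r: "0 \<le> r" "r < 1" for r
  proof -
    have "isCont f (of_real r * cis \<theta>)"
      by (rule DERIV_isCont[OF HD_DERIV[OF f ray_in_disc[OF r]]])
    moreover have "(\<lambda>n. of_real r * cis (u n)) \<longlonglongrightarrow> of_real r * cis \<theta>"
      using \<open>u \<longlonglongrightarrow> \<theta>\<close> by (intro tendsto_intros)
    ultimately have "(\<lambda>n. f (of_real r * cis (u n))) \<longlonglongrightarrow> f (of_real r * cis t)"
      unfolding cis by (rule isCont_tendsto_compose)
    then show ?thesis
      by (intro lim_imp_Liminf[symmetric] tendsto_ennrealI tendsto_norm) auto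
  qed
  then have "AE r in radial_measure 0. ennreal (norm (f (of_real r * cis t))) \<le> liminf (\<lambda>n. ennreal (norm (f (of_real r * cis (u n)))))"
    unfolding radial_measure_def by (subst AE_density) (auto simp: indicator_def)
  then have "radial_norm p 0 f t \<le> Lp (radial_measure 0) p (\<lambda>r. liminf (\<lambda>n. ennreal (norm (f (of_real r * cis (u n))))))"
    unfolding radial_norm_eq_Lp[OF f p0] by (intro Lp_mono p0)
  also have "\<dots> \<le> liminf (\<lambda>n. radial_norm p 0 f (u n))"
    unfolding radial_norm_eq_Lp[OF f p0]
    using ray_measurable[OF f] by (intro Lp_liminf p0) (simp add: measurable_cong_sets[OF sets_radial_measure])
  also have "\<dots> \<le> E"
    using u(3) by (intro Liminf_le always_eventually) auto
  finally show ?thesis by (simp add: E_def)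
qed

text \<open>Shaped after \<open>radial_norm_le_of_deriv_le\<close>: \<open>B\<close> may depend on
  \<epsilon> but not on \<open>s\<close> or \<open>t\<close>, and its term dies out as
  \<open>s\<close> tends to 1, uniformly in the angle.\<close>

lemma RM0_I:
  assumes f: "f \<in> RM p \<infinity>" and p: "1 \<le> p"
    and le: "\<And>\<epsilon>. 0 < \<epsilon> \<Longrightarrow> \<exists>B\<ge>0. \<forall>s t. 0 \<le> s \<longrightarrow> s < 1 \<longrightarrow> radial_norm p s f t \<le> ennreal (B * (1 - s) powr (1 / p)) + ennreal \<epsilon>"
  shows "f \<in> RM0 p"
proof -
  have "((\<lambda>s. SUP t. radial_norm p s f t) \<longlongrightarrow> 0) (at_left 1)"
  proof (rule order_tendstoI)
    fix a :: ennreal assume "0 < a"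
    then obtain b where b: "0 < b" "b < a" using dense by blast
    then obtain c where "b = ennreal c" "0 \<le> c" by (cases b) auto
    with b have c: "0 < c" "ennreal c < a" by (auto simp: le_less)
    then obtain B where B: "0 \<le> B" "\<And>s t. 0 \<le> s \<Longrightarrow> s < 1 \<Longrightarrow> radial_norm p s f t \<le> ennreal (B * (1 - s) powr (1 / p)) + ennreal (c / 2)"
      using le[of "c / 2"] by auto
    have "((\<lambda>s. B * (1 - s) powr (1 / p)) \<longlongrightarrow> B * (1 - 1) powr (1 / p)) (at_left 1)"
      using p by (intro tendsto_intros tendsto_powr') (auto simp: eventually_at_filter)
    then have "eventually (\<lambda>s. B * (1 - s) powr (1 / p) < c / 2) (at_left 1)"
      using c by (intro order_tendstoD(2)) auto
    moreover have "eventually (\<lambda>s. 0 < s \<and> s < (1::real)) (at_left 1)"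
      unfolding eventually_at_left_field by (intro exI[of _ 0]) auto
    ultimately show "eventually (\<lambda>s. (SUP t. radial_norm p s f t) < a) (at_left 1)"
    proof eventually_elim
      case (elim s)
      have "radial_norm p s f t \<le> ennreal c" for t
      proof -
        have "radial_norm p s f t \<le> ennreal (B * (1 - s) powr (1 / p)) + ennreal (c / 2)"
          using elim by (intro B) auto
        also have "\<dots> = ennreal (B * (1 - s) powr (1 / p) + c / 2)"
          using B c by (simp add: ennreal_plus)
        also have "\<dots> \<le> ennreal c" using elim by (intro ennreal_leI) auto
        finally show ?thesis .
      qed
      then have "(SUP t. radial_norm p s f t) \<le> ennreal c" by (intro SUP_least)
      with c show ?case by simp
    qed
  qed simp
  then show ?thesis using f by (simp add: RM0_def radial_norm_def[abs_def])
qed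

lemma RM0_small:
  assumes f: "f \<in> RM0 p" and e: "0 < \<epsilon>"
  obtains s where "0 \<le> s" "s < 1" "\<And>t. radial_norm p s f t \<le> ennreal \<epsilon>"
proof -
  have "((\<lambda>s. SUP t. radial_norm p s f t) \<longlongrightarrow> 0) (at_left 1)"
    using f by (simp add: RM0_def radial_norm_def[abs_def])
  then have "eventually (\<lambda>s. (SUP t. radial_norm p s f t) < ennreal \<epsilon>) (at_left 1)"
    using e by (intro order_tendstoD(2)) auto
  moreover have "eventually (\<lambda>s. 0 < s \<and> s < (1::real)) (at_left 1)"
    unfolding eventually_at_left_field by (intro exI[of _ 0]) auto
  ultimately have "eventually (\<lambda>s. (SUP t. radial_norm p s f t) < ennreal \<epsilon> \<and> 0 < s \<and> s < 1) (at_left 1)"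
    by eventually_elim auto
  then obtain s where s: "(SUP t. radial_norm p s f t) < ennreal \<epsilon>" "0 < s" "s < 1"
    using eventually_happens'[of "at_left (1::real)"] by (auto simp: trivial_limit_at_left_real)
  have "radial_norm p s f t \<le> ennreal \<epsilon>" for t
    using SUP_upper[of t UNIV "\<lambda>t. radial_norm p s f t"] s(1) by (meson UNIV_I less_imp_le order_trans)
  then show ?thesis using s by (intro that[of s]) auto
qed

text \<open>The radius \<sigma> is chosen so that the tail of \<open>f\<close> beyond it is
  uniformly small. Below \<sigma> the derivative of the image is bounded, and beyond \<sigma> only
  the tail of \<open>f\<close> enters the Hardy term.\<close>

lemma T_op_RM0_of_bloch:
  assumes f: "f \<in> RM0 p" and g: "g \<in> Bloch" and p: "1 \<le> p"
  shows "T_op g f \<in> RM0 p"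
proof (rule RM0_I[OF _ p])
  have fR: "f \<in> RM p \<infinity>" using f RM0_subset_RM by auto
  have fH: "f \<in> HD" using RM_D(1)[OF fR] .
  have gH: "g \<in> HD" using g by (simp add: Bloch_def)
  note T = T_op_props[OF fH gH]
  have p0: "0 < p" using p by simp
  show "T_op g f \<in> RM p \<infinity>" by (rule T_op_RM[OF fR g p]) simp
  obtain C where C: "0 \<le> C" "\<And>z. z \<in> disc \<Longrightarrow> norm (deriv g z) \<le> C / (1 - norm z)"
    using bloch_bound[OF g] by blast
  fix \<epsilon> :: real assume e: "0 < \<epsilon>"
  \<comment> \<open>The \<open>+ 1\<close> keeps the quotient meaningful for
    \<open>C = 0\<close>.\<close>
  have "0 < \<epsilon> / (2 * p * C + 1)" using e C p by (intro divide_pos_pos) (auto intro: add_nonneg_pos)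
  then obtain \<sigma> where \<sigma>: "0 \<le> \<sigma>" "\<sigma> < 1" "\<And>t. radial_norm p \<sigma> f t \<le> ennreal (\<epsilon> / (2 * p * C + 1))"
    using RM0_small[OF f] by blast
  obtain B where B: "0 \<le> B" "\<And>z. norm z \<le> \<sigma> \<Longrightarrow> norm (disc_deriv (T_op g f) z) \<le> B"
    using HD_bound_cball[OF disc_deriv_HD[OF T(1)] \<sigma>(2)] by blast
  have "radial_norm p s (T_op g f) t \<le> ennreal (B * (1 - s) powr (1 / p)) + ennreal \<epsilon>" if s: "0 \<le> s" "s < 1" for s t
  proof -
    let ?u = "\<lambda>r. ennreal (norm (f (of_real r * cis t))) * indicator {\<sigma>..} r"
    note [measurable] = ray_measurable[OF fH]
    have "radial_norm p s (T_op g f) t \<le> ennreal (B * (1 - s) powr (1 / p)) + ennreal (2 * p * C) * Lp (radial_measure 0) p ?u"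
    proof (rule radial_norm_le_of_deriv_le[OF T(1,2) p B(1) C(1) _ _ s])
      show "?u \<in> borel_measurable borel" by measurable
      fix r :: real assume r: "0 \<le> r" "r < 1"
      let ?z = "of_real r * cis t"
      have z: "?z \<in> disc" "norm ?z = r" using ray_in_disc[OF r] r by (auto simp: norm_mult)
      show "ennreal (norm (deriv (T_op g f) ?z)) \<le> ennreal B + ennreal C * (?u r * ennreal (1 / (1 - r)))"
      proof (cases "r < \<sigma>")
        case True
        then have "norm (deriv (T_op g f) ?z) \<le> B"
          using B(2)[of ?z] z by (simp add: disc_deriv_def)
        then show ?thesis by (rule order_trans[OF ennreal_leI]) simp
      next
        case False
        have "norm (f ?z) * norm (deriv g ?z) \<le> norm (f ?z) * (C / (1 - r))"
          using C(2)[OF z(1)] z(2) by (intro mult_left_mono) auto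
        then have "ennreal (norm (deriv (T_op g f) ?z)) \<le> ennreal (C * (norm (f ?z) * (1 / (1 - r))))"
          unfolding T(3)[OF z(1)] norm_mult by (intro ennreal_leI) (simp add: ac_simps)
        also have "\<dots> = ennreal C * (ennreal (norm (f ?z)) * ennreal (1 / (1 - r)))"
          using C r by (simp add: ennreal_mult del: times_divide_eq_right)
        finally show ?thesis using False by (simp add: add_increasing)
      qed
    qed
    also have "Lp (radial_measure 0) p ?u \<le> radial_norm p \<sigma> f t"
      unfolding radial_norm_eq_Lp[OF fH p0] Lp_def using p \<sigma>
      by (intro ennpow_mono) (auto simp: nn_integral_radial_measure indicator_def intro!: nn_integral_mono)
    also have "radial_norm p \<sigma> f t \<le> ennreal (\<epsilon> / (2 * p * C + 1))" by (rule \<sigma>(3))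
    also have "ennreal (2 * p * C) * ennreal (\<epsilon> / (2 * p * C + 1)) = ennreal (2 * p * C * (\<epsilon> / (2 * p * C + 1)))"
      using p C e by (intro ennreal_mult[symmetric]) (auto intro!: divide_nonneg_nonneg)
    also have "ennreal (2 * p * C * (\<epsilon> / (2 * p * C + 1))) \<le> ennreal \<epsilon>"
    proof (rule ennreal_leI)
      have "0 \<le> 2 * p * C" using p C by simp
      then show "2 * p * C * (\<epsilon> / (2 * p * C + 1)) \<le> \<epsilon>" using e by (simp add: field_simps)
    qed
    finally show ?thesis by this (auto intro: add_left_mono mult_left_mono)
  qed
  then show "\<exists>B\<ge>0. \<forall>s t. 0 \<le> s \<longrightarrow> s < 1 \<longrightarrow> radial_norm p s (T_op g f) t \<le> ennreal (B * (1 - s) powr (1 / p)) + ennreal \<epsilon>"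
    using B(1) by blast
qed

text \<open>About \<open>F\<close> only \<open>F 0 = 0\<close> and the formula for its derivative
  enter, so the estimate applies to an image \<open>T_op g f\<close> and equally to a difference of
  two images.\<close>

lemma radial_norm_le_of_little_bloch:
  assumes h: "h \<in> HD" and F: "F \<in> HD" "F 0 = 0" and p: "1 \<le> p" and B: "0 \<le> B" and C: "0 \<le> C"
    and deriv: "\<And>z. z \<in> disc \<Longrightarrow> deriv F z = h z * deriv g z"
    and R: "\<And>z. R \<le> norm z \<Longrightarrow> norm z < 1 \<Longrightarrow> norm (deriv g z) \<le> C / (1 - norm z)"
    and le: "\<And>z. norm z \<le> R \<Longrightarrow> norm z < 1 \<Longrightarrow> norm (h z * deriv g z) \<le> B"
    and s: "0 \<le> s" "s < 1"
  shows "radial_norm p s F t \<le> ennreal (B * (1 - s) powr (1 / p)) + ennreal (2 * p * C) * radial_norm p 0 h t"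
proof -
  have p0: "0 < p" using p by simp
  let ?u = "\<lambda>r. ennreal (norm (h (of_real r * cis t)))"
  show ?thesis
    unfolding radial_norm_eq_Lp[OF h p0]
  proof (rule radial_norm_le_of_deriv_le[OF F p B C ray_measurable[OF h] _ s])
    fix r :: real assume r: "0 \<le> r" "r < 1"
    let ?z = "of_real r * cis t"
    have z: "?z \<in> disc" "norm ?z = r" using ray_in_disc[OF r] r by (auto simp: norm_mult)
    show "ennreal (norm (deriv F ?z)) \<le> ennreal B + ennreal C * (?u r * ennreal (1 / (1 - r)))"
    proof (cases "r \<le> R")
      case True
      then have "norm (deriv F ?z) \<le> B"
        unfolding deriv[OF z(1)] using z r by (intro le) auto
      then show ?thesis by (rule order_trans[OF ennreal_leI]) simp
    next
      case False
      have "norm (h ?z) * norm (deriv g ?z) \<le> norm (h ?z) * (C / (1 - r))"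
        using R[of ?z] z(2) False r by (intro mult_left_mono) auto
      then have "ennreal (norm (deriv F ?z)) \<le> ennreal (C * (norm (h ?z) * (1 / (1 - r))))"
        unfolding deriv[OF z(1)] norm_mult by (intro ennreal_leI) (simp add: ac_simps)
      also have "\<dots> = ennreal C * (ennreal (norm (h ?z)) * ennreal (1 / (1 - r)))"
        using C r by (simp add: ennreal_mult del: times_divide_eq_right)
      finally show ?thesis by (simp add: add_increasing)
    qed
  qed
qed

text \<open>No decay of \<open>f\<close> is assumed: the small constant near the circle replaces it.
  The compactness proof needs this for limits that are only known to lie in RM(p,\<infinity>). Since
  \<open>RM0\<close> is defined with a true supremum, the norm of \<open>f\<close> has to be used as
  a bound at every angle, as \<open>radial_norm_le_rho_infinity\<close> permits.\<close>

lemma T_op_RM0_of_little_bloch: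
  assumes f: "f \<in> RM p \<infinity>" and g: "g \<in> little_Bloch" and p: "1 \<le> p"
  shows "T_op g f \<in> RM0 p"
proof (rule RM0_I[OF _ p])
  have gB: "g \<in> Bloch" using g by (simp add: little_Bloch_def)
  have gH: "g \<in> HD" using gB by (simp add: Bloch_def)
  have fH: "f \<in> HD" using RM_D(1)[OF f] .
  note T = T_op_props[OF fH gH]
  show "T_op g f \<in> RM p \<infinity>" by (rule T_op_RM[OF f gB p]) simp
  fix \<epsilon> :: real assume e: "0 < \<epsilon>"
  define N where "N = rho_norm p \<infinity> f"
  have N: "0 \<le> N" "rho p \<infinity> f = ennreal N"
    using ennreal_rho_norm[OF RM_D(2)[OF f]] by (auto simp: N_def rho_norm_def)
  \<comment> \<open>\<open>N + 1\<close> instead of \<open>N\<close> allows for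
    \<open>f = 0\<close>; in any case \<open>2 * p * C * N \<le> \<epsilon>\<close>.\<close>
  define C where "C = \<epsilon> / (2 * p * (N + 1))"
  have C: "0 < C" using e p N by (simp add: C_def)
  obtain R where R: "0 \<le> R" "R < 1" "\<And>z. R \<le> norm z \<Longrightarrow> norm z < 1 \<Longrightarrow> norm (deriv g z) \<le> C / (1 - norm z)"
    using little_bloch_bound[OF g C] by blast
  obtain B where B: "0 \<le> B" "\<And>z. norm z \<le> R \<Longrightarrow> norm (disc_deriv (T_op g f) z) \<le> B"
    using HD_bound_cball[OF disc_deriv_HD[OF T(1)] R(2)] by blast
  have "radial_norm p s (T_op g f) t \<le> ennreal (B * (1 - s) powr (1 / p)) + ennreal \<epsilon>" if s: "0 \<le> s" "s < 1" for s t
  proof -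
    have "radial_norm p s (T_op g f) t \<le> ennreal (B * (1 - s) powr (1 / p)) + ennreal (2 * p * C) * radial_norm p 0 f t"
    proof (rule radial_norm_le_of_little_bloch[OF fH T(1,2) p B(1) _ T(3) R(3) _ s])
      show "norm (f z * deriv g z) \<le> B" if "norm z \<le> R" "norm z < 1" for z
        using B(2)[of z] T(3)[of z] that by (simp add: disc_deriv_def)
    qed (use C in auto)
    also have "radial_norm p 0 f t \<le> ennreal N"
      using radial_norm_le_rho_infinity[OF fH p] N(2) by simp
    also have "ennreal (2 * p * C) * ennreal N = ennreal (2 * p * C * N)"
      using p C N by (intro ennreal_mult[symmetric]) auto
    also have "ennreal (2 * p * C * N) \<le> ennreal \<epsilon>"
    proof (rule ennreal_leI)
      have "2 * p * C * N = \<epsilon> * (N / (N + 1))" using p by (simp add: C_def)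
      also have "\<dots> \<le> \<epsilon> * 1" using e N by (intro mult_left_mono) auto
      finally show "2 * p * C * N \<le> \<epsilon>" by simp
    qed
    finally show ?thesis by this (auto intro: add_left_mono mult_left_mono)
  qed
  then show "\<exists>B\<ge>0. \<forall>s t. 0 \<le> s \<longrightarrow> s < 1 \<longrightarrow> radial_norm p s (T_op g f) t \<le> ennreal (B * (1 - s) powr (1 / p)) + ennreal \<epsilon>"
    using B(1) by blast
qed

section \<open>Test functions as elements of RM(p,q) and RM(p,0)\<close>

lemma test_fun_RM:
  assumes a: "norm a < 1" and p: "1 \<le> p" and q: "1 \<le> q" and e: "e = 1 / p + 1 / enn2real q"
  shows "test_fun e a \<in> RM p q" "rho_norm p q (test_fun e a) \<le> 1"
  using rho_test_fun_le_1[OF assms] test_fun_HD[OF a]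
  by (auto simp: RM_def rho_norm_def intro!: enn2real_leI elim: order.strict_trans1)

text \<open>The first bound serves for fixed \<open>z\<close> and \<open>norm a\<close> tending to
  1; the second, for fixed \<open>a\<close>, shows that the test function is bounded on the
  disc.\<close>

lemma norm_test_fun_le:
  assumes a: "norm a < 1" and z: "norm z < 1"
  shows "norm (test_fun e a z) \<le> (1 - norm a) powr (3 - e) / (1 - norm z) ^ 3"
    and "norm (test_fun e a z) \<le> (1 - norm a) powr (3 - e) / (1 - norm a) ^ 3"
proof -
  have *: "norm (test_fun e a z) \<le> (1 - norm a) powr (3 - e) / m ^ 3" if m: "0 < m" "m \<le> norm (1 - cnj a * z)" for m
  proof -
    have "m ^ 3 \<le> norm (1 - cnj a * z) ^ 3" using m by (intro power_mono) auto
    also have "\<dots> \<le> 27 * norm (1 - cnj a * z) ^ 3" by simp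
    finally have "(1 - norm a) powr (3 - e) / (27 * norm (1 - cnj a * z) ^ 3) \<le> (1 - norm a) powr (3 - e) / m ^ 3"
      using m by (intro divide_left_mono mult_pos_pos zero_less_power) auto
    then show ?thesis using z by (simp add: test_fun_def norm_divide norm_power)
  qed
  show "norm (test_fun e a z) \<le> (1 - norm a) powr (3 - e) / (1 - norm z) ^ 3"
    using z norm_one_minus_cnj_ge(1)[OF a, of z] by (intro *) auto
  show "norm (test_fun e a z) \<le> (1 - norm a) powr (3 - e) / (1 - norm a) ^ 3"
    using z a norm_one_minus_cnj_ge(2)[OF a, of z] by (intro *) auto
qed

text \<open>Boundedness on the disc suffices, because it makes the radial tails at most
  \<open>B * (1 - s) powr (1 / p)\<close>.\<close>

lemma test_fun_RM0:
  assumes a: "norm a < 1" and p: "1 \<le> p"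
  shows "test_fun (1 / p) a \<in> RM0 p"
proof (rule RM0_I[OF _ p])
  show "test_fun (1 / p) a \<in> RM p \<infinity>" by (rule test_fun_RM(1)[OF a p]) auto
  fix \<epsilon> :: real assume "0 < \<epsilon>"
  define B where "B = (1 - norm a) powr (3 - 1 / p) / (1 - norm a) ^ 3"
  have B: "0 \<le> B" using a by (simp add: B_def)
  have p0: "0 < p" using p by simp
  have "radial_norm p s (test_fun (1 / p) a) t \<le> ennreal (B * (1 - s) powr (1 / p)) + ennreal \<epsilon>" if s: "0 \<le> s" "s < 1" for s t
  proof -
    have "norm (test_fun (1 / p) a (of_real r * cis t)) \<le> B" if "0 \<le> r" "r < 1" for r
      unfolding B_def using that by (intro norm_test_fun_le a) (simp add: norm_mult)
    then have "AE r in radial_measure s. ennreal (norm (test_fun (1 / p) a (of_real r * cis t))) \<le> ennreal B"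
      unfolding radial_measure_def using s by (subst AE_density) (auto simp: indicator_def intro!: ennreal_leI)
    then have "radial_norm p s (test_fun (1 / p) a) t \<le> Lp (radial_measure s) p (\<lambda>r. ennreal B)"
      unfolding radial_norm_eq_Lp[OF test_fun_HD[OF a] p0] by (rule Lp_mono[OF p0])
    also have "\<dots> = ennreal (B * (1 - s) powr (1 / p))"
      using p B s by (simp add: Lp_const emeasure_radial_measure ennpow_ennreal ennreal_mult)
    finally show ?thesis by (rule order_trans) simp
  qed
  then show "\<exists>B\<ge>0. \<forall>s t. 0 \<le> s \<longrightarrow> s < 1 \<longrightarrow> radial_norm p s (test_fun (1 / p) a) t \<le> ennreal (B * (1 - s) powr (1 / p)) + ennreal \<epsilon>"
    using B by blast
qed

section \<open>Compactness\<close>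

text \<open>The evaluation bound supplies the locally uniform bounds for Montel's theorem, and
  Fatou's lemma keeps the norm of the limit at most 1.\<close>

lemma montel_RM:
  assumes f: "\<And>n. f n \<in> HD" "\<And>n. rho p q (f n) \<le> 1" and p: "1 \<le> p" and q: "1 \<le> q"
  obtains h r where "h \<in> HD" "rho p q h \<le> 1" "strict_mono (r :: nat \<Rightarrow> nat)"
    "\<And>K. compact K \<Longrightarrow> K \<subseteq> disc \<Longrightarrow> uniform_limit K (\<lambda>n. f (r n)) h sequentially"
proof -
  define w where "w = (\<lambda>z::complex. 64 * (1 - norm z) powr (- (1 + 1 / p + 1 / enn2real q)))"
  have fw: "norm (f n z) \<le> w z" if "norm z < 1" for n z
  proof -
    have "ennreal (norm (f n z)) \<le> ennreal (w z) * rho p q (f n)"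
      unfolding w_def by (rule norm_le_rho[OF f(1) that p q])
    also have "\<dots> \<le> ennreal (w z) * 1" by (intro mult_left_mono f) simp
    finally show ?thesis by (simp add: w_def)
  qed
  have bdd: "\<exists>B. \<forall>h\<in>range f. \<forall>z\<in>K. norm (h z) \<le> B" if K: "compact K" "K \<subseteq> disc" for K
  proof -
    have "continuous_on K w"
      unfolding w_def using K(2) by (intro continuous_intros) auto
    then have "bounded (w ` K)" by (intro compact_imp_bounded compact_continuous_image K)
    then obtain B where B: "\<forall>y\<in>w ` K. norm y \<le> B" unfolding bounded_iff by blast
    have "norm (f n z) \<le> B" if "z \<in> K" for n z
    proof -
      have "norm (f n z) \<le> w z" using that K(2) by (intro fw) auto
      also have "\<dots> \<le> B" using B that by force
      finally show ?thesis .
    qed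
    then show ?thesis by blast
  qed
  have hol: "h holomorphic_on disc" if "h \<in> range f" for h
    using that f(1) by (auto simp: HD_def)
  obtain h0 r where h0: "h0 holomorphic_on disc" "strict_mono (r :: nat \<Rightarrow> nat)"
      "\<And>x. x \<in> disc \<Longrightarrow> ((\<lambda>n. f (r n) x) \<longlonglongrightarrow> h0 x)"
      "\<And>K. \<lbrakk>compact K; K \<subseteq> disc\<rbrakk> \<Longrightarrow> uniform_limit K (f \<circ> r) h0 sequentially"
    using Montel[OF open_ball hol bdd order_refl] by blast
  \<comment> \<open>The limit is determined on the disc only and has to be extended by 0
    again.\<close>
  define h where "h = (\<lambda>z. if z \<in> disc then h0 z else 0)"
  have h: "h \<in> HD" unfolding h_def by (rule HD_I[OF h0(1)])
  have "rho p q h \<le> 1"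
  proof (rule rho_le_of_tendsto[OF _ _ h _ p q])
    show "(\<lambda>n. f (r n) z) \<longlonglongrightarrow> h z" if "z \<in> disc" for z
      unfolding h_def using h0(3)[OF that] that by (simp only: if_True)
  qed (use f in auto)
  moreover have "uniform_limit K (\<lambda>n. f (r n)) h sequentially" if K: "compact K" "K \<subseteq> disc" for K
  proof -
    have "uniform_limit K (f \<circ> r) h sequentially \<longleftrightarrow> uniform_limit K (f \<circ> r) h0 sequentially"
      using K(2) by (intro uniform_limit_cong') (auto simp: h_def)
    then show ?thesis using h0(4)[OF K] by (simp add: o_def)
  qed
  ultimately show ?thesis using h h0(2) that by blast
qed

text \<open>Here \<open>T_op g\<close> upgrades locally uniform convergence to convergence in norm.
  On the disc of radius \<open>R\<close> the differences are uniformly small, and near the circle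
  the small constant \<open>C\<close> multiplies a norm that is merely bounded.\<close>

lemma T_op_convergent:
  assumes f: "\<And>n. f n \<in> HD" "\<And>n. rho p q (f n) \<le> 1" and h: "h \<in> HD" "rho p q h \<le> 1"
    and lim: "\<And>K. compact K \<Longrightarrow> K \<subseteq> disc \<Longrightarrow> uniform_limit K f h sequentially"
    and g: "g \<in> little_Bloch" and p: "1 \<le> p" and q: "1 \<le> q" and e: "0 < \<epsilon>"
  shows "eventually (\<lambda>n. rho p q (\<lambda>z. T_op g (f n) z - T_op g h z) \<le> ennreal \<epsilon>) sequentially"
proof -
  have p0: "0 < p" using p by simp
  have gH: "g \<in> HD" using g by (simp add: little_Bloch_def Bloch_def)
  \<comment> \<open>The difference of \<open>f n\<close> and \<open>h\<close> has norm at most 2, so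
    the outer part costs \<open>2 * p * C * 2 = \<epsilon> / 2\<close>.\<close>
  define C where "C = \<epsilon> / (8 * p)"
  have C: "0 < C" using e p by (simp add: C_def)
  obtain R where R: "0 \<le> R" "R < 1" "\<And>z. R \<le> norm z \<Longrightarrow> norm z < 1 \<Longrightarrow> norm (deriv g z) \<le> C / (1 - norm z)"
    using little_bloch_bound[OF g C] by blast
  obtain A where A: "0 \<le> A" "\<And>z. norm z \<le> R \<Longrightarrow> norm (disc_deriv g z) \<le> A"
    using HD_bound_cball[OF disc_deriv_HD[OF gH] R(2)] by blast
  have "uniform_limit (cball 0 R) f h sequentially"
    using R by (intro lim) auto
  moreover have "0 < \<epsilon> / (2 * (A + 1))" using e A by simp
  ultimately have "eventually (\<lambda>n. \<forall>z\<in>cball 0 R. dist (f n z) (h z) < \<epsilon> / (2 * (A + 1))) sequentially"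
    by (rule uniform_limitD)
  then show ?thesis
  proof eventually_elim
    case (elim n)
    let ?k = "\<lambda>z. f n z - h z" and ?F = "\<lambda>z. T_op g (f n) z - T_op g h z"
    note T1 = T_op_props[OF f(1)[of n] gH] and T2 = T_op_props[OF h(1) gH]
    have k: "?k \<in> HD" by (intro HD_diff f h)
    have F: "?F \<in> HD" by (intro HD_diff T1 T2)
    have dF: "deriv ?F z = ?k z * deriv g z" if "z \<in> disc" for z
      using DERIV_imp_deriv[OF DERIV_diff[OF HD_DERIV[OF T1(1) that] HD_DERIV[OF T2(1) that]]] T1(3)[OF that] T2(3)[OF that]
      by (simp add: algebra_simps)
    have "rho p q ?F = angular_norm q (radial_norm p 0 ?F)" by (rule rho_eq_angular_norm[OF p0 q F])
    also have "\<dots> \<le> angular_norm q (\<lambda>t. ennreal (\<epsilon> / 2) + ennreal (2 * p * C) * radial_norm p 0 ?k t)"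
    proof (intro angular_norm_mono q radial_norm_measurable F)
      fix t
      have "radial_norm p 0 ?F t \<le> ennreal (\<epsilon> / 2 * (1 - 0) powr (1 / p)) + ennreal (2 * p * C) * radial_norm p 0 ?k t"
      proof (rule radial_norm_le_of_little_bloch[OF k F _ p _ _ dF R(3)])
        show "norm (?k z * deriv g z) \<le> \<epsilon> / 2" if "norm z \<le> R" "norm z < 1" for z
        proof -
          have "norm (?k z) \<le> \<epsilon> / (2 * (A + 1))" using elim that by (auto simp: dist_norm less_imp_le)
          moreover have "norm (deriv g z) \<le> A + 1" using A(2)[of z] that by (simp add: disc_deriv_def)
          ultimately have "norm (?k z) * norm (deriv g z) \<le> \<epsilon> / (2 * (A + 1)) * (A + 1)"
            using e A by (intro mult_mono) auto
          also have "\<dots> = \<epsilon> / 2" using A by (simp add: field_simps)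
          finally show ?thesis by (simp add: norm_mult)
        qed
      qed (use e C T1(2) T2(2) in auto)
      then show "radial_norm p 0 ?F t \<le> ennreal (\<epsilon> / 2) + ennreal (2 * p * C) * radial_norm p 0 ?k t" by simp
    qed
    also have "\<dots> \<le> angular_norm q (\<lambda>t. ennreal (\<epsilon> / 2)) + angular_norm q (\<lambda>t. ennreal (2 * p * C) * radial_norm p 0 ?k t)"
      using radial_norm_measurable[OF k, of p 0] by (intro angular_norm_triangle q) auto
    also have "\<dots> \<le> ennreal (\<epsilon> / 2) + ennreal (2 * p * C) * 2"
    proof (rule add_mono)
      show "angular_norm q (\<lambda>t. ennreal (\<epsilon> / 2)) \<le> ennreal (\<epsilon> / 2)" by (simp add: angular_norm_const[OF q])
      have "angular_norm q (\<lambda>t. ennreal (2 * p * C) * radial_norm p 0 ?k t) \<le> ennreal (2 * p * C) * rho p q ?k"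
        unfolding rho_eq_angular_norm[OF p0 q k] by (intro angular_norm_cmult_le q radial_norm_measurable k)
      also have "\<dots> \<le> ennreal (2 * p * C) * 2"
      proof (rule mult_left_mono)
        have "rho p q ?k \<le> rho p q (f n) + rho p q h" by (intro rho_diff_le f h p q)
        also have "\<dots> \<le> 1 + 1" by (intro add_mono f h)
        finally show "rho p q ?k \<le> 2" by simp
      qed simp
      finally show "angular_norm q (\<lambda>t. ennreal (2 * p * C) * radial_norm p 0 ?k t) \<le> ennreal (2 * p * C) * 2" .
    qed
    also have "\<dots> = ennreal (\<epsilon> / 2) + ennreal (2 * p * C * 2)"
      using C p by (subst ennreal_mult) auto
    also have "\<dots> = ennreal (\<epsilon> / 2 + 2 * p * C * 2)"
      using C p e by (intro ennreal_plus[symmetric]) auto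
    also have "\<epsilon> / 2 + 2 * p * C * 2 = \<epsilon>" using p by (simp add: C_def)
    finally show ?case .
  qed
qed

text \<open>By the Bolzano-Weierstrass criterion an infinite set of images has to accumulate in
  \<open>X\<close>. The hypothesis \<open>T\<close> concerns all of RM(p,q) because the limit
  \<open>h\<close> of the preimages may leave \<open>X\<close>, while its image may not.\<close>

lemma compact_op_if_little_bloch:
  assumes g: "g \<in> little_Bloch" and p: "1 \<le> p" and q: "1 \<le> q"
    and X: "X \<subseteq> RM p q" and T: "\<And>f. f \<in> RM p q \<Longrightarrow> T_op g f \<in> X"
  shows "compact_op X (rho_norm p q) (T_op g)"
proof -
  interpret R: Metric_space "RM p q" "\<lambda>f h. rho_norm p q (\<lambda>z. f z - h z)"
    by (rule Metric_space_RM[OF p q])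
  interpret M: Metric_space X "\<lambda>f h. rho_norm p q (\<lambda>z. f z - h z)"
    by (rule R.subspace[OF X])
  let ?S = "T_op g ` {f \<in> X. rho_norm p q f \<le> 1}"
  have "M.mtopology derived_set_of Y \<noteq> {}" if Y: "infinite Y" "Y \<subseteq> ?S" "Y \<subseteq> X" for Y
  proof -
    obtain y :: "nat \<Rightarrow> complex \<Rightarrow> complex" where y: "inj y" "range y \<subseteq> Y"
      using infinite_countable_subset[OF Y(1)] by blast
    have "\<exists>f. f \<in> X \<and> rho_norm p q f \<le> 1 \<and> y n = T_op g f" for n
      using y(2) Y(2) by blast
    then obtain f where f: "\<And>n. f n \<in> X" "\<And>n. rho_norm p q (f n) \<le> 1" "\<And>n. y n = T_op g (f n)"
      by metis
    have fR: "f n \<in> RM p q" for n using f(1) X by blast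
    have fH: "f n \<in> HD" for n by (rule RM_D(1)[OF fR])
    have f1: "rho p q (f n) \<le> 1" for n
      using f(2)[of n] ennreal_leI[of "rho_norm p q (f n)" 1] ennreal_rho_norm[OF RM_D(2)[OF fR[of n]]] by simp
    obtain h r where h: "h \<in> HD" "rho p q h \<le> 1" "strict_mono (r :: nat \<Rightarrow> nat)"
      "\<And>K. compact K \<Longrightarrow> K \<subseteq> disc \<Longrightarrow> uniform_limit K (\<lambda>n. f (r n)) h sequentially"
      using montel_RM[of f, OF fH f1 p q] by blast
    have "rho p q h < \<infinity>" using h(2) by (rule order.strict_trans1) simp
    then have hR: "h \<in> RM p q" using h(1) by (simp add: RM_def)
    have lim: "limitin M.mtopology (y \<circ> r) (T_op g h) sequentially"
      unfolding M.limit_metric_sequentially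
    proof (intro conjI allI impI)
      show "T_op g h \<in> X" by (rule T[OF hR])
      fix \<epsilon> :: real assume e: "0 < \<epsilon>"
      have "eventually (\<lambda>n. rho p q (\<lambda>z. T_op g (f (r n)) z - T_op g h z) \<le> ennreal (\<epsilon> / 2)) sequentially"
        using e by (intro T_op_convergent[OF fH f1 h(1,2) h(4) g p q]) auto
      then obtain N where N: "\<And>n. n \<ge> N \<Longrightarrow> rho p q (\<lambda>z. T_op g (f (r n)) z - T_op g h z) \<le> ennreal (\<epsilon> / 2)"
        unfolding eventually_sequentially by blast
      have "(y \<circ> r) n \<in> X \<and> rho_norm p q (\<lambda>z. (y \<circ> r) n z - T_op g h z) < \<epsilon>" if "n \<ge> N" for n
      proof -
        have "rho_norm p q (\<lambda>z. T_op g (f (r n)) z - T_op g h z) \<le> \<epsilon> / 2"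
          unfolding rho_norm_def using e by (intro enn2real_leI N that) auto
        then show ?thesis using e T[OF fR] by (simp add: f(3))
      qed
      then show "\<exists>N. \<forall>n\<ge>N. (y \<circ> r) n \<in> X \<and> rho_norm p q (\<lambda>z. (y \<circ> r) n z - T_op g h z) < \<epsilon>" by blast
    qed
    \<comment> \<open>Injectivity makes each tail of the sequence infinite as a set, so every
      neighbourhood of the limit meets \<open>Y\<close> in infinitely many points.\<close>
    have inj: "inj (y \<circ> r)"
      using y(1) h(3) by (simp add: inj_compose strict_mono_imp_inj_on)
    have "infinite (Y \<inter> U)" if U: "T_op g h \<in> U" "openin M.mtopology U" for U
    proof -
      obtain N where N: "\<And>n. n \<ge> N \<Longrightarrow> (y \<circ> r) n \<in> U"
        using lim U unfolding limitin_def eventually_sequentially by blast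
      have "(y \<circ> r) ` {N..} \<subseteq> Y \<inter> U" using N y(2) by auto
      moreover have "infinite ((y \<circ> r) ` {N..})"
        using finite_imageD[OF _ inj_on_subset[OF inj subset_UNIV]] infinite_Ici by blast
      ultimately show ?thesis by (rule infinite_super)
    qed
    then have "T_op g h \<in> M.mtopology derived_set_of Y"
      using T[OF hR] unfolding M.derived_set_of_infinite_openin_metric by blast
    then show ?thesis by blast
  qed
  then have "compactin M.mtopology (M.mtopology closure_of ?S)"
    unfolding M.compact_closure_of_eq_Bolzano_Weierstrass by blast
  then show ?thesis
    unfolding compact_op_def norm_topology_def using T X by blast
qed

section \<open>Necessity of the Bloch conditions\<close>

lemma T_op_norm_le:
  assumes f: "f \<in> HD" and g: "g \<in> HD" and z: "norm z < 1" and B: "\<And>w::complex. norm w \<le> norm z \<Longrightarrow> norm (f w * deriv g w) \<le> B"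
  shows "norm (T_op g f z) \<le> B * norm z"
proof -
  note T = T_op_props[OF f g]
  have "norm (T_op g f z - T_op g f 0) \<le> B * norm (z - 0)"
  proof (rule field_differentiable_bound[of "cball 0 (norm z)" _ "\<lambda>w. f w * deriv g w"])
    fix w :: complex assume w: "w \<in> cball 0 (norm z)"
    then have wd: "w \<in> disc" using z by auto
    show "(T_op g f has_field_derivative f w * deriv g w) (at w within cball 0 (norm z))"
      using HD_DERIV[OF T(1) wd] unfolding T(3)[OF wd] by (rule has_field_derivative_at_within)
    show "norm (f w * deriv g w) \<le> B" using B[of w] w by simp
  qed auto
  then show ?thesis using T(2) by simp
qed

text \<open>The constant is \<open>2 * 13824\<close>, from
  \<open>1 - (norm a)\<^sup>2 \<le> 2 * (1 - norm a)\<close>.\<close>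

lemma bloch_le_rho_norm:
  assumes g: "g \<in> HD" and p: "1 \<le> p" and q: "1 \<le> q" and e: "e = 1 / p + 1 / enn2real q"
    and a: "norm a < 1" and T: "T_op g (test_fun e a) \<in> RM p q"
  shows "(1 - (norm a)\<^sup>2) * norm (deriv g a) \<le> 27648 * rho_norm p q (T_op g (test_fun e a))"
proof -
  have "ennreal ((1 - norm a) * norm (deriv g a)) \<le> 13824 * rho p q (T_op g (test_fun e a))"
    by (rule bloch_le_rho_T_op_test_fun[OF g a p q e])
  also have "\<dots> = ennreal (13824 * rho_norm p q (T_op g (test_fun e a)))"
    unfolding ennreal_rho_norm[OF RM_D(2)[OF T], symmetric]
    by (subst ennreal_mult) (auto simp: rho_norm_def)
  finally have 1: "(1 - norm a) * norm (deriv g a) \<le> 13824 * rho_norm p q (T_op g (test_fun e a))"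
    by (subst (asm) ennreal_le_iff) (auto simp: rho_norm_def)
  have "1 - (norm a)\<^sup>2 = (1 + norm a) * (1 - norm a)" by (simp add: power2_eq_square algebra_simps)
  also have "\<dots> \<le> 2 * (1 - norm a)" using a by (intro mult_right_mono) auto
  finally have "(1 - (norm a)\<^sup>2) * norm (deriv g a) \<le> 2 * ((1 - norm a) * norm (deriv g a))"
    unfolding mult.assoc[symmetric] by (intro mult_right_mono) auto
  with 1 show ?thesis by linarith
qed

text \<open>Isolates what the bounded and the compact case have in common: a uniform bound for the
  images of the test functions.\<close>

lemma bloch_if_rho_norm_le:
  assumes g: "g \<in> HD" and p: "1 \<le> p" and q: "1 \<le> q" and e: "e = 1 / p + 1 / enn2real q"
    and T: "\<And>a. norm a < 1 \<Longrightarrow> T_op g (test_fun e a) \<in> RM p q"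
    and B: "\<And>a. norm a < 1 \<Longrightarrow> rho_norm p q (T_op g (test_fun e a)) \<le> B"
  shows "g \<in> Bloch"
proof -
  have "(1 - (norm a)\<^sup>2) * norm (deriv g a) \<le> 27648 * B" if "a \<in> disc" for a
    using bloch_le_rho_norm[OF g p q e _ T, of a] B[of a] that by simp
  then have "bdd_above ((\<lambda>z. (1 - (norm z)\<^sup>2) * norm (deriv g z)) ` disc)"
    by (rule bdd_aboveI2)
  then show ?thesis using g by (simp add: Bloch_def)
qed

lemma bloch_if_bounded_op:
  assumes g: "g \<in> HD" and p: "1 \<le> p" and q: "1 \<le> q" and e: "e = 1 / p + 1 / enn2real q"
    and X: "X \<subseteq> RM p q" and test_fun: "\<And>a. norm a < 1 \<Longrightarrow> test_fun e a \<in> X"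
    and bd: "bounded_op X (rho_norm p q) (T_op g)"
  shows "g \<in> Bloch"
proof -
  obtain C where C: "T_op g ` X \<subseteq> X" "\<And>f. f \<in> X \<Longrightarrow> rho_norm p q (T_op g f) \<le> C * rho_norm p q f"
    using bd unfolding bounded_op_def by blast
  show ?thesis
  proof (rule bloch_if_rho_norm_le[OF g p q e])
    fix a :: complex assume a: "norm a < 1"
    show "T_op g (test_fun e a) \<in> RM p q" using C(1) X test_fun[OF a] by blast
    have "rho_norm p q (T_op g (test_fun e a)) \<le> C * rho_norm p q (test_fun e a)" by (rule C(2)[OF test_fun[OF a]])
    \<comment> \<open>\<open>bounded_op\<close> does not fix the sign of \<open>C\<close>.\<close>
    also have "\<dots> \<le> \<bar>C\<bar> * 1"
      using test_fun_RM(2)[OF a p q e] by (intro mult_mono) (auto simp: rho_norm_def)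
    finally show "rho_norm p q (T_op g (test_fun e a)) \<le> \<bar>C\<bar>" by simp
  qed
qed

text \<open>For fixed \<open>z\<close> the denominators are bounded below uniformly in
  \<open>a\<close>, so the scaling factor with its positive exponent \<open>3 - e\<close>
  decides.\<close>

lemma T_op_test_fun_tendsto_0:
  assumes g: "g \<in> HD" and a: "\<And>n. norm (a n) < 1" "(\<lambda>n. norm (a n)) \<longlonglongrightarrow> 1" and e: "e < 3" and z: "norm z < 1"
  shows "(\<lambda>n. T_op g (test_fun e (a n)) z) \<longlonglongrightarrow> 0"
proof -
  obtain A where A: "0 \<le> A" "\<And>w. norm w \<le> norm z \<Longrightarrow> norm (disc_deriv g w) \<le> A"
    using HD_bound_cball[OF disc_deriv_HD[OF g] z] by blast
  define c where "c = A / (1 - norm z) ^ 3 * norm z"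
  have le: "norm (T_op g (test_fun e (a n)) z) \<le> (1 - norm (a n)) powr (3 - e) * c" for n
  proof -
    let ?d = "(1 - norm (a n)) powr (3 - e)"
    have "norm (T_op g (test_fun e (a n)) z) \<le> (?d / (1 - norm z) ^ 3 * A) * norm z"
    proof (rule T_op_norm_le[OF test_fun_HD[OF a(1)] g z])
      fix w :: complex assume w: "norm w \<le> norm z"
      have "norm (test_fun e (a n) w) \<le> ?d / (1 - norm w) ^ 3"
        using w z by (intro norm_test_fun_le a) auto
      also have "\<dots> \<le> ?d / (1 - norm z) ^ 3"
        using w z by (intro divide_left_mono power_mono mult_pos_pos zero_less_power) auto
      finally have 1: "norm (test_fun e (a n) w) \<le> ?d / (1 - norm z) ^ 3" .
      moreover have "norm (deriv g w) \<le> A" using A(2)[OF w] w z by (simp add: disc_deriv_def)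
      ultimately show "norm (test_fun e (a n) w * deriv g w) \<le> ?d / (1 - norm z) ^ 3 * A"
        unfolding norm_mult using z by (intro mult_mono) auto
    qed
    then show ?thesis by (simp add: c_def)
  qed
  have "(\<lambda>n. (1 - norm (a n)) powr (3 - e) * c) \<longlonglongrightarrow> (1 - 1) powr (3 - e) * c"
    using a e by (intro tendsto_intros tendsto_powr') (auto intro!: always_eventually less_imp_le)
  then have lim: "(\<lambda>n. (1 - norm (a n)) powr (3 - e) * c) \<longlonglongrightarrow> 0" by simp
  show ?thesis
    by (rule Lim_null_comparison[OF always_eventually lim]) (use le in blast)
qed

text \<open>If the little Bloch condition failed along points \<open>a n\<close> with
  \<open>norm (a n)\<close> tending to 1, compactness would give a norm limit for a subsequence of
  the images. Its point values are 0, so the norms would tend to 0, against the lower bound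
  \<open>\<epsilon> / 27648\<close>.\<close>

lemma little_bloch_if_compact_op:
  assumes g: "g \<in> HD" and p: "1 \<le> p" and q: "1 \<le> q" and e: "e = 1 / p + 1 / enn2real q"
    and X: "X \<subseteq> RM p q" and test_fun: "\<And>a. norm a < 1 \<Longrightarrow> test_fun e a \<in> X"
    and c: "compact_op X (rho_norm p q) (T_op g)"
  shows "g \<in> little_Bloch"
proof -
  interpret R: Metric_space "RM p q" "\<lambda>f h. rho_norm p q (\<lambda>z. f z - h z)"
    by (rule Metric_space_RM[OF p q])
  interpret M: Metric_space X "\<lambda>f h. rho_norm p q (\<lambda>z. f z - h z)"
    by (rule R.subspace[OF X])
  let ?S = "T_op g ` {f \<in> X. rho_norm p q f \<le> 1}"
  have TX: "T_op g ` X \<subseteq> X" and comp: "compactin M.mtopology (M.mtopology closure_of ?S)"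
    using c unfolding compact_op_def norm_topology_def by blast+
  have sub: "?S \<subseteq> M.mtopology closure_of ?S"
    using TX by (intro closure_of_subset) auto
  have in_S: "T_op g (test_fun e a) \<in> ?S" if "norm a < 1" for a
    using test_fun[OF that] test_fun_RM(2)[OF that p q e] by blast
  have TR: "T_op g (test_fun e a) \<in> RM p q" if "norm a < 1" for a
    using TX X test_fun[OF that] by blast
  have e3: "e < 3"
  proof -
    have "1 / enn2real q \<le> 1"
      using enn2real_ge_1[OF q] by (cases "q = \<infinity>") auto
    moreover have "1 / p \<le> 1" using p by simp
    ultimately show ?thesis by (simp add: e)
  qed
  \<comment> \<open>Membership in \<open>Bloch\<close> is part of \<open>little_Bloch\<close> and is
    settled first: a compact set is bounded in the metric, and distances to the fixed image of
    \<open>test_fun e 0\<close> turn this into a bound on norms.\<close>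
  have "M.mbounded ?S" using M.mbounded_subset[OF M.compactin_imp_mbounded[OF comp] sub] .
  then obtain B where B: "\<And>x y. x \<in> ?S \<Longrightarrow> y \<in> ?S \<Longrightarrow> rho_norm p q (\<lambda>z. x z - y z) \<le> B"
    unfolding M.mbounded_alt by blast
  have zero: "(\<lambda>z. 0) \<in> RM p q"
    using RM_diff[OF TR TR p q, of 0 0] by simp
  let ?T0 = "T_op g (test_fun e 0)"
  have bound: "rho_norm p q (T_op g (test_fun e a)) \<le> B + rho_norm p q ?T0" if a: "norm a < 1" for a
  proof -
    have "rho_norm p q (\<lambda>z. T_op g (test_fun e a) z - 0) \<le> rho_norm p q (\<lambda>z. T_op g (test_fun e a) z - ?T0 z) + rho_norm p q (\<lambda>z. ?T0 z - 0)"
      using R.triangle[OF TR[OF a] TR[of 0] zero] by simp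
    then show ?thesis using B[OF in_S[OF a] in_S[of 0]] by simp
  qed
  have bloch: "g \<in> Bloch"
    by (rule bloch_if_rho_norm_le[OF g p q e]) (use TR bound in blast)+
  have lower: "(1 - (norm a)\<^sup>2) * norm (deriv g a) \<le> 27648 * rho_norm p q (T_op g (test_fun e a))"
    if "norm a < 1" for a
    by (rule bloch_le_rho_norm[OF g p q e that TR[OF that]])
  have "((\<lambda>z. (1 - (norm z)\<^sup>2) * norm (deriv g z)) \<longlongrightarrow> 0) (filtercomap norm (at_left 1))"
  proof (rule ccontr)
    let ?b = "\<lambda>z. (1 - (norm z)\<^sup>2) * norm (deriv g z)"
    assume "\<not> ?thesis"
    then obtain \<epsilon> where \<epsilon>: "0 < \<epsilon>" "\<not> eventually (\<lambda>z. dist (?b z) 0 < \<epsilon>) (filtercomap norm (at_left 1))"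
      unfolding tendsto_iff by blast
    \<comment> \<open>Each ring \<open>1 - 1 / Suc n < norm z < 1\<close> belongs to the filter, so
      it contains a point where the limit condition fails.\<close>
    have "\<exists>a. 1 - 1 / Suc n < norm a \<and> norm a < 1 \<and> \<epsilon> \<le> ?b a" for n
    proof (rule ccontr)
      assume no: "\<not> ?thesis"
      have "eventually (\<lambda>y. 1 - 1 / Suc n < y \<and> y < (1::real)) (at_left 1)"
        unfolding eventually_at_left_field by (intro exI[of _ "1 - 1 / Suc n"]) auto
      then have "eventually (\<lambda>z::complex. 1 - 1 / Suc n < norm z \<and> norm z < 1) (filtercomap norm (at_left 1))"
        by (rule eventually_filtercomapI)
      then have "eventually (\<lambda>z. dist (?b z) 0 < \<epsilon>) (filtercomap norm (at_left 1))"
      proof eventually_elim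
        case (elim z)
        then have "?b z < \<epsilon>" using no by force
        moreover have "0 \<le> ?b z" using elim by (intro mult_nonneg_nonneg) (auto simp: power_le_one)
        ultimately show ?case by (simp add: dist_norm abs_if)
      qed
      with \<epsilon>(2) show False by blast
    qed
    then obtain a where a: "\<And>n. 1 - 1 / Suc n < norm (a n)" "\<And>n. norm (a n) < 1" "\<And>n. \<epsilon> \<le> ?b (a n)"
      by metis
    have a1: "(\<lambda>n. norm (a n)) \<longlonglongrightarrow> 1"
    proof (rule tendsto_sandwich[of "\<lambda>n. 1 - 1 / Suc n" _ _ "\<lambda>_. 1"])
      show "(\<lambda>n. 1 - 1 / Suc n) \<longlonglongrightarrow> 1"
        using tendsto_diff[OF tendsto_const LIMSEQ_inverse_real_of_nat, of 1] by (simp add: inverse_eq_divide)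
    qed (use a in \<open>auto intro!: always_eventually less_imp_le\<close>)
    define y where "y n = T_op g (test_fun e (a n))" for n
    have yR: "y n \<in> RM p q" for n unfolding y_def by (rule TR[OF a(2)])
    have "range y \<subseteq> M.mtopology closure_of ?S"
      using sub in_S[OF a(2)] by (auto simp: y_def)
    then obtain l r where lr: "l \<in> M.mtopology closure_of ?S" "strict_mono r" "limitin M.mtopology (y \<circ> r) l sequentially"
      using comp unfolding M.compactin_sequentially by blast
    have lX: "l \<in> X" using lr(3) unfolding M.limit_metric_sequentially by blast
    have lR: "l \<in> RM p q" using lX X by blast
    have dist0: "(\<lambda>n. rho_norm p q (\<lambda>z. y (r n) z - l z)) \<longlonglongrightarrow> 0"
    proof (rule LIMSEQ_I)
      fix \<epsilon> :: real assume "0 < \<epsilon>"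
      then obtain N where "\<And>n. n \<ge> N \<Longrightarrow> rho_norm p q (\<lambda>z. (y \<circ> r) n z - l z) < \<epsilon>"
        using lr(3) unfolding M.limit_metric_sequentially by blast
      then show "\<exists>N. \<forall>n\<ge>N. norm (rho_norm p q (\<lambda>z. y (r n) z - l z) - 0) < \<epsilon>"
        by (auto simp: rho_norm_def)
    qed
    \<comment> \<open>The norm limit is also the pointwise limit, by the evaluation bound.\<close>
    have "l z = 0" for z
    proof (cases "norm z < 1")
      case True
      define w where "w = 64 * (1 - norm z) powr (- (1 + 1 / p + 1 / enn2real q))"
      have w: "0 \<le> w" by (simp add: w_def)
      have le: "norm (y (r n) z - l z) \<le> w * rho_norm p q (\<lambda>z. y (r n) z - l z)" for n
      proof -
        note D = RM_diff[OF yR[of "r n"] lR p q]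
        have "ennreal (norm (y (r n) z - l z)) \<le> ennreal w * rho p q (\<lambda>z. y (r n) z - l z)"
          unfolding w_def by (rule norm_le_rho[OF RM_D(1)[OF D] True p q])
        also have "\<dots> = ennreal (w * rho_norm p q (\<lambda>z. y (r n) z - l z))"
          unfolding ennreal_rho_norm[OF RM_D(2)[OF D], symmetric]
          using w by (intro ennreal_mult[symmetric]) (auto simp: rho_norm_def)
        finally show ?thesis
          using w by (subst (asm) ennreal_le_iff) (auto simp: rho_norm_def)
      qed
      have "(\<lambda>n. y (r n) z - l z) \<longlonglongrightarrow> 0"
        by (rule Lim_null_comparison[OF always_eventually tendsto_mult_right_zero[OF dist0, of w]]) (use le in blast)
      moreover have "(\<lambda>n. y (r n) z) \<longlonglongrightarrow> 0"
        using LIMSEQ_subseq_LIMSEQ[OF T_op_test_fun_tendsto_0[OF g a(2) a1 e3 True] lr(2)]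
        by (simp add: y_def o_def)
      ultimately have "(\<lambda>n. y (r n) z - (y (r n) z - l z)) \<longlonglongrightarrow> 0 - 0" by (intro tendsto_diff)
      then show ?thesis by (simp add: LIMSEQ_const_iff)
    next
      case False
      then show ?thesis using RM_D(1)[OF lR] by (simp add: HD_def)
    qed
    then have "(\<lambda>n. rho_norm p q (y (r n))) \<longlonglongrightarrow> 0" using dist0 by simp
    moreover have "\<epsilon> / 27648 \<le> rho_norm p q (y (r n))" for n
      using order_trans[OF a(3) lower[OF a(2)], of "r n"] by (simp add: y_def)
    ultimately have "\<epsilon> / 27648 \<le> 0"
      by (intro LIMSEQ_le_const[of _ 0]) auto
    with \<epsilon>(1) show False by simp
  qed
  with bloch show ?thesis by (simp add: little_Bloch_def)
qed

theorem theorem5p3: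
  fixes p :: real and q :: ennreal and g :: "complex \<Rightarrow> complex"
  assumes "1 \<le> p" and "1 \<le> q" and "g \<in> HD"
  shows "(bounded_op (RM p q) (rho_norm p q) (T_op g) \<longleftrightarrow> g \<in> Bloch) \<and>
         (bounded_op (RM0 p) (rho_norm p \<infinity>) (T_op g) \<longleftrightarrow> g \<in> Bloch) \<and>
         (compact_op (RM p q) (rho_norm p q) (T_op g) \<longleftrightarrow> g \<in> little_Bloch) \<and>
         (compact_op (RM0 p) (rho_norm p \<infinity>) (T_op g) \<longleftrightarrow> g \<in> little_Bloch)"
proof -
  note p = assms(1) and q = assms(2) and g = assms(3)
  have inf: "(1::ennreal) \<le> \<infinity>" by simp
  \<comment> \<open>Since \<open>enn2real \<infinity> = 0\<close> and division by 0 gives 0, the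
    exponent \<open>e\<close> for \<open>q = \<infinity>\<close> is \<open>1 / p\<close>, the one
    used for RM(p,0).\<close>
  have e0: "1 / p = 1 / p + 1 / enn2real \<infinity>" by simp
  have bl: "g \<in> Bloch" if "g \<in> little_Bloch" using that by (simp add: little_Bloch_def)
  note test_fun = test_fun_RM(1)[OF _ p q refl] and test0 = test_fun_RM0[OF _ p]
  have "bounded_op (RM p q) (rho_norm p q) (T_op g) \<longleftrightarrow> g \<in> Bloch"
    using bloch_if_bounded_op[OF g p q refl order_refl test_fun] bounded_op_if_bloch[OF _ p q order_refl] T_op_RM[OF _ _ p q]
    by blast
  moreover have "bounded_op (RM0 p) (rho_norm p \<infinity>) (T_op g) \<longleftrightarrow> g \<in> Bloch"
    using bloch_if_bounded_op[OF g p inf e0 RM0_subset_RM test0] bounded_op_if_bloch[OF _ p inf RM0_subset_RM] T_op_RM0_of_bloch[OF _ _ p]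
    by blast
  moreover have "compact_op (RM p q) (rho_norm p q) (T_op g) \<longleftrightarrow> g \<in> little_Bloch"
    using little_bloch_if_compact_op[OF g p q refl order_refl test_fun] compact_op_if_little_bloch[OF _ p q order_refl] T_op_RM[OF _ bl p q]
    by blast
  moreover have "compact_op (RM0 p) (rho_norm p \<infinity>) (T_op g) \<longleftrightarrow> g \<in> little_Bloch"
    using little_bloch_if_compact_op[OF g p inf e0 RM0_subset_RM test0] compact_op_if_little_bloch[OF _ p inf RM0_subset_RM] T_op_RM0_of_little_bloch[OF _ _ p]
    by blast
  ultimately show ?thesis by blast
qed

end
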